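(* Let $1\le p<\infty$. Assume that the metric measure space $X=(X,d,\mu)$ is complete, that $\mu$ is doubling, and that $X$ supports a $p$-Poincaré inequality. Let $U\subset X$ be quasiopen. Then a function $u:U\to[-\infty,\infty]$ is quasicontinuous if and only if it is measurable and finite q.e., and $u\circ\gamma$ is continuous for $p$-a.e. curve $\gamma:[0,l_\gamma]\to U$.
   Context: Setting: $1\le p<\infty$, and $X=(X,d,\mu)$ is a metric space with metric $d$ and a positive complete Borel measure $\mu$ such that $\mu(B)<\infty$ for all open balls $B\subset X$. Write $B(x_0,r)=\{x\in X:d(x,x_0)<r\}$ and, for $B=B(x_0,r)$ and $\delta>0$, $\delta B=B(x_0,\delta r)$. Curves: a curve is a continuous mapping from an interval. Only compact rectifiable curves are considered; they are nonconstant unless otherwise stated and parameterized by arc length $ds$, so $\gamma:[0,l_\gamma]\to X$ with $l_\gamma$ the length of $\gamma$. A property holds for $p$-almost every ($p$-a.e.) curve if it fails only for a curve family $\Gamma$ for which there is a nonnegative Borel function $\rho\in L^p(X)$ with $\int_\gamma\rho\,ds=\infty$ for every $\gamma\in\Gamma$. "For $p$-a.e. curve $\gamma:[0,l_\gamma]\to U$" means that the property may fail only for such an exceptional family of curves lying in $U$. Upper gradients: a nonnegative Borel function $g$ on $X$ is an upper gradient of $f:X\to[-\infty,\infty]$ if $|f(\gamma(0))-f(\gamma(l_\gamma))|\le\int_\gamma g\,ds$ for all nonconstant compact rectifiable curves $\gamma:[0,l_\gamma]\to X$, where the left-hand side is $\infty$ whenever at least one of its terms is infinite. Newtonian space and capacity: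 for measurable $f:X\to[-\infty,\infty]$ (defined everywhere), $\|f\|_{N^{1,p}(X)}=\bigl(\int_X|f|^p\,d\mu+\inf_g\int_X g^p\,d\mu\bigr)^{1/p}$, with infimum over all upper gradients $g$ of $f$, and $N^{1,p}(X)=\{f:\|f\|_{N^{1,p}(X)}<\infty\}$. For $E\subset X$, $C_p(E)=\inf_u\|u\|_{N^{1,p}(X)}^p$, the infimum being over all $u\in N^{1,p}(X)$ with $u\ge1$ on $E$. For a measurable set $U\subset X$, $N^{1,p}(U)$ and the intrinsic capacity $C_p^U$ are defined in the same way with $X$ replaced by the metric measure space $(U,d|_U,\mu|_U)$. A property holds q.e. (quasieverywhere) if the set where it fails has $C_p$-capacity zero. Doubling: there is $C>0$ such that $0<\mu(2B)\le C\mu(B)<\infty$ for all balls $B$. $p$-Poincaré inequality: there are constants $C>0$ and $\lambda\ge1$ such that for all balls $B\subset X$, all integrable functions $f$ on $X$ and all upper gradients $g$ of $f$, $$\frac1{\mu(B)}\int_B|f-f_B|\,d\mu\le C\,\mathrm{diam}(B)\Bigl(\frac1{\mu(\lambda B)}\int_{\lambda B}g^p\,d\mu\Bigr)^{1/p},\qquad f_B=\frac1{\mu(B)}\int_B f\,d\mu.$$ A set $U\subset X$ is quasiopen if for every $\varepsilon>0$ there is an open set $G\subset X$ with $C_p(G)<\varepsilon$ and $G\cup U$ open. Quasiopen sets are known to be measurable. Quasicontinuity: for measurable $U\subset X$, a function $u:U\to[-\infty,\infty]$ is $C_p^U$-quasicontinuous (resp. $C_p$-quasicontinuous) if for every $\varepsilon>0$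 there is a relatively open set $G\subset U$ with $C_p^U(G)<\varepsilon$ (resp. an open set $G\subset X$ with $C_p(G)<\varepsilon$) such that $u|_{U\setminus G}$ is finite and continuous. On quasiopen $U$ the two notions are equivalent, and "quasicontinuous" may be read in either sense. *)

theory Defs
  imports "HOL-Analysis.Analysis"
begin

(* Meant for exponents p > 0 only. *)
definition enn_powr :: "ennreal \<Rightarrow> real \<Rightarrow> ennreal" where
  "enn_powr a p = (if a = \<infinity> then \<infinity> else ennreal (enn2real a powr p))"

(* The sigma-algebra carrying a complete Borel measure is the completion of the Borel
   sigma-algebra. *)
definition complete_borel_measure :: "'a::metric_space measure \<Rightarrow> bool" where
  "complete_borel_measure M \<longleftrightarrow> (\<exists>N. sets N = sets borel \<and> M = completion N)"

definition doubling :: "'a::metric_space measure \<Rightarrow> bool" where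
  "doubling M \<longleftrightarrow> (\<exists>C>0. \<forall>x. \<forall>r>0.
     0 < emeasure M (ball x (2 * r)) \<and>
     emeasure M (ball x (2 * r)) \<le> ennreal C * emeasure M (ball x r) \<and>
     emeasure M (ball x r) < \<infinity>)"

definition curve_length :: "(real \<Rightarrow> 'a::metric_space) \<Rightarrow> real \<Rightarrow> real \<Rightarrow> ennreal" where
  "curve_length \<gamma> a b =
     (SUP ts \<in> {ts. sorted ts \<and> set ts \<subseteq> {a..b}}.
        \<Sum>i<length ts - 1. ennreal (dist (\<gamma> (ts ! i)) (\<gamma> (ts ! Suc i))))"

(* A nonconstant compact rectifiable curve parameterized by arc length is a pair (l, \<gamma>) of
   its length l and a map of which only the values on {0..l} matter. *)
definition arclength_curve :: "real \<times> (real \<Rightarrow> 'a::metric_space) \<Rightarrow> bool" where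
  "arclength_curve = (\<lambda>(l, \<gamma>). 0 < l \<and> continuous_on {0..l} \<gamma> \<and>
     (\<forall>t\<in>{0..l}. curve_length \<gamma> 0 t = ennreal t))"

definition curve_integral :: "real \<times> (real \<Rightarrow> 'a::metric_space) \<Rightarrow> ('a \<Rightarrow> ennreal) \<Rightarrow> ennreal" where
  "curve_integral = (\<lambda>(l, \<gamma>) g. \<integral>\<^sup>+t\<in>{0..l}. g (\<gamma> t) \<partial>lborel)"

definition p_exceptional ::
  "real \<Rightarrow> 'a::metric_space measure \<Rightarrow> (real \<times> (real \<Rightarrow> 'a)) set \<Rightarrow> bool" where
  "p_exceptional p M \<Gamma> \<longleftrightarrow>
     (\<exists>\<rho>. \<rho> \<in> borel_measurable borel \<and> (\<integral>\<^sup>+x. enn_powr (\<rho> x) p \<partial>M) < \<infinity> \<and>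
        (\<forall>c\<in>\<Gamma>. curve_integral c \<rho> = \<infinity>))"

definition p_ae_curve_in ::
  "real \<Rightarrow> 'a::metric_space measure \<Rightarrow> 'a set \<Rightarrow> (real \<Rightarrow> (real \<Rightarrow> 'a) \<Rightarrow> bool) \<Rightarrow> bool" where
  "p_ae_curve_in p M U P \<longleftrightarrow>
     p_exceptional p M {(l, \<gamma>). arclength_curve (l, \<gamma>) \<and> \<gamma> ` {0..l} \<subseteq> U \<and> \<not> P l \<gamma>}"

definition upper_gradient :: "('a::metric_space \<Rightarrow> ennreal) \<Rightarrow> ('a \<Rightarrow> ereal) \<Rightarrow> bool" where
  "upper_gradient g f \<longleftrightarrow> g \<in> borel_measurable borel \<and>
     (\<forall>l \<gamma>. arclength_curve (l, \<gamma>) \<longrightarrow>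
        (if \<bar>f (\<gamma> 0)\<bar> = \<infinity> \<or> \<bar>f (\<gamma> l)\<bar> = \<infinity> then \<infinity>
         else e2ennreal \<bar>f (\<gamma> 0) - f (\<gamma> l)\<bar>) \<le> curve_integral (l, \<gamma>) g)"

definition newtonian_norm :: "real \<Rightarrow> 'a::metric_space measure \<Rightarrow> ('a \<Rightarrow> ereal) \<Rightarrow> ennreal" where
  "newtonian_norm p M f =
     enn_powr ((\<integral>\<^sup>+x. enn_powr (e2ennreal \<bar>f x\<bar>) p \<partial>M) +
               (INF g \<in> {g. upper_gradient g f}. \<integral>\<^sup>+x. enn_powr (g x) p \<partial>M)) (1 / p)"

definition newtonian_space :: "real \<Rightarrow> 'a::metric_space measure \<Rightarrow> ('a \<Rightarrow> ereal) set" where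
  "newtonian_space p M = {f. f \<in> borel_measurable M \<and> newtonian_norm p M f < \<infinity>}"

definition capacity :: "real \<Rightarrow> 'a::metric_space measure \<Rightarrow> 'a set \<Rightarrow> ennreal" where
  "capacity p M E =
     (INF u \<in> {u \<in> newtonian_space p M. \<forall>x\<in>E. 1 \<le> u x}. enn_powr (newtonian_norm p M u) p)"

definition poincare_inequality :: "real \<Rightarrow> 'a::metric_space measure \<Rightarrow> bool" where
  "poincare_inequality p M \<longleftrightarrow> (\<exists>C>0. \<exists>\<Lambda>\<ge>1. \<forall>x. \<forall>r>0. \<forall>f g.
     f \<in> borel_measurable M \<and> (\<integral>\<^sup>+y. e2ennreal \<bar>f y\<bar> \<partial>M) < \<infinity> \<and> upper_gradient g f \<longrightarrow>
     (let B = ball x r; B' = ball x (\<Lambda> * r);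
          fB = (LINT y:B|M. real_of_ereal (f y)) / measure M B
      in (\<integral>\<^sup>+y\<in>B. e2ennreal \<bar>f y - ereal fB\<bar> \<partial>M) / emeasure M B
           \<le> ennreal (C * diameter B) *
              enn_powr ((\<integral>\<^sup>+y\<in>B'. enn_powr (g y) p \<partial>M) / emeasure M B') (1 / p)))"

definition quasiopen :: "real \<Rightarrow> 'a::metric_space measure \<Rightarrow> 'a set \<Rightarrow> bool" where
  "quasiopen p M U \<longleftrightarrow>
     (\<forall>\<epsilon>>0. \<exists>G. open G \<and> capacity p M G < ennreal \<epsilon> \<and> open (G \<union> U))"

(* Quasicontinuity with respect to the capacity of the ambient space (not the intrinsic
   capacity of U); only the values of u on U matter. *)
definition quasicontinuous_on ::
  "real \<Rightarrow> 'a::metric_space measure \<Rightarrow> 'a set \<Rightarrow> ('a \<Rightarrow> ereal) \<Rightarrow> bool" where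
  "quasicontinuous_on p M U u \<longleftrightarrow>
     (\<forall>\<epsilon>>0. \<exists>G. open G \<and> capacity p M G < ennreal \<epsilon> \<and>
        (\<forall>x\<in>U - G. \<bar>u x\<bar> \<noteq> \<infinity>) \<and> continuous_on (U - G) u)"

definition finite_qe_on ::
  "real \<Rightarrow> 'a::metric_space measure \<Rightarrow> 'a set \<Rightarrow> ('a \<Rightarrow> ereal) \<Rightarrow> bool" where
  "finite_qe_on p M U u \<longleftrightarrow> capacity p M {x \<in> U. \<bar>u x\<bar> = \<infinity>} = 0"

end

theory Submission
  imports Defs "HOL-Library.Diagonal_Subsequence"
begin

text \<open>If \<open>u\<close> is continuous off open sets \<open>G k\<close> of rapidly decreasing capacity, then almost every
  curve misses \<open>G k\<close> for all large \<open>k\<close>, so \<open>u\<close> is continuous along it.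

  Conversely, all exceptional families are controlled by one lower semicontinuous weight
  \<open>\<rho> \<ge> 1\<close>, locally in \<open>L\<^sup>p\<close>, with infinite integral along the exceptional curves. A bounded
  measurable function \<open>w\<close> with upper gradient \<open>\<rho>\<close> is squeezed between an upper and a lower
  semicontinuous function with the same upper gradient that agree with \<open>w\<close> on a closed set \<open>K\<close>
  given by Lusin's theorem: the extremal \<open>\<rho>\<close>-Lipschitz extensions of \<open>w\<close> restricted to \<open>K\<close>,
  which are semicontinuous by Arzela--Ascoli since closed balls are compact. Their difference
  has an upper gradient supported off \<open>K\<close>, hence small norm, and its superlevel sets are
  open; so \<open>w\<close> is quasicontinuous.
  A function that is merely continuous along curves is a supremum of such \<open>w\<close> off a set of
  capacity zero, and so is \<open>1 - u\<close> after compressing the range of \<open>u\<close> to the unit interval.\<close>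

section \<open>Powers of extended nonnegative reals\<close>

text \<open>Quasicontinuity asks for open exceptional sets, while a bound on capacity comes from a
  test function with an upper gradient. Superlevel sets of lower semicontinuous test functions serve
  both ends; this is why semicontinuity of the extremal extensions carries the converse. The
  normalization \<open>1 \<le> \<rho>\<close> has two uses. The length of a curve is at most its
  \<open>\<rho>\<close>-integral, so near-minimizing curves live on bounded parameter intervals; and
  the measure with density \<open>\<rho>\<close> to the power \<open>p\<close> dominates both terms
  of the Newtonian norm of a function with values in the unit interval. The price is that
  \<open>\<rho>\<close> is only locally p-integrable, which suffices because only its integrals over
  open sets chosen small enter. The weight is also infinite on a null set off which closed pieces
  from Lusin's theorem cover the space. A curve of finite weight meets these pieces at almost every
  parameter, and values on the null set are controlled through continuity along the curve.\<close>

lemma enn_powr_mono: "a \<le> b \<Longrightarrow> 0 < p \<Longrightarrow> enn_powr a p \<le> enn_powr b p"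
  unfolding enn_powr_def
  by (auto simp: top_unique less_top intro!: ennreal_leI powr_mono2 enn2real_mono)

lemma enn_powr_inverse: "0 < p \<Longrightarrow> enn_powr (enn_powr a (1 / p)) p = a"
  by (cases a) (auto simp: enn_powr_def powr_powr)

lemma enn_powr_inverse': "0 < p \<Longrightarrow> enn_powr (enn_powr a p) (1 / p) = a"
  using enn_powr_inverse[of "1 / p" a] by simp

lemma enn_powr_le_iff: "0 < p \<Longrightarrow> enn_powr a p \<le> enn_powr b p \<longleftrightarrow> a \<le> b"
  by (metis enn_powr_mono enn_powr_inverse' zero_less_divide_1_iff)

lemma enn_powr_less_iff: "0 < p \<Longrightarrow> enn_powr a p < enn_powr b p \<longleftrightarrow> a < b"
  by (meson enn_powr_le_iff not_less)

lemma enn_powr_ennreal: "0 \<le> x \<Longrightarrow> enn_powr (ennreal x) p = ennreal (x powr p)"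
  by (simp add: enn_powr_def)

lemma enn_powr_zero [simp]: "enn_powr 0 p = 0"
  by (simp add: enn_powr_def)

lemma enn_powr_one [simp]: "enn_powr 1 p = 1"
  by (simp add: enn_powr_def)

lemma enn_powr_top [simp]: "enn_powr top p = top"
  by (simp add: enn_powr_def)

lemma enn_powr_less_top: "enn_powr a p < top \<longleftrightarrow> a < top"
  by (auto simp: enn_powr_def less_top)

lemma enn_powr_mult: "enn_powr (a * b) p = enn_powr a p * enn_powr b p" if "0 < p"
proof (cases a; cases b)
  fix r s assume "0 \<le> r" "a = ennreal r" "0 \<le> s" "b = ennreal s"
  then show ?thesis
    by (simp add: enn_powr_def ennreal_mult[symmetric] powr_mult)
qed (use that in \<open>auto simp: enn_powr_def ennreal_mult_top ennreal_top_mult ennreal_mult_eq_top_iff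
       powr_nonneg_iff ennreal_eq_0_iff\<close>)

lemma enn_powr_measurable [measurable]: "(\<lambda>a. enn_powr a p) \<in> borel_measurable borel"
  unfolding enn_powr_def by measurable

text \<open>Each \<open>a k\<close> is at most the \<open>1 / p\<close>-th power of the sum, hence
  so is the supremum; only monotonicity of powers enters. This is how the norms of suprema of test
  functions and of upper gradients are summed.\<close>

lemma enn_powr_SUP_le:
  assumes "0 < p"
  shows "enn_powr (SUP k. a k) p \<le> (\<Sum>k. enn_powr (a k) p)"
proof -
  have "enn_powr (a k) p \<le> (\<Sum>k. enn_powr (a k) p)" for k
    using sum_le_suminf[of "\<lambda>k. enn_powr (a k) p" "{k}"] by (simp add: summableI)
  then have "a k \<le> enn_powr (\<Sum>k. enn_powr (a k) p) (1 / p)" for k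
    by (metis enn_powr_mono enn_powr_inverse' assms zero_less_divide_1_iff)
  then have "(SUP k. a k) \<le> enn_powr (\<Sum>k. enn_powr (a k) p) (1 / p)"
    by (rule SUP_least)
  then show ?thesis
    by (metis enn_powr_mono enn_powr_inverse assms)
qed

lemma enn_powr_max_le: "0 < p \<Longrightarrow> enn_powr (max a b) p \<le> enn_powr a p + enn_powr b p"
  by (auto simp: max_def)

section \<open>Curve length\<close>

text \<open>Lipschitz on the whole line, so that shifts, reversals and limits need no care about
  domains and the curve is Borel measurable.\<close>

definition lip1 :: "(real \<Rightarrow> 'a::metric_space) \<Rightarrow> bool" where
  "lip1 \<gamma> \<longleftrightarrow> (\<forall>s t. dist (\<gamma> s) (\<gamma> t) \<le> \<bar>s - t\<bar>)"

lemma lip1I: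
  assumes "\<And>s t. s \<le> t \<Longrightarrow> dist (\<gamma> s) (\<gamma> t) \<le> t - s"
  shows "lip1 \<gamma>"
  unfolding lip1_def
proof (intro allI)
  fix s t
  show "dist (\<gamma> s) (\<gamma> t) \<le> \<bar>s - t\<bar>"
    using assms[of s t] assms[of t s] by (cases "s \<le> t") (auto simp: dist_commute)
qed

lemma lip1D: "lip1 \<gamma> \<Longrightarrow> dist (\<gamma> s) (\<gamma> t) \<le> \<bar>s - t\<bar>"
  by (simp add: lip1_def)

lemma lip1_continuous: "lip1 \<gamma> \<Longrightarrow> continuous_on A \<gamma>"
  unfolding continuous_on_iff
  by (metis lip1D dist_real_def le_less_trans)

lemma lip1_comp:
  assumes "lip1 \<gamma>" "\<And>s t. \<bar>f s - f t\<bar> \<le> \<bar>s - t\<bar>"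
  shows "lip1 (\<lambda>t. \<gamma> (f t))"
  using assms unfolding lip1_def by (meson order_trans)

lemma lip1_measurable [measurable_dest]: "lip1 \<gamma> \<Longrightarrow> \<gamma> \<in> borel_measurable borel"
  by (intro borel_measurable_continuous_onI lip1_continuous)

section \<open>Partition sums and the additivity of length\<close>

definition variation_sum :: "(real \<Rightarrow> 'a::metric_space) \<Rightarrow> real list \<Rightarrow> real" where
  "variation_sum \<gamma> ts = (\<Sum>i<length ts - 1. dist (\<gamma> (ts ! i)) (\<gamma> (ts ! Suc i)))"

lemma curve_length_alt:
  "curve_length \<gamma> a b = (SUP ts \<in> {ts. sorted ts \<and> set ts \<subseteq> {a..b}}. ennreal (variation_sum \<gamma> ts))"
  unfolding curve_length_def variation_sum_def by (simp add: sum_ennreal)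

lemma variation_sum_Nil [simp]: "variation_sum \<gamma> [] = 0"
  and variation_sum_single [simp]: "variation_sum \<gamma> [x] = 0"
  and variation_sum_Cons2 [simp]: 
    "variation_sum \<gamma> (x # y # ts) = dist (\<gamma> x) (\<gamma> y) + variation_sum \<gamma> (y # ts)"
  by (simp_all add: variation_sum_def sum.lessThan_Suc_shift del: sum.lessThan_Suc)

lemma variation_sum_nonneg [simp]: "0 \<le> variation_sum \<gamma> ts"
  by (simp add: variation_sum_def sum_nonneg)

lemma variation_sum_map: "variation_sum \<gamma> (map f ts) = variation_sum (\<lambda>t. \<gamma> (f t)) ts"
  by (induction ts rule: induct_list012) auto

lemma variation_sum_cong:
  "(\<And>t. t \<in> set ts \<Longrightarrow> \<gamma> t = \<gamma>' t) \<Longrightarrow> variation_sum \<gamma> ts = variation_sum \<gamma>' ts"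
  by (induction ts rule: induct_list012) auto

lemma variation_sum_snoc:
  "ts \<noteq> [] \<Longrightarrow> variation_sum \<gamma> (ts @ [b]) = variation_sum \<gamma> ts + dist (\<gamma> (last ts)) (\<gamma> b)"
  by (induction ts rule: induct_list012) auto

lemma variation_sum_le_add:
  assumes "sorted ts"
    and "\<And>s t. s \<in> set ts \<Longrightarrow> t \<in> set ts \<Longrightarrow> s \<le> t \<Longrightarrow>
      dist (\<gamma> s) (\<gamma> t) \<le> dist (\<alpha> s) (\<alpha> t) + dist (\<beta> s) (\<beta> t)"
  shows "variation_sum \<gamma> ts \<le> variation_sum \<alpha> ts + variation_sum \<beta> ts"
  using assms
proof (induction ts rule: induct_list012)
  case (3 x y ts)
  have "dist (\<gamma> x) (\<gamma> y) \<le> dist (\<alpha> x) (\<alpha> y) + dist (\<beta> x) (\<beta> y)"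
    using 3 by auto
  moreover have "variation_sum \<gamma> (y # ts) \<le> variation_sum \<alpha> (y # ts) + variation_sum \<beta> (y # ts)"
    using 3 by auto
  ultimately show ?case by auto
qed auto

lemma variation_sum_lip1:
  assumes "sorted ts" "set ts \<subseteq> {a..b}" "a \<le> b"
    and "\<And>s t. a \<le> s \<Longrightarrow> s \<le> t \<Longrightarrow> t \<le> b \<Longrightarrow> dist (\<gamma> s) (\<gamma> t) \<le> t - s"
  shows "variation_sum \<gamma> ts \<le> b - a"
proof -
  have "ts \<noteq> [] \<Longrightarrow> variation_sum \<gamma> ts \<le> b - hd ts"
    using assms(1,2)
  proof (induction ts rule: induct_list012)
    case (3 x y ts)
    then show ?case using assms(4)[of x y] by auto
  qed auto
  then show ?thesis
    using assms(2,3) by (cases ts) (auto intro: order_trans)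
qed

lemma curve_length_lip1:
  assumes "0 \<le> b" "\<And>s t. 0 \<le> s \<Longrightarrow> s \<le> t \<Longrightarrow> t \<le> b \<Longrightarrow> dist (\<gamma> s) (\<gamma> t) \<le> t - s"
  shows "curve_length \<gamma> 0 b \<le> ennreal b"
  unfolding curve_length_alt
  using variation_sum_lip1[of _ 0 b \<gamma>] assms by (auto intro!: SUP_least ennreal_leI)

lemma curve_length_upper:
  "sorted ts \<Longrightarrow> set ts \<subseteq> {a..b} \<Longrightarrow> ennreal (variation_sum \<gamma> ts) \<le> curve_length \<gamma> a b"
  unfolding curve_length_alt by (rule SUP_upper) auto

text \<open>Appending \<open>a\<close> and then \<open>b\<close> to a partition of
  \<open>{0..a}\<close> makes the chord from \<open>a\<close> to \<open>b\<close> the last summand.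
  This bounds chords by increments of length.\<close>

lemma curve_length_add_dist:
  assumes "0 \<le> a" "a \<le> b"
  shows "curve_length \<gamma> 0 a + ennreal (dist (\<gamma> a) (\<gamma> b)) \<le> curve_length \<gamma> 0 b"
proof -
  have "ennreal (variation_sum \<gamma> ts) + ennreal (dist (\<gamma> a) (\<gamma> b)) \<le> curve_length \<gamma> 0 b"
    if ts: "sorted ts" "set ts \<subseteq> {0..a}" for ts
  proof -
    have "variation_sum \<gamma> ts \<le> variation_sum \<gamma> (ts @ [a])"
      by (cases "ts = []") (auto simp: variation_sum_snoc)
    then have "variation_sum \<gamma> ts + dist (\<gamma> a) (\<gamma> b) \<le> variation_sum \<gamma> ((ts @ [a]) @ [b])"
      by (subst variation_sum_snoc) auto
    moreover have "sorted ((ts @ [a]) @ [b])" "set ((ts @ [a]) @ [b]) \<subseteq> {0..b}"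
      using ts assms by (auto simp: sorted_append intro: order_trans)
    ultimately show ?thesis
      using curve_length_upper[of "(ts @ [a]) @ [b]" 0 b \<gamma>]
      by (metis ennreal_leI order_trans ennreal_plus variation_sum_nonneg zero_le_dist)
  qed
  moreover have "{ts::real list. sorted ts \<and> set ts \<subseteq> {0..a}} \<noteq> {}"
    by (auto intro!: exI[of _ "[]"])
  ultimately show ?thesis
    unfolding curve_length_alt[of \<gamma> 0 a]
    by (subst ennreal_SUP_add_left[symmetric]) (auto intro!: SUP_least)
qed

text \<open>Splitting a partition at \<open>a\<close> is done by the maps \<open>min a\<close> and \<open>max a\<close>.\<close>

lemma curve_length_split:
  assumes "0 \<le> a" "a \<le> b"
  shows "curve_length \<gamma> 0 b \<le> curve_length \<gamma> 0 a + curve_length (\<lambda>t. \<gamma> (a + t)) 0 (b - a)"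
proof -
  have "ennreal (variation_sum \<gamma> ts) \<le> curve_length \<gamma> 0 a + curve_length (\<lambda>t. \<gamma> (a + t)) 0 (b - a)"
    if ts: "sorted ts" "set ts \<subseteq> {0..b}" for ts
  proof -
    have "dist (\<gamma> s) (\<gamma> t) \<le> dist (\<gamma> (min a s)) (\<gamma> (min a t)) + dist (\<gamma> (max a s)) (\<gamma> (max a t))"
      if "s \<le> t" for s t
      using that dist_triangle[of "\<gamma> s" "\<gamma> t" "\<gamma> a"]
      by (auto simp: min_def max_def)
    then have "variation_sum \<gamma> ts \<le> variation_sum (\<lambda>t. \<gamma> (min a t)) ts + variation_sum (\<lambda>t. \<gamma> (max a t)) ts"
      by (intro variation_sum_le_add ts) auto
    also have "\<dots> = variation_sum \<gamma> (map (min a) ts) +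
                     variation_sum (\<lambda>t. \<gamma> (a + t)) (map (\<lambda>t. max a t - a) ts)"
      by (simp add: variation_sum_map)
    finally have "ennreal (variation_sum \<gamma> ts) \<le> ennreal (variation_sum \<gamma> (map (min a) ts)) +
                     ennreal (variation_sum (\<lambda>t. \<gamma> (a + t)) (map (\<lambda>t. max a t - a) ts))"
      by (metis ennreal_leI ennreal_plus variation_sum_nonneg)
    also have "\<dots> \<le> curve_length \<gamma> 0 a + curve_length (\<lambda>t. \<gamma> (a + t)) 0 (b - a)"
    proof (intro add_mono curve_length_upper)
      have "mono (min a)" "mono (\<lambda>t. max a t - a)" by (auto intro!: monoI simp: min_def max_def)
      then show "sorted (map (min a) ts)" "sorted (map (\<lambda>t. max a t - a) ts)"
        using ts(1) by (auto simp: sorted_map mono_def intro: sorted_wrt_mono_rel[of ts "(\<le>)"])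
      show "set (map (min a) ts) \<subseteq> {0..a}" "set (map (\<lambda>t. max a t - a) ts) \<subseteq> {0..b - a}"
        using ts(2) assms by auto
    qed
    finally show ?thesis .
  qed
  then show ?thesis
    unfolding curve_length_alt[of \<gamma> 0 b] by (auto intro!: SUP_least)
qed

lemma arclength_curve_lip:
  assumes "arclength_curve (l, \<gamma>)" "0 \<le> s" "s \<le> t" "t \<le> l"
  shows "dist (\<gamma> s) (\<gamma> t) \<le> t - s"
proof -
  have "curve_length \<gamma> 0 s = ennreal s" "curve_length \<gamma> 0 t = ennreal t"
    using assms by (auto simp: arclength_curve_def)
  then have "ennreal s + ennreal (dist (\<gamma> s) (\<gamma> t)) \<le> ennreal t"
    using curve_length_add_dist[of s t \<gamma>] assms by simp
  then show ?thesis
    using assms by (simp flip: ennreal_plus)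
qed

text \<open>A curve matters only on \<open>{0..l}\<close>; clamping the parameter makes it 1-Lipschitz on all of
  \<open>\<real>\<close>.\<close>

definition clamp_to :: "real \<Rightarrow> real \<Rightarrow> real" where
  "clamp_to l t = max 0 (min l t)"

lemma arclength_curve_clamp_lip1:
  assumes "arclength_curve (l, \<gamma>)"
  shows "lip1 (\<lambda>t. \<gamma> (clamp_to l t))"
proof (rule lip1I)
  fix s t :: real assume "s \<le> t"
  moreover have "0 < l" using assms by (simp add: arclength_curve_def)
  ultimately have "dist (\<gamma> (clamp_to l s)) (\<gamma> (clamp_to l t)) \<le> clamp_to l t - clamp_to l s"
    by (intro arclength_curve_lip[OF assms]) (auto simp: clamp_to_def)
  also have "\<dots> \<le> t - s" using \<open>s \<le> t\<close> by (auto simp: clamp_to_def)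
  finally show "dist (\<gamma> (clamp_to l s)) (\<gamma> (clamp_to l t)) \<le> t - s" .
qed

lemma clamp_to_id: "t \<in> {0..l} \<Longrightarrow> clamp_to l t = t"
  by (auto simp: clamp_to_def)

text \<open>The upper bound on the length comes from the Lipschitz property, the lower one from
  subadditivity: the length \<open>a\<close> of the discarded initial piece is finite and
  cancels.\<close>

lemma arclength_curve_subcurve:
  assumes \<gamma>: "arclength_curve (l, \<gamma>)" and "0 \<le> a" "a < b" "b \<le> l"
  shows "arclength_curve (b - a, \<lambda>t. \<gamma> (a + t))"
proof -
  have "curve_length (\<lambda>t. \<gamma> (a + t)) 0 t = ennreal t" if "t \<in> {0..b - a}" for t
  proof (rule antisym)
    show "curve_length (\<lambda>t. \<gamma> (a + t)) 0 t \<le> ennreal t"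
    proof (rule curve_length_lip1)
      fix s r assume "0 \<le> s" "s \<le> r" "r \<le> t"
      then show "dist (\<gamma> (a + s)) (\<gamma> (a + r)) \<le> r - s"
        using arclength_curve_lip[OF \<gamma>, of "a + s" "a + r"] assms that by auto
    qed (use that in auto)
    have "curve_length \<gamma> 0 (a + t) \<le> curve_length \<gamma> 0 a + curve_length (\<lambda>t. \<gamma> (a + t)) 0 t"
      using curve_length_split[of a "a + t" \<gamma>] that assms by auto
    moreover have "curve_length \<gamma> 0 (a + t) = ennreal (a + t)" "curve_length \<gamma> 0 a = ennreal a"
      using \<gamma> that assms by (auto simp: arclength_curve_def)
    ultimately have "ennreal a + ennreal t \<le> ennreal a + curve_length (\<lambda>t. \<gamma> (a + t)) 0 t"
      using that assms by simp
    then show "ennreal t \<le> curve_length (\<lambda>t. \<gamma> (a + t)) 0 t"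
      by (simp add: ennreal_add_left_cancel_le)
  qed
  moreover have "continuous_on {0..b - a} (\<lambda>t. \<gamma> (a + t))"
  proof (rule continuous_on_compose2[where g = \<gamma> and f = "(+) a"])
    show "continuous_on {0..l} \<gamma>" using \<gamma> by (simp add: arclength_curve_def)
    show "continuous_on {0..b - a} ((+) a)" by (intro continuous_intros)
    show "(+) a ` {0..b - a} \<subseteq> {0..l}" using assms(2-) by auto
  qed
  ultimately show ?thesis
    using assms by (simp add: arclength_curve_def)
qed

section \<open>Lower semicontinuity and arc length reparametrization\<close>

definition lsc :: "('a::topological_space \<Rightarrow> ennreal) \<Rightarrow> bool" where
  "lsc f \<longleftrightarrow> (\<forall>c. open {x. c < f x})"

lemma lsc_eventually:
  assumes "lsc f" "(\<gamma> \<longlongrightarrow> x) F" "c < f x"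
  shows "\<forall>\<^sub>F n in F. c < f (\<gamma> n)"
  using topological_tendstoD[OF assms(2), of "{x. c < f x}"] assms by (simp add: lsc_def)

lemma lsc_le_Liminf:
  assumes "lsc f" "(\<gamma> \<longlongrightarrow> x) F"
  shows "f x \<le> Liminf F (\<lambda>n. f (\<gamma> n))"
  unfolding le_Liminf_iff using lsc_eventually[OF assms] by blast

lemma lsc_measurable [measurable_dest]: "lsc f \<Longrightarrow> f \<in> borel_measurable borel"
  by (rule borel_measurableI_greater) (auto simp: lsc_def)

text \<open>Lower Riemann sums suffice here because the integrand is lower semicontinuous.\<close>

lemma nn_integral_lip_reparam:
  fixes q :: "real \<Rightarrow> ennreal" and s :: "real \<Rightarrow> real"
  assumes lsc: "\<And>\<sigma> c. \<sigma> \<in> {0..S} \<Longrightarrow> c < q \<sigma> \<Longrightarrow>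
      \<exists>\<delta>>0. \<forall>\<sigma>'\<in>{0..S}. \<bar>\<sigma>' - \<sigma>\<bar> < \<delta> \<longrightarrow> c < q \<sigma>'"
    and "0 < S"
    and mono: "\<And>t t'. 0 \<le> t \<Longrightarrow> t \<le> t' \<Longrightarrow> t' \<le> L \<Longrightarrow> s t \<le> s t' \<and> s t' - s t \<le> t' - t"
    and onto: "s ` {0..L} = {0..S}"
  shows "(\<integral>\<^sup>+\<sigma>\<in>{0..S}. q \<sigma> \<partial>lborel) \<le> (\<integral>\<^sup>+t\<in>{0..L}. q (s t) \<partial>lborel)"
proof -
  \<comment> \<open>A right inverse of \<open>s\<close>, in general discontinuous. Since
    \<open>s\<close> contracts, \<open>\<tau>\<close> expands, which gives the inequality between
    the Riemann sums below.\<close>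
  define \<tau> where "\<tau> \<sigma> = (SOME t. t \<in> {0..L} \<and> s t = \<sigma>)" for \<sigma>
  have \<tau>: "\<tau> \<sigma> \<in> {0..L}" "s (\<tau> \<sigma>) = \<sigma>" if "\<sigma> \<in> {0..S}" for \<sigma>
  proof -
    have "\<exists>t. t \<in> {0..L} \<and> s t = \<sigma>" using that onto by (metis imageE)
    from someI_ex[OF this] show "\<tau> \<sigma> \<in> {0..L}" "s (\<tau> \<sigma>) = \<sigma>" unfolding \<tau>_def by blast+
  qed
  have \<tau>_mono: "\<tau> \<sigma> \<le> \<tau> \<sigma>'" and \<tau>_expand: "\<sigma>' - \<sigma> \<le> \<tau> \<sigma>' - \<tau> \<sigma>"
    if "0 \<le> \<sigma>" "\<sigma> < \<sigma>'" "\<sigma>' \<le> S" for \<sigma> \<sigma>'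
  proof -
    show "\<tau> \<sigma> \<le> \<tau> \<sigma>'"
      using \<tau>[of \<sigma>] \<tau>[of \<sigma>'] mono[of "\<tau> \<sigma>'" "\<tau> \<sigma>"] that by (cases "\<tau> \<sigma>' \<le> \<tau> \<sigma>") auto
    then show "\<sigma>' - \<sigma> \<le> \<tau> \<sigma>' - \<tau> \<sigma>"
      using \<tau>[of \<sigma>] \<tau>[of \<sigma>'] mono[of "\<tau> \<sigma>" "\<tau> \<sigma>'"] that by auto
  qed
  define P where "P n i = S * real i / real (Suc n)" for n i :: nat
  \<comment> \<open>The cells are open on the left to be disjoint, so the point \<open>0\<close> is
    lost; it is discarded at the end as a null set. The infimum runs over the closed cell because
    \<open>s\<close> may take an end value on a whole interval.\<close>
  define I where "I n i = {P n i<..P n (Suc i)}" for n i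
  define m where "m n i = (INF \<sigma>\<in>{P n i..P n (Suc i)}. q \<sigma>)" for n i
  define Q where "Q n \<sigma> = (\<Sum>i<Suc n. m n i * indicator (I n i) \<sigma>)" for n \<sigma>
  have P: "0 \<le> P n i" "P n i < P n (Suc i)" for n i
    using \<open>0 < S\<close> by (auto simp: P_def field_simps intro: add_pos_nonneg)
  have P_le: "P n (Suc i) \<le> S" if "i < Suc n" for n i
    using \<open>0 < S\<close> that by (auto simp: P_def field_simps mult_left_mono)
  have P_mono: "P n i \<le> P n j" if "i \<le> j" for n i j
    using \<open>0 < S\<close> that unfolding P_def by (intro divide_right_mono mult_left_mono) auto
  have I_cover: "\<exists>i<Suc n. \<sigma> \<in> I n i" if "\<sigma> \<in> {0<..S}" for \<sigma> n
  proof -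
    define i where "i = nat (\<lceil>\<sigma> * real (Suc n) / S\<rceil> - 1)"
    have pos: "0 < \<sigma> * real (Suc n) / S" using that \<open>0 < S\<close> by simp
    have "\<sigma> * real (Suc n) / S \<le> real (Suc n)"
      using that \<open>0 < S\<close> by (simp add: pos_divide_le_eq mult.commute mult_left_mono)
    then have "\<lceil>\<sigma> * real (Suc n) / S\<rceil> \<le> int (Suc n)"
      by (simp add: ceiling_le_iff)
    moreover have c1: "1 \<le> \<lceil>\<sigma> * real (Suc n) / S\<rceil>"
      using pos by linarith
    ultimately have "i < Suc n" by (auto simp: i_def)
    have "real i = of_int \<lceil>\<sigma> * real (Suc n) / S\<rceil> - 1"
      using c1 by (simp add: i_def)
    then have "real i < \<sigma> * real (Suc n) / S" "\<sigma> * real (Suc n) / S \<le> real (Suc i)"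
      by linarith+
    then have "\<sigma> \<in> I n i"
      using \<open>0 < S\<close> unfolding I_def P_def by (simp add: field_simps)
    with \<open>i < Suc n\<close> show ?thesis by blast
  qed
  have Q_lower: "Q n \<sigma> \<ge> c" if "\<sigma> \<in> {0<..S}" "\<And>\<sigma>'. \<sigma>' \<in> {0..S} \<Longrightarrow> \<bar>\<sigma>' - \<sigma>\<bar> < \<delta> \<Longrightarrow> c < q \<sigma>'"
    "S / real (Suc n) < \<delta>" for n \<sigma> c \<delta>
  proof -
    obtain i where i: "i < Suc n" "\<sigma> \<in> I n i" using I_cover \<open>\<sigma> \<in> _\<close> by blast
    have "c \<le> m n i"
      unfolding m_def
    proof (rule INF_greatest)
      fix \<sigma>' assume \<sigma>': "\<sigma>' \<in> {P n i..P n (Suc i)}"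
      moreover have "P n (Suc i) - P n i = S / real (Suc n)"
        by (simp add: P_def diff_divide_distrib[symmetric] right_diff_distrib[symmetric])
      ultimately have "\<bar>\<sigma>' - \<sigma>\<bar> < \<delta>"
        using i that(3) by (auto simp: I_def)
      then show "c \<le> q \<sigma>'" using that(2)[of \<sigma>'] P(1)[of n i] P_le[OF i(1)] \<sigma>' by (auto intro: less_imp_le)
    qed
    also have "m n i = m n i * indicator (I n i) \<sigma>" using i by simp
    also have "\<dots> \<le> Q n \<sigma>"
      unfolding Q_def using i by (intro member_le_sum) auto
    finally show ?thesis .
  qed
  have liminf: "q \<sigma> \<le> liminf (\<lambda>n. Q n \<sigma>)" if \<sigma>: "\<sigma> \<in> {0<..S}" for \<sigma>
    unfolding le_Liminf_iff
  proof (intro allI impI)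
    fix c assume "c < q \<sigma>"
    then obtain c' where c': "c < c'" "c' < q \<sigma>" using dense by blast
    then obtain \<delta> where \<delta>: "\<delta> > 0" "\<forall>\<sigma>'\<in>{0..S}. \<bar>\<sigma>' - \<sigma>\<bar> < \<delta> \<longrightarrow> c' < q \<sigma>'"
      using lsc[of \<sigma> c'] \<sigma> by auto
    have "(\<lambda>n. S / real (Suc n)) \<longlonglongrightarrow> 0"
      using LIMSEQ_Suc[OF lim_const_over_n[of S]] by simp
    then have "\<forall>\<^sub>F n in sequentially. S / real (Suc n) < \<delta>"
      using \<delta>(1) by (rule order_tendstoD)
    then show "\<forall>\<^sub>F n in sequentially. c < Q n \<sigma>"
    proof eventually_elim
      case (elim n)
      then show ?case using Q_lower[OF \<sigma>, of \<delta> c' n] \<delta>(2) c'(1) by auto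
    qed
  qed
  have Q_int: "(\<integral>\<^sup>+\<sigma>. Q n \<sigma> \<partial>lborel) \<le> (\<integral>\<^sup>+t\<in>{0..L}. q (s t) \<partial>lborel)" for n
  proof -
    \<comment> \<open>Open image intervals are pairwise disjoint, and monotonicity of
      \<open>s\<close> sends each of them back into its closed cell.\<close>
    define J where "J i = {\<tau> (P n i)<..<\<tau> (P n (Suc i))}" for i
    have PS: "P n i \<in> {0..S}" "P n (Suc i) \<in> {0..S}" if "i < Suc n" for i
      using P[of n i] P_le[OF that] by auto
    have "(\<integral>\<^sup>+\<sigma>. Q n \<sigma> \<partial>lborel) = (\<Sum>i<Suc n. m n i * ennreal (P n (Suc i) - P n i))"
      unfolding Q_def using P
      by (subst nn_integral_sum) (auto simp: I_def nn_integral_cmult_indicator less_imp_le)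
    also have "\<dots> \<le> (\<Sum>i<Suc n. m n i * ennreal (\<tau> (P n (Suc i)) - \<tau> (P n i)))"
      using P P_le by (intro sum_mono mult_left_mono ennreal_leI \<tau>_expand) auto
    also have "\<dots> = (\<integral>\<^sup>+t. (\<Sum>i<Suc n. m n i * indicator (J i) t) \<partial>lborel)"
      using P P_le \<tau>_mono
      by (subst nn_integral_sum) (auto simp: J_def nn_integral_cmult_indicator)
    also have "\<dots> \<le> (\<integral>\<^sup>+t\<in>{0..L}. q (s t) \<partial>lborel)"
    proof (rule nn_integral_mono)
      fix t
      show "(\<Sum>i<Suc n. m n i * indicator (J i) t) \<le> q (s t) * indicator {0..L} t"
      proof (cases "\<exists>i<Suc n. t \<in> J i")
        case False
        then have "(\<Sum>i<Suc n. m n i * indicator (J i) t) = 0" by (intro sum.neutral) auto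
        then show ?thesis by (metis zero_le)
      next
        case True
        then obtain i where i: "i < Suc n" "t \<in> J i" by blast
        have tL: "t \<in> {0..L}" using i PS[OF i(1)] \<tau>[of "P n i"] \<tau>[of "P n (Suc i)"] by (auto simp: J_def)
        have other: "t \<notin> J j" if "j < Suc n" "j \<noteq> i" for j
        proof -
          have "\<tau> (P n (Suc a)) \<le> \<tau> (P n b)" if "a < b" "b < Suc n" for a b
          proof (cases "Suc a = b")
            case False
            then have "Suc a \<le> b - 1" "Suc (b - 1) = b" using that by auto
            then have "P n (Suc a) < P n b" using P_mono[of "Suc a" "b - 1" n] P(2)[of n "b - 1"] by simp
            then show ?thesis using PS[of b] PS[of a] that by (intro \<tau>_mono) auto
          qed simp
          from this[of i j] this[of j i] show ?thesis using that i by (force simp: J_def)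
        qed
        have "(\<Sum>i<Suc n. m n i * indicator (J i) t) = (\<Sum>j\<in>{i}. m n j * indicator (J j) t)"
          using other i by (intro sum.mono_neutral_right) auto
        also have "\<dots> = m n i" using i by simp
        also have "m n i \<le> q (s t)"
        proof -
          have "s t \<le> P n (Suc i)" using mono[of t "\<tau> (P n (Suc i))"] \<tau>[of "P n (Suc i)"] PS[OF i(1)] i tL
            by (auto simp: J_def)
          moreover have "P n i \<le> s t" using mono[of "\<tau> (P n i)" t] \<tau>[of "P n i"] PS[OF i(1)] i tL
            by (auto simp: J_def)
          ultimately show ?thesis unfolding m_def by (intro INF_lower) auto
        qed
        finally show ?thesis using tL by simp
      qed
    qed
    finally show ?thesis .
  qed
  have "(\<integral>\<^sup>+\<sigma>\<in>{0..S}. q \<sigma> \<partial>lborel) = (\<integral>\<^sup>+\<sigma>\<in>{0<..S}. q \<sigma> \<partial>lborel)"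
    using AE_lborel_singleton[of "0::real"]
    by (intro nn_integral_cong_AE) (auto split: split_indicator elim!: eventually_mono)
  also have "\<dots> \<le> (\<integral>\<^sup>+\<sigma>. liminf (\<lambda>n. Q n \<sigma>) \<partial>lborel)"
    using liminf by (intro nn_integral_mono) (auto split: split_indicator)
  also have "\<dots> \<le> liminf (\<lambda>n. \<integral>\<^sup>+\<sigma>. Q n \<sigma> \<partial>lborel)"
  proof (rule nn_integral_liminf)
    show "Q n \<in> borel_measurable lborel" for n
      unfolding Q_def I_def by measurable
  qed
  also have "\<dots> \<le> (\<integral>\<^sup>+t\<in>{0..L}. q (s t) \<partial>lborel)"
    using Q_int by (intro Liminf_le) auto
  finally show ?thesis .
qed


text \<open>\<open>s\<close> is the length of \<open>\<gamma>\<close> up to time \<open>t\<close>.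
  Parameters with the same value of \<open>s\<close> have the same image, so \<open>\<gamma>\<close>
  factors through \<open>s\<close>. A constant curve has \<open>S = 0\<close> and no arc length
  parametrization, hence the guards \<open>0 < S\<close>.\<close>

lemma lip1_reparam:
  fixes \<gamma> :: "real \<Rightarrow> 'a::metric_space"
  assumes \<gamma>: "lip1 \<gamma>" and "0 \<le> L"
  obtains S \<gamma>' s where "0 \<le> S" "s ` {0..L} = {0..S}"
    "\<And>t. t \<in> {0..L} \<Longrightarrow> \<gamma> t = \<gamma>' (s t)"
    "\<And>t t'. t \<in> {0..L} \<Longrightarrow> t' \<in> {0..L} \<Longrightarrow> \<bar>s t - s t'\<bar> \<le> \<bar>t - t'\<bar>"
    "0 < S \<Longrightarrow> arclength_curve (S, \<gamma>')"
    "\<And>\<rho>. 0 < S \<Longrightarrow> lsc \<rho> \<Longrightarrow> curve_integral (S, \<gamma>') \<rho> \<le> (\<integral>\<^sup>+t\<in>{0..L}. \<rho> (\<gamma> t) \<partial>lborel)"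
proof -
  define s where "s t = enn2real (curve_length \<gamma> 0 t)" for t
  have lip: "dist (\<gamma> a) (\<gamma> b) \<le> b - a" if "a \<le> b" for a b
    using lip1D[OF \<gamma>, of a b] that by simp
  have len_le: "curve_length \<gamma> 0 t \<le> ennreal t" if "0 \<le> t" for t
    using that by (intro curve_length_lip1 lip)
  have len: "curve_length \<gamma> 0 t = ennreal (s t)" if "0 \<le> t" for t
    using len_le[OF that] unfolding s_def
    by (metis ennreal_enn2real ennreal_less_top le_less_trans)
  have s_nonneg: "0 \<le> s t" for t by (simp add: s_def)
  have s0: "s 0 = 0" using len_le[of 0] by (simp add: s_def)
  have s_dist: "s a + dist (\<gamma> a) (\<gamma> b) \<le> s b" if "0 \<le> a" "a \<le> b" for a b
  proof -
    have "ennreal (s a) + ennreal (dist (\<gamma> a) (\<gamma> b)) \<le> ennreal (s b)"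
      using curve_length_add_dist[OF that, of \<gamma>] len[of a] len[of b] that by simp
    then show ?thesis by (simp add: s_nonneg flip: ennreal_plus)
  qed
  have s_lip: "s b \<le> s a + (b - a)" if "0 \<le> a" "a \<le> b" for a b
  proof -
    have "curve_length (\<lambda>t. \<gamma> (a + t)) 0 (b - a) \<le> ennreal (b - a)"
    proof (rule curve_length_lip1)
      fix r t :: real assume "r \<le> t"
      then show "dist (\<gamma> (a + r)) (\<gamma> (a + t)) \<le> t - r" using lip[of "a + r" "a + t"] by simp
    qed (use that in simp)
    then have "ennreal (s b) \<le> ennreal (s a) + ennreal (b - a)"
      using curve_length_split[OF that, of \<gamma>] len[of a] len[of b] that
      by (metis add_left_mono order_trans)
    then show ?thesis using that by (simp add: s_nonneg flip: ennreal_plus)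
  qed
  have s_mono: "s a \<le> s b" if "0 \<le> a" "a \<le> b" for a b
    using s_dist[OF that] zero_le_dist[of "\<gamma> a" "\<gamma> b"] by linarith
  have s_abs: "\<bar>s t - s t'\<bar> \<le> \<bar>t - t'\<bar>" if "0 \<le> t" "0 \<le> t'" for t t'
    using s_lip[of t t'] s_lip[of t' t] s_mono[of t t'] s_mono[of t' t] that by (cases "t \<le> t'") auto
  define S where "S = s L"
  have onto: "s ` {0..L} = {0..S}"
  proof
    show "s ` {0..L} \<subseteq> {0..S}" using s_mono s_nonneg by (auto simp: S_def)
    have "continuous_on {0..L} s"
      unfolding continuous_on_iff dist_real_def
      using s_abs by (metis atLeastAtMost_iff le_less_trans)
    then show "{0..S} \<subseteq> s ` {0..L}"
      using IVT'[of s 0 _ L] \<open>0 \<le> L\<close> s0 by (force simp: S_def)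
  qed
  define \<tau> where "\<tau> \<sigma> = (SOME t. t \<in> {0..L} \<and> s t = \<sigma>)" for \<sigma>
  have \<tau>: "0 \<le> \<tau> \<sigma>" "\<tau> \<sigma> \<le> L" "s (\<tau> \<sigma>) = \<sigma>" if "0 \<le> \<sigma>" "\<sigma> \<le> S" for \<sigma>
  proof -
    have "\<exists>t. t \<in> {0..L} \<and> s t = \<sigma>" using that onto by (metis imageE atLeastAtMost_iff)
    from someI_ex[OF this] show "0 \<le> \<tau> \<sigma>" "\<tau> \<sigma> \<le> L" "s (\<tau> \<sigma>) = \<sigma>" unfolding \<tau>_def by auto
  qed
  have \<tau>_mono: "\<tau> a \<le> \<tau> b" if "0 \<le> a" "a \<le> b" "b \<le> S" for a b
  proof (cases "a = b")
    case False
    then show ?thesis using \<tau>[of a] \<tau>[of b] s_mono[of "\<tau> b" "\<tau> a"] that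
      by (cases "\<tau> b \<le> \<tau> a") auto
  qed simp
  define \<gamma>' where "\<gamma>' \<sigma> = \<gamma> (\<tau> \<sigma>)" for \<sigma>
  have eq: "\<gamma> t = \<gamma>' (s t)" if "0 \<le> t" "t \<le> L" for t
  proof -
    have st: "0 \<le> s t" "s t \<le> S" using that s_nonneg s_mono by (auto simp: S_def)
    obtain r where r: "r = \<tau> (s t)" "0 \<le> r" "s r = s t" using \<tau>[OF st] by auto
    have "dist (\<gamma> t) (\<gamma> r) \<le> 0"
      using s_dist[of t r] s_dist[of r t] r(2,3) that
      by (cases "t \<le> r") (auto simp: dist_commute)
    then show ?thesis using r(1) by (simp add: \<gamma>'_def)
  qed
  have lip': "dist (\<gamma>' a) (\<gamma>' b) \<le> b - a" if "0 \<le> a" "a \<le> b" "b \<le> S" for a b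
    using s_dist[of "\<tau> a" "\<tau> b"] \<tau>_mono[OF that] \<tau>[of a] \<tau>[of b] that by (auto simp: \<gamma>'_def)
  have cont': "continuous_on {0..S} \<gamma>'"
    unfolding continuous_on_iff
  proof (intro ballI allI impI)
    fix a e :: real assume "a \<in> {0..S}" "0 < e"
    moreover have "dist (\<gamma>' b) (\<gamma>' a) \<le> \<bar>b - a\<bar>" if "b \<in> {0..S}" for b
      using lip'[of a b] lip'[of b a] \<open>a \<in> _\<close> that by (cases "a \<le> b") (auto simp: dist_commute)
    ultimately show "\<exists>d>0. \<forall>b\<in>{0..S}. dist b a < d \<longrightarrow> dist (\<gamma>' b) (\<gamma>' a) < e"
      unfolding dist_real_def by (metis le_less_trans)
  qed
  have "curve_length \<gamma>' 0 \<sigma> = ennreal \<sigma>" if \<sigma>: "\<sigma> \<in> {0..S}" for \<sigma>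
  proof (rule antisym)
    show "curve_length \<gamma>' 0 \<sigma> \<le> ennreal \<sigma>"
      using \<sigma> by (intro curve_length_lip1 lip') auto
    \<comment> \<open>Pushing a partition forward by \<open>s\<close> keeps its sum because
      \<open>\<gamma>\<close> factors through \<open>s\<close>, so no length is lost.\<close>
    have "ennreal (variation_sum \<gamma> ts) \<le> curve_length \<gamma>' 0 \<sigma>"
      if ts: "sorted ts" "set ts \<subseteq> {0..\<tau> \<sigma>}" for ts
    proof -
      have "variation_sum \<gamma> ts = variation_sum (\<lambda>t. \<gamma>' (s t)) ts"
        using ts(2) \<tau>[of \<sigma>] \<sigma> by (intro variation_sum_cong eq) auto
      then have "variation_sum \<gamma> ts = variation_sum \<gamma>' (map s ts)"
        by (simp add: variation_sum_map)
      moreover have "sorted (map s ts)"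
        using ts s_mono by (auto simp: sorted_map intro!: sorted_wrt_mono_rel[of ts "(\<le>)"])
      moreover have "set (map s ts) \<subseteq> {0..\<sigma>}"
        using ts(2) s_mono[of _ "\<tau> \<sigma>"] s_nonneg \<tau>[of \<sigma>] \<sigma> by auto
      ultimately show ?thesis
        using curve_length_upper by metis
    qed
    then have "curve_length \<gamma> 0 (\<tau> \<sigma>) \<le> curve_length \<gamma>' 0 \<sigma>"
      unfolding curve_length_alt[of \<gamma>] by (auto intro!: SUP_least)
    then show "ennreal \<sigma> \<le> curve_length \<gamma>' 0 \<sigma>"
      using len[of "\<tau> \<sigma>"] \<tau>[of \<sigma>] \<sigma> by simp
  qed
  then have arc: "arclength_curve (S, \<gamma>')" if "0 < S"
    using that cont' by (simp add: arclength_curve_def)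
  have int: "curve_integral (S, \<gamma>') \<rho> \<le> (\<integral>\<^sup>+t\<in>{0..L}. \<rho> (\<gamma> t) \<partial>lborel)" if "0 < S" "lsc \<rho>" for \<rho>
  proof -
    have "(\<integral>\<^sup>+\<sigma>\<in>{0..S}. \<rho> (\<gamma>' \<sigma>) \<partial>lborel) \<le> (\<integral>\<^sup>+t\<in>{0..L}. \<rho> (\<gamma>' (s t)) \<partial>lborel)"
    proof (rule nn_integral_lip_reparam[OF _ \<open>0 < S\<close> _ onto])
      fix \<sigma> c assume \<sigma>: "\<sigma> \<in> {0..S}" "c < \<rho> (\<gamma>' \<sigma>)"
      have "(\<gamma>' \<longlongrightarrow> \<gamma>' \<sigma>) (at \<sigma> within {0..S})"
        using cont' \<sigma>(1) by (auto simp: continuous_on_def)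
      from lsc_eventually[OF \<open>lsc \<rho>\<close> this \<sigma>(2)]
      obtain d where "d > 0" "\<forall>x\<in>{0..S}. x \<noteq> \<sigma> \<and> dist x \<sigma> < d \<longrightarrow> c < \<rho> (\<gamma>' x)"
        unfolding eventually_at by blast
      then show "\<exists>\<delta>>0. \<forall>\<sigma>'\<in>{0..S}. \<bar>\<sigma>' - \<sigma>\<bar> < \<delta> \<longrightarrow> c < \<rho> (\<gamma>' \<sigma>')"
        using \<sigma>(2) unfolding dist_real_def by metis
    next
      fix t t' assume "0 \<le> t" "t \<le> t'" "t' \<le> L"
      then show "s t \<le> s t' \<and> s t' - s t \<le> t' - t"
        using s_mono[of t t'] s_lip[of t t'] by auto
    qed
    also have "\<dots> = (\<integral>\<^sup>+t\<in>{0..L}. \<rho> (\<gamma> t) \<partial>lborel)"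
      using eq by (intro nn_integral_cong) (auto split: split_indicator)
    finally show ?thesis by (simp add: curve_integral_def)
  qed
  show ?thesis
  proof (rule that[of S s \<gamma>'])
    show "0 \<le> S" using s_nonneg by (simp add: S_def)
  qed (use onto eq s_abs arc int in auto)
qed

section \<open>Capacity and families of curves\<close>

lemma ennreal_abs_diff_le_iff:
  assumes "0 \<le> x" "0 \<le> y"
  shows "ennreal \<bar>x - y\<bar> \<le> D \<longleftrightarrow> ennreal x \<le> ennreal y + D \<and> ennreal y \<le> ennreal x + D"
proof (cases D)
  case (real r)
  then show ?thesis
    using assms by (auto simp flip: ennreal_plus)
qed simp

text \<open>The bound is vacuous if the right side is infinite; otherwise finiteness puts
  \<open>v\<close> into the Newtonian space, and \<open>g\<close> competes in the infimum over upper
  gradients.\<close>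

lemma capacity_le_test:
  assumes "0 < p" and v: "v \<in> borel_measurable M" "\<And>x. 0 \<le> v x" "\<And>x. x \<in> E \<Longrightarrow> 1 \<le> v x"
    and g: "g \<in> borel_measurable borel"
      "\<And>l \<gamma>. arclength_curve (l, \<gamma>) \<Longrightarrow> ennreal \<bar>v (\<gamma> 0) - v (\<gamma> l)\<bar> \<le> curve_integral (l, \<gamma>) g"
  shows "capacity p M E \<le> (\<integral>\<^sup>+x. enn_powr (ennreal (v x)) p \<partial>M) + (\<integral>\<^sup>+x. enn_powr (g x) p \<partial>M)"
    (is "_ \<le> ?R")
proof (cases "?R = top")
  case False
  then have True: "?R < top" unfolding less_top .
  have ug: "upper_gradient g (\<lambda>x. ereal (v x))"
    using g by (auto simp: upper_gradient_def)
  have pw: "enn_powr (newtonian_norm p M (\<lambda>x. ereal (v x))) p \<le> ?R"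
    unfolding newtonian_norm_def enn_powr_inverse[OF \<open>0 < p\<close>]
    using v(2) ug by (intro add_mono INF_lower2[of g]) (auto)
  then have "newtonian_norm p M (\<lambda>x. ereal (v x)) < top"
    using True by (meson enn_powr_less_top le_less_trans)
  then have "(\<lambda>x. ereal (v x)) \<in> {u \<in> newtonian_space p M. \<forall>x\<in>E. 1 \<le> u x}"
    using v by (auto simp: newtonian_space_def one_ereal_def)
  then show ?thesis
    unfolding capacity_def by (rule INF_lower2) (rule pw)
qed (metis top_greatest)

text \<open>A witness for capacity less than \<open>c\<close>. The gradient is fixed together with
  the function because the infimum over upper gradients need not be attained; truncation to the unit
  interval is built in.\<close>

definition capacity_test ::
  "real \<Rightarrow> 'a::metric_space measure \<Rightarrow> 'a set \<Rightarrow> ennreal \<Rightarrow> ('a \<Rightarrow> real) \<Rightarrow> ('a \<Rightarrow> ennreal) \<Rightarrow> bool" where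
  "capacity_test p M E c v g \<longleftrightarrow> v \<in> borel_measurable M \<and> (\<forall>x. 0 \<le> v x \<and> v x \<le> 1) \<and>
    (\<forall>x\<in>E. v x = 1) \<and> g \<in> borel_measurable borel \<and>
    (\<forall>l \<gamma>. arclength_curve (l, \<gamma>) \<longrightarrow> ennreal \<bar>v (\<gamma> 0) - v (\<gamma> l)\<bar> \<le> curve_integral (l, \<gamma>) g) \<and>
    (\<integral>\<^sup>+x. enn_powr (ennreal (v x)) p \<partial>M) + (\<integral>\<^sup>+x. enn_powr (g x) p \<partial>M) < c"

lemma capacity_less_test:
  assumes "0 < p" and cap: "capacity p M E < c"
  shows "\<exists>v g. capacity_test p M E c v g"
proof -
  obtain u where u: "u \<in> borel_measurable M" "\<forall>x\<in>E. 1 \<le> u x" "enn_powr (newtonian_norm p M u) p < c"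
    using cap unfolding capacity_def INF_less_iff newtonian_space_def by auto
  define A where "A = (\<integral>\<^sup>+x. enn_powr (e2ennreal \<bar>u x\<bar>) p \<partial>M)"
  define I where "I g = (\<integral>\<^sup>+x. enn_powr (g x) p \<partial>M)" for g :: "'a \<Rightarrow> ennreal"
  have lt: "A + (INF g \<in> {g. upper_gradient g u}. I g) < c"
    using u(3) unfolding newtonian_norm_def enn_powr_inverse[OF \<open>0 < p\<close>] A_def I_def .
  obtain g where g: "upper_gradient g u" "A + I g < c"
  proof -
    \<comment> \<open>Finiteness of \<open>A\<close> allows it to be subtracted, so that the strict
      bound passes to one particular \<open>g\<close>.\<close>
    have "A < top" using lt by (cases "A = top") (simp_all add: less_top)
    then obtain a where a: "A = ennreal a" "0 \<le> a" by (cases A) auto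
    have "(INF g \<in> {g. upper_gradient g u}. I g) < c - A"
      using lt a by (simp add: less_diff_eq_ennreal add.commute)
    then obtain g where "upper_gradient g u" "I g < c - A"
      unfolding INF_less_iff by auto
    then show ?thesis
      using a by (intro that[of g]) (simp_all add: less_diff_eq_ennreal add.commute)
  qed
  \<comment> \<open>Truncation increases neither term of the norm. Infinite values of
    \<open>u\<close> become 1; a curve starting or ending at such a point has infinite
    \<open>g\<close>-integral, so nothing is lost there.\<close>
  define v where "v x = real_of_ereal (min 1 \<bar>u x\<bar>)" for x
  have v_eq: "v x = (if \<bar>u x\<bar> = \<infinity> then 1 else min 1 \<bar>real_of_ereal (u x)\<bar>)" for x
    by (cases "u x") (auto simp: v_def one_ereal_def min_def)
  have "v \<in> borel_measurable M" unfolding v_def using u(1) by measurable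
  moreover have v01: "0 \<le> v x" "v x \<le> 1" for x
    by (auto simp: v_eq)
  moreover have "v x = 1" if "x \<in> E" for x
    using bspec[OF u(2) that] by (cases "u x") (auto simp: v_eq one_ereal_def)
  moreover have "g \<in> borel_measurable borel" using g by (simp add: upper_gradient_def)
  moreover have "ennreal \<bar>v (\<gamma> 0) - v (\<gamma> l)\<bar> \<le> curve_integral (l, \<gamma>) g"
    if "arclength_curve (l, \<gamma>)" for l \<gamma>
  proof -
    have ineq: "(if \<bar>u (\<gamma> 0)\<bar> = \<infinity> \<or> \<bar>u (\<gamma> l)\<bar> = \<infinity> then \<infinity>
         else e2ennreal \<bar>u (\<gamma> 0) - u (\<gamma> l)\<bar>) \<le> curve_integral (l, \<gamma>) g"
      using g(1) that by (simp add: upper_gradient_def)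
    show ?thesis
    proof (cases "\<bar>u (\<gamma> 0)\<bar> = \<infinity> \<or> \<bar>u (\<gamma> l)\<bar> = \<infinity>")
      case True
      then show ?thesis using ineq by (simp add: top_unique)
    next
      case False
      then obtain a b where ab: "u (\<gamma> 0) = ereal a" "u (\<gamma> l) = ereal b"
        by (cases "u (\<gamma> 0)"; cases "u (\<gamma> l)") auto
      have "\<bar>v (\<gamma> 0) - v (\<gamma> l)\<bar> \<le> \<bar>a - b\<bar>"
        using ab by (auto simp: v_eq min_def abs_if)
      then have "ennreal \<bar>v (\<gamma> 0) - v (\<gamma> l)\<bar> \<le> ennreal \<bar>a - b\<bar>" by (rule ennreal_leI)
      also have "\<dots> \<le> curve_integral (l, \<gamma>) g" using ineq ab by simp
      finally show ?thesis .
    qed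
  qed
  moreover have "(\<integral>\<^sup>+x. enn_powr (ennreal (v x)) p \<partial>M) + (\<integral>\<^sup>+x. enn_powr (g x) p \<partial>M) < c"
  proof (rule le_less_trans[OF add_right_mono])
    show "(\<integral>\<^sup>+x. enn_powr (ennreal (v x)) p \<partial>M) \<le> A"
      unfolding A_def
    proof (intro nn_integral_mono enn_powr_mono \<open>0 < p\<close>)
      show "ennreal (v x) \<le> e2ennreal \<bar>u x\<bar>" for x
        by (cases "u x") (auto simp: v_eq intro!: ennreal_leI)
    qed
    show "A + (\<integral>\<^sup>+x. enn_powr (g x) p \<partial>M) < c" using g(2) by (simp add: I_def)
  qed
  ultimately show ?thesis unfolding capacity_test_def by blast
qed

lemma capacity_mono:
  assumes "E \<subseteq> F"
  shows "capacity p M E \<le> capacity p M F"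
  unfolding capacity_def using assms by (intro INF_superset_mono) auto

text \<open>The supremum of the test functions has the supremum of their gradients as an upper
  gradient, and both \<open>p\<close>-th powers are at most the sums. The bounds by
  \<open>c k\<close> are strict in order to choose test functions.\<close>

lemma capacity_Union_le:
  assumes "0 < p" and cap: "\<And>k::nat. capacity p M (E k) < c k" and sets: "sets borel \<subseteq> sets M" "space M = UNIV"
  shows "capacity p M (\<Union>k. E k) \<le> (\<Sum>k. c k)"
proof -
  obtain v g where "\<And>k. capacity_test p M (E k) (c k) (v k) (g k)"
    using capacity_less_test[OF \<open>0 < p\<close> cap] by metis
  then have v: "\<And>k. v k \<in> borel_measurable M" "\<And>k x. 0 \<le> v k x" "\<And>k x. v k x \<le> 1"
      "\<And>k x. x \<in> E k \<Longrightarrow> v k x = 1" and g: "\<And>k. g k \<in> borel_measurable borel"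
      "\<And>k l \<gamma>. arclength_curve (l, \<gamma>) \<Longrightarrow> ennreal \<bar>v k (\<gamma> 0) - v k (\<gamma> l)\<bar> \<le> curve_integral (l, \<gamma>) (g k)"
      "\<And>k. (\<integral>\<^sup>+x. enn_powr (ennreal (v k x)) p \<partial>M) + (\<integral>\<^sup>+x. enn_powr (g k x) p \<partial>M) < c k"
    unfolding capacity_test_def by blast+
  define V where "V x = enn2real (SUP k. ennreal (v k x))" for x
  define G where "G x = (SUP k. g k x)" for x
  have sup_le: "(SUP k. ennreal (v k x)) \<le> 1" for x
    using v(3) by (intro SUP_least) simp
  then have V: "ennreal (V x) = (SUP k. ennreal (v k x))" for x
    unfolding V_def by (metis ennreal_enn2real ennreal_one_less_top le_less_trans)
  have gM: "g k \<in> borel_measurable M" for k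
    using g(1)[of k] sets by (auto simp: measurable_def)
  have "capacity p M (\<Union>k. E k) \<le> (\<integral>\<^sup>+x. enn_powr (ennreal (V x)) p \<partial>M) + (\<integral>\<^sup>+x. enn_powr (G x) p \<partial>M)"
  proof (rule capacity_le_test[OF \<open>0 < p\<close>])
    show "V \<in> borel_measurable M" unfolding V_def using v(1) by measurable
    show "0 \<le> V x" for x by (simp add: V_def)
    show "1 \<le> V x" if "x \<in> (\<Union>k. E k)" for x
    proof -
      from that obtain k where "x \<in> E k" by blast
      then have "1 \<le> (SUP k. ennreal (v k x))" using v(4) by (intro SUP_upper2[of k]) auto
      then have "ennreal 1 \<le> ennreal (V x)" by (simp add: V)
      then show ?thesis by (simp add: V_def)
    qed
    show "G \<in> borel_measurable borel" unfolding G_def using g(1) by measurable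
    fix l and \<gamma> :: "real \<Rightarrow> 'a" assume arc: "arclength_curve (l, \<gamma>)"
    let ?D = "curve_integral (l, \<gamma>) G"
    have D: "ennreal \<bar>v k (\<gamma> 0) - v k (\<gamma> l)\<bar> \<le> ?D" for k
    proof (rule order_trans[OF g(2)[OF arc]])
      show "curve_integral (l, \<gamma>) (g k) \<le> ?D"
        by (auto simp: curve_integral_def G_def intro!: nn_integral_mono mult_right_mono SUP_upper)
    qed
    have "(SUP k. ennreal (v k x)) \<le> (SUP k. ennreal (v k y)) + ?D"
      if "\<And>k. ennreal (v k x) \<le> ennreal (v k y) + ?D" for x y
      by (rule SUP_least, rule order_trans[OF that]) (intro add_right_mono SUP_upper, simp)
    then have "ennreal (V (\<gamma> 0)) \<le> ennreal (V (\<gamma> l)) + ?D" "ennreal (V (\<gamma> l)) \<le> ennreal (V (\<gamma> 0)) + ?D"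
      unfolding V using D ennreal_abs_diff_le_iff[OF v(2) v(2)] by blast+
    then show "ennreal \<bar>V (\<gamma> 0) - V (\<gamma> l)\<bar> \<le> ?D"
      by (subst ennreal_abs_diff_le_iff) (simp_all add: V_def)
  qed
  also have "\<dots> \<le> (\<integral>\<^sup>+x. (\<Sum>k. enn_powr (ennreal (v k x)) p) \<partial>M) + (\<integral>\<^sup>+x. (\<Sum>k. enn_powr (g k x) p) \<partial>M)"
    unfolding V G_def by (intro add_mono nn_integral_mono enn_powr_SUP_le \<open>0 < p\<close>)
  also have "\<dots> = (\<Sum>k. \<integral>\<^sup>+x. enn_powr (ennreal (v k x)) p \<partial>M) + (\<Sum>k. \<integral>\<^sup>+x. enn_powr (g k x) p \<partial>M)"
    using v(1) gM by (subst (1 2) nn_integral_suminf) auto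
  also have "\<dots> = (\<Sum>k. (\<integral>\<^sup>+x. enn_powr (ennreal (v k x)) p \<partial>M) + (\<integral>\<^sup>+x. enn_powr (g k x) p \<partial>M))"
    by (intro suminf_add summableI)
  also have "\<dots> \<le> (\<Sum>k. c k)"
    using g(3) by (intro suminf_le summableI less_imp_le)
  finally show ?thesis .
qed

text \<open>The factor 1/4 makes the total \<open>e / 2\<close>, which leaves room for a strict
  inequality after summation.\<close>

lemma suminf_half_powers: "0 < e \<Longrightarrow> (\<Sum>k. ennreal (e * (1 / 2) ^ k / 4)) = ennreal (e / 2)"
proof -
  assume "0 < e"
  have "(\<lambda>k. (e / 4) * (1 / 2) ^ k) sums ((e / 4) * (1 / (1 - 1 / 2)))"
    by (intro sums_mult geometric_sums) simp
  then have "(\<lambda>k. e * (1 / 2) ^ k / 4) sums (e / 2)" by simp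
  then show ?thesis using \<open>0 < e\<close> by (intro suminf_ennreal_eq) auto
qed

lemma capacity_Union_less:
  assumes "0 < p" "0 < \<epsilon>" and cap: "\<And>k::nat. capacity p M (E k) < ennreal (\<epsilon> * (1 / 2) ^ k / 4)"
    and "sets borel \<subseteq> sets M" "space M = UNIV"
  shows "capacity p M (\<Union>k. E k) < ennreal \<epsilon>"
proof -
  have "capacity p M (\<Union>k. E k) \<le> (\<Sum>k. ennreal (\<epsilon> * (1 / 2) ^ k / 4))"
    by (rule capacity_Union_le) fact+
  also have "\<dots> = ennreal (\<epsilon> / 2)"
    using \<open>0 < \<epsilon>\<close> by (rule suminf_half_powers)
  also have "\<dots> < ennreal \<epsilon>" using \<open>0 < \<epsilon>\<close> by (simp add: ennreal_lessI)
  finally show ?thesis .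
qed

text \<open>Nothing is known about \<open>\<gamma>\<close> outside \<open>{0..l}\<close>, so
  measurability of integrands is read off from the clamped curve.\<close>

lemma curve_integral_clamp:
  "curve_integral (l, \<gamma>) g = (\<integral>\<^sup>+t\<in>{0..l}. g (\<gamma> (clamp_to l t)) \<partial>lborel)"
  unfolding curve_integral_def prod.case
  by (intro nn_integral_cong) (auto simp: clamp_to_id split: split_indicator)

lemma clamp_curve_measurable [measurable_dest]:
  "arclength_curve (l, \<gamma>) \<Longrightarrow> (\<lambda>t. \<gamma> (clamp_to l t)) \<in> borel_measurable borel"
  by (intro lip1_measurable arclength_curve_clamp_lip1)

lemma curve_integral_subcurve:
  assumes \<gamma>: "arclength_curve (l, \<gamma>)" and g: "g \<in> borel_measurable borel" and "0 \<le> a" "a < b" "b \<le> l"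
  shows "curve_integral (b - a, \<lambda>t. \<gamma> (a + t)) g = (\<integral>\<^sup>+t\<in>{a..b}. g (\<gamma> t) \<partial>lborel)"
proof -
  have [measurable]: "(\<lambda>t. \<gamma> (clamp_to l t)) \<in> borel_measurable borel"
    using clamp_curve_measurable[OF \<gamma>] .
  note g [measurable]
  have [measurable]: "{a..b} \<in> sets borel" by simp
  have "(\<integral>\<^sup>+t\<in>{a..b}. g (\<gamma> t) \<partial>lborel) = (\<integral>\<^sup>+t. g (\<gamma> (clamp_to l t)) * indicator {a..b} t \<partial>lborel)"
    using assms by (intro nn_integral_cong) (auto simp: clamp_to_id split: split_indicator)
  also have "\<dots> = ennreal \<bar>1\<bar> * (\<integral>\<^sup>+t. g (\<gamma> (clamp_to l (a + 1 * t))) * indicator {a..b} (a + 1 * t) \<partial>lborel)"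
    by (rule nn_integral_real_affine) simp_all
  also have "\<dots> = curve_integral (b - a, \<lambda>t. \<gamma> (a + t)) g"
    using assms unfolding curve_integral_def prod.case
    by (auto intro!: nn_integral_cong simp: clamp_to_id split: split_indicator)
  finally show ?thesis by simp
qed

text \<open>Subcurves of an arc length curve are again such curves, so the end points may be
  replaced by any two parameters at the cost of the full integral.\<close>

lemma upper_gradient_along_curve:
  assumes g: "g \<in> borel_measurable borel"
      "\<And>l \<gamma>. arclength_curve (l, \<gamma>) \<Longrightarrow> ennreal \<bar>v (\<gamma> 0) - v (\<gamma> l)\<bar> \<le> curve_integral (l, \<gamma>) g"
    and \<gamma>: "arclength_curve (l, \<gamma>)" and st: "s \<in> {0..l}" "t \<in> {0..l}"
  shows "ennreal \<bar>v (\<gamma> s) - v (\<gamma> t)\<bar> \<le> curve_integral (l, \<gamma>) g"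
proof -
  have *: "ennreal \<bar>v (\<gamma> s) - v (\<gamma> t)\<bar> \<le> curve_integral (l, \<gamma>) g"
    if "s < t" "0 \<le> s" "t \<le> l" for s t
  proof -
    have "ennreal \<bar>v (\<gamma> s) - v (\<gamma> t)\<bar> \<le> (\<integral>\<^sup>+t\<in>{s..t}. g (\<gamma> t) \<partial>lborel)"
      using g(2)[OF arclength_curve_subcurve[OF \<gamma> that(2,1,3)]] curve_integral_subcurve[OF \<gamma> g(1) that(2,1,3)]
      by simp
    also have "\<dots> \<le> curve_integral (l, \<gamma>) g"
      using that by (auto simp: curve_integral_def intro!: nn_integral_mono split: split_indicator)
    finally show ?thesis .
  qed
  show ?thesis
    using *[of s t] *[of t s] st by (cases s t rule: linorder_cases) (auto simp: abs_minus_commute)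
qed

text \<open>Exceptional families are witnessed by Borel weights, but test functions are measurable
  only for the completion. Making the Borel representative infinite on a Borel null set turns it
  into a majorant with the same integral.\<close>

lemma completion_measurable_majorant:
  fixes v :: "'a::metric_space \<Rightarrow> real"
  assumes "v \<in> borel_measurable (completion N)" "sets N = sets borel"
  obtains a where "a \<in> borel_measurable borel" "\<And>x. ennreal (v x) \<le> a x" "AE x in N. a x = ennreal (v x)"
proof -
  obtain v' where v': "v' \<in> borel_measurable N" "AE x in N. v x = v' x"
    using completion_ex_borel_measurable_real[OF assms(1)] by blast
  then obtain Z where Z: "{x\<in>space N. v x \<noteq> v' x} \<subseteq> Z" "Z \<in> null_sets N"
    by (elim AE_E) auto
  have sp: "space N = UNIV" using sets_eq_imp_space_eq[OF assms(2)] by simp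
  have Zb: "Z \<in> sets borel" using Z assms(2) by auto
  have v'b: "v' \<in> borel_measurable borel" using v'(1) assms(2) by (simp cong: measurable_cong_sets)
  show ?thesis
  proof (rule that[of "\<lambda>x. if x \<in> Z then top else ennreal (v' x)"])
    show "(\<lambda>x. if x \<in> Z then top else ennreal (v' x)) \<in> borel_measurable borel"
      using Zb v'b by measurable
    show "ennreal (v x) \<le> (if x \<in> Z then top else ennreal (v' x))" for x
      using Z sp by (cases "v x = v' x") auto
    show "AE x in N. (if x \<in> Z then top else ennreal (v' x)) = ennreal (v x)"
      using AE_not_in[OF Z(2)] v'(2) by eventually_elim auto
  qed
qed


text \<open>On a curve of finite \<open>\<rho>\<close>-integral, the test function of \<open>G k\<close> for large \<open>k\<close> is at most
  \<open>1/2\<close> somewhere and oscillates by less than \<open>1/2\<close>, so the curve does not meet \<open>G k\<close>.\<close>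

lemma eventually_avoid_small_capacity:
  fixes N :: "'a::metric_space measure"
  assumes "0 < p" and N: "sets N = sets borel"
    and cap: "\<And>k::nat. capacity p (completion N) (G k) < ennreal ((1 / 2) powr ((p + 1) * real k))"
  obtains \<rho> where "\<rho> \<in> borel_measurable borel" "(\<integral>\<^sup>+x. enn_powr (\<rho> x) p \<partial>N) < \<infinity>"
    "\<And>l \<gamma>. arclength_curve (l, \<gamma>) \<Longrightarrow> curve_integral (l, \<gamma>) \<rho> < \<infinity> \<Longrightarrow>
      \<exists>k0. \<forall>k\<ge>k0. \<gamma> ` {0..l} \<inter> G k = {}"
proof -
  \<comment> \<open>The factors \<open>2 ^ k\<close> in the weight below contribute
    \<open>2 powr (p * k)\<close> to its \<open>p\<close>-th power; the exponent
    \<open>p + 1\<close> leaves the summable \<open>(1 / 2) ^ k\<close>.\<close>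
  define c where "c k = (1 / 2) powr ((p + 1) * real k)" for k :: nat
  obtain v g where "\<And>k. capacity_test p (completion N) (G k) (ennreal (c k)) (v k) (g k)"
    using capacity_less_test[OF \<open>0 < p\<close> cap] unfolding c_def by metis
  then have v: "\<And>k. v k \<in> borel_measurable (completion N)" "\<And>k x. 0 \<le> v k x" "\<And>k x. v k x \<le> 1"
      "\<And>k x. x \<in> G k \<Longrightarrow> v k x = 1" and g[measurable]: "\<And>k. g k \<in> borel_measurable borel"
      and ug: "\<And>k l \<gamma>. arclength_curve (l, \<gamma>) \<Longrightarrow> ennreal \<bar>v k (\<gamma> 0) - v k (\<gamma> l)\<bar> \<le> curve_integral (l, \<gamma>) (g k)"
      and small: "\<And>k. (\<integral>\<^sup>+x. enn_powr (ennreal (v k x)) p \<partial>completion N) + (\<integral>\<^sup>+x. enn_powr (g k x) p \<partial>completion N) < ennreal (c k)"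
    unfolding capacity_test_def by blast+
  have "\<forall>k. \<exists>a. a \<in> borel_measurable borel \<and> (\<forall>x. ennreal (v k x) \<le> a x) \<and> (AE x in N. a x = ennreal (v k x))"
    using completion_measurable_majorant[OF v(1) N] by metis
  then obtain a where a[measurable]: "\<And>k. a k \<in> borel_measurable borel" and a_ge: "\<And>k x. ennreal (v k x) \<le> a k x"
    and a_AE: "\<And>k. AE x in N. a k x = ennreal (v k x)"
    by metis
  define \<rho> where "\<rho> x = (SUP k. ennreal (2 ^ k) * max (a k x) (g k x))" for x
  have \<rho>_meas[measurable]: "\<rho> \<in> borel_measurable borel" unfolding \<rho>_def by measurable
  have measN: "f \<in> borel_measurable N" if "f \<in> borel_measurable borel" for f :: "'a \<Rightarrow> ennreal"
    using that N by (simp cong: measurable_cong_sets)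
  have summand: "(\<integral>\<^sup>+x. enn_powr (ennreal (2 ^ k) * max (a k x) (g k x)) p \<partial>N) \<le> ennreal ((1 / 2) ^ k)" for k
  proof -
    have "(\<integral>\<^sup>+x. enn_powr (ennreal (2 ^ k) * max (a k x) (g k x)) p \<partial>N)
        \<le> (\<integral>\<^sup>+x. enn_powr (ennreal (2 ^ k)) p * (enn_powr (ennreal (v k x)) p + enn_powr (g k x) p) \<partial>N)"
    proof (rule nn_integral_mono_AE)
      show "AE x in N. enn_powr (ennreal (2 ^ k) * max (a k x) (g k x)) p
        \<le> enn_powr (ennreal (2 ^ k)) p * (enn_powr (ennreal (v k x)) p + enn_powr (g k x) p)"
        using a_AE[of k]
      proof eventually_elim
        case (elim x)
        show ?case
          unfolding enn_powr_mult[OF \<open>0 < p\<close>] elim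
          using enn_powr_max_le[OF \<open>0 < p\<close>] by (intro mult_left_mono) auto
      qed
    qed
    also have "\<dots> = (\<integral>\<^sup>+x. enn_powr (ennreal (2 ^ k)) p * (enn_powr (ennreal (v k x)) p + enn_powr (g k x) p) \<partial>completion N)"
      by (simp add: nn_integral_completion)
    also have "\<dots> = enn_powr (ennreal (2 ^ k)) p * ((\<integral>\<^sup>+x. enn_powr (ennreal (v k x)) p \<partial>completion N) + (\<integral>\<^sup>+x. enn_powr (g k x) p \<partial>completion N))"
    proof -
      have [measurable]: "v k \<in> borel_measurable (completion N)" "g k \<in> borel_measurable (completion N)"
        using v(1) measN[OF g] by (auto intro: measurable_completion)
      show ?thesis
        by (subst nn_integral_cmult, measurable) (subst nn_integral_add, auto)
    qed
    also have "\<dots> \<le> enn_powr (ennreal (2 ^ k)) p * ennreal (c k)"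
      using small[of k] by (intro mult_left_mono) auto
    also have "\<dots> = ennreal ((2 ^ k) powr p * c k)"
      by (simp add: enn_powr_ennreal ennreal_mult c_def)
    also have "(2 ^ k) powr p * c k = (1 / 2) ^ k"
      unfolding c_def
      by (simp add: powr_realpow[symmetric] powr_powr powr_divide powr_add[symmetric] field_simps)
    finally show ?thesis .
  qed
  have "(\<integral>\<^sup>+x. enn_powr (\<rho> x) p \<partial>N) \<le> (\<integral>\<^sup>+x. (\<Sum>k. enn_powr (ennreal (2 ^ k) * max (a k x) (g k x)) p) \<partial>N)"
    unfolding \<rho>_def by (intro nn_integral_mono enn_powr_SUP_le \<open>0 < p\<close>)
  also have "\<dots> = (\<Sum>k. \<integral>\<^sup>+x. enn_powr (ennreal (2 ^ k) * max (a k x) (g k x)) p \<partial>N)"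
    by (intro nn_integral_suminf measN) measurable
  also have "\<dots> \<le> (\<Sum>k. ennreal ((1 / 2) ^ k))"
    using summand by (intro suminf_le summableI)
  also have "\<dots> = ennreal 2"
    using geometric_sums[of "1 / 2 :: real"] by (intro suminf_ennreal_eq) auto
  also have "\<dots> < \<infinity>" by simp
  finally have \<rho>_int: "(\<integral>\<^sup>+x. enn_powr (\<rho> x) p \<partial>N) < \<infinity>" .
  have avoid: "\<exists>k0. \<forall>k\<ge>k0. \<gamma> ` {0..l} \<inter> G k = {}"
    if \<gamma>: "arclength_curve (l, \<gamma>)" and fin: "curve_integral (l, \<gamma>) \<rho> < \<infinity>" for l \<gamma>
  proof -
    obtain C where C: "curve_integral (l, \<gamma>) \<rho> = ennreal C" "0 \<le> C"
      using fin by (cases "curve_integral (l, \<gamma>) \<rho>") auto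
    have "0 < l" using \<gamma> by (simp add: arclength_curve_def)
    have [measurable]: "(\<lambda>t. \<gamma> (clamp_to l t)) \<in> borel_measurable borel"
      using clamp_curve_measurable[OF \<gamma>] .
    have int_le: "curve_integral (l, \<gamma>) f \<le> ennreal (C / 2 ^ k)"
      if [measurable]: "f \<in> borel_measurable borel" and f: "\<And>x. f x \<le> max (a k x) (g k x)" for f k
    proof -
      have "ennreal (2 ^ k) * curve_integral (l, \<gamma>) f = (\<integral>\<^sup>+t\<in>{0..l}. ennreal (2 ^ k) * f (\<gamma> (clamp_to l t)) \<partial>lborel)"
        unfolding curve_integral_clamp by (subst nn_integral_cmult[symmetric]) (auto simp: mult.assoc)
      also have "\<dots> \<le> curve_integral (l, \<gamma>) \<rho>"
        unfolding curve_integral_clamp \<rho>_def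
        by (intro nn_integral_mono mult_right_mono SUP_upper2[of k] mult_left_mono f) auto
      finally have "ennreal (2 ^ k) * curve_integral (l, \<gamma>) f \<le> ennreal C" using C by simp
      then have "ennreal (1 / 2 ^ k) * (ennreal (2 ^ k) * curve_integral (l, \<gamma>) f) \<le> ennreal (1 / 2 ^ k) * ennreal C"
        by (rule mult_left_mono) simp
      also have "ennreal (1 / 2 ^ k) * (ennreal (2 ^ k) * curve_integral (l, \<gamma>) f) = curve_integral (l, \<gamma>) f"
        by (simp add: mult.assoc[symmetric] ennreal_mult[symmetric])
      finally show ?thesis using C by (simp add: ennreal_mult[symmetric])
    qed
    have "(\<lambda>k. C / 2 ^ k) \<longlonglongrightarrow> 0"
      using tendsto_mult_right_zero[OF LIMSEQ_power_zero[of "1 / 2 :: real"], of C]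
      by (simp add: power_divide)
    \<comment> \<open>The bound \<open>l / 2\<close> rules out that \<open>v k\<close> exceeds 1/2
      on the whole curve, and the bound 1/2 limits its oscillation along the curve.\<close>
    then have "\<forall>\<^sub>F k in sequentially. C / 2 ^ k < min (l / 2) (1 / 2)"
      using \<open>0 < l\<close> by (intro order_tendstoD) auto
    then obtain k0 where k0: "\<And>k. k \<ge> k0 \<Longrightarrow> C / 2 ^ k < min (l / 2) (1 / 2)"
      unfolding eventually_sequentially by auto
    have "\<gamma> ` {0..l} \<inter> G k = {}" if "k \<ge> k0" for k
    proof -
      have "\<exists>t\<in>{0..l}. v k (\<gamma> t) \<le> 1 / 2"
      proof (rule ccontr)
        assume "\<not> ?thesis"
        then have big: "1 / 2 < v k (\<gamma> t)" if "t \<in> {0..l}" for t using that by force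
        have "ennreal (l / 2) = (\<integral>\<^sup>+t\<in>{0..l}. ennreal (1 / 2) \<partial>lborel)"
        proof -
          have "ennreal (l / 2) = ennreal (1 / 2) * ennreal l"
            using \<open>0 < l\<close> by (subst ennreal_mult[symmetric]) auto
          also have "ennreal l = emeasure lborel {0..l}" using \<open>0 < l\<close> by simp
          finally show ?thesis by (subst nn_integral_cmult_indicator) auto
        qed
        also have "\<dots> \<le> curve_integral (l, \<gamma>) (a k)"
          unfolding curve_integral_def prod.case
        proof (rule nn_integral_mono)
          fix t
          show "ennreal (1 / 2) * indicator {0..l} t \<le> a k (\<gamma> t) * indicator {0..l} t"
            using big[of t] order_trans[OF ennreal_leI a_ge, of "1 / 2" k "\<gamma> t"]
            by (auto split: split_indicator)
        qed
        also have "\<dots> \<le> ennreal (C / 2 ^ k)" by (intro int_le) auto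
        finally show False using k0[OF \<open>k \<ge> k0\<close>] C \<open>0 < l\<close> by simp
      qed
      then obtain t where t: "t \<in> {0..l}" "v k (\<gamma> t) \<le> 1 / 2" by blast
      have "v k (\<gamma> s) < 1" if "s \<in> {0..l}" for s
      proof -
        have "ennreal \<bar>v k (\<gamma> s) - v k (\<gamma> t)\<bar> \<le> curve_integral (l, \<gamma>) (g k)"
          by (rule upper_gradient_along_curve[OF g ug \<gamma> that t(1)])
        also have "\<dots> \<le> ennreal (C / 2 ^ k)" by (intro int_le) auto
        finally have "\<bar>v k (\<gamma> s) - v k (\<gamma> t)\<bar> \<le> C / 2 ^ k" using C by simp
        then show ?thesis using k0[OF \<open>k \<ge> k0\<close>] t(2) by linarith
      qed
      then show ?thesis using v(4)[of _ k] by fastforce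
    qed
    then show ?thesis by blast
  qed
  show ?thesis using that[OF \<rho>_meas \<rho>_int avoid] by blast
qed

section \<open>Quasicontinuity along curves\<close>

lemma emeasure_le_capacity:
  assumes "0 < p" "E \<in> sets M"
  shows "emeasure M E \<le> capacity p M E"
proof (rule ccontr)
  assume "\<not> ?thesis"
  then have "capacity p M E < emeasure M E" by simp
  from capacity_less_test[OF \<open>0 < p\<close> this] obtain v g where
    "capacity_test p M E (emeasure M E) v g" by blast
  then have v: "\<forall>x\<in>E. v x = 1"
    and less: "(\<integral>\<^sup>+x. enn_powr (ennreal (v x)) p \<partial>M) + (\<integral>\<^sup>+x. enn_powr (g x) p \<partial>M) < emeasure M E"
    unfolding capacity_test_def by auto
  have "emeasure M E = (\<integral>\<^sup>+x. indicator E x \<partial>M)" using assms(2) by simp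
  also have "\<dots> \<le> (\<integral>\<^sup>+x. enn_powr (ennreal (v x)) p \<partial>M)"
    using v by (intro nn_integral_mono) (auto split: split_indicator)
  also have "\<dots> \<le> (\<integral>\<^sup>+x. enn_powr (ennreal (v x)) p \<partial>M) + (\<integral>\<^sup>+x. enn_powr (g x) p \<partial>M)"
    by simp
  finally show False using less by simp
qed

lemma ennreal_zeroI:
  fixes a :: ennreal
  assumes "\<And>e. 0 < e \<Longrightarrow> a < ennreal e"
  shows "a = 0"
proof (rule ccontr)
  assume "a \<noteq> 0"
  then obtain b where "0 < b" "b < a" using dense[of 0 a] by (auto simp: zero_less_iff_neq_zero)
  then obtain r where "b = ennreal r" "0 < r" by (cases b) (auto simp: top_unique)
  then show False using assms[of r] \<open>b < a\<close> by simp
qed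

context
  fixes N M :: "'a::metric_space measure" and p :: real
  assumes p: "0 < p" and setsN: "sets N = sets borel" and M: "M = completion N"
begin

lemma borel_sets_M: "A \<in> sets borel \<Longrightarrow> A \<in> sets M"
  using setsN M by auto

lemma space_M: "space M = UNIV"
  using sets_eq_imp_space_eq[OF setsN] M by simp

lemma null_subset_M: "B \<in> null_sets M \<Longrightarrow> A \<subseteq> B \<Longrightarrow> A \<in> null_sets M"
  unfolding M null_sets_completion_iff2 by blast

lemma null_INT_small_capacity:
  assumes "\<And>\<epsilon>. 0 < \<epsilon> \<Longrightarrow> \<exists>k::nat. capacity p M (G k) < ennreal \<epsilon>" "\<And>k. open (G k)"
  shows "(\<Inter>k. G k) \<in> null_sets M"
proof (rule null_setsI)
  show sets: "(\<Inter>k. G k) \<in> sets M" using assms(2) by (intro borel_sets_M) auto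
  show "emeasure M (\<Inter>k. G k) = 0"
  proof (rule ennreal_zeroI)
    fix e :: real assume "0 < e"
    then obtain k where "capacity p M (G k) < ennreal e" using assms(1) by blast
    moreover have "emeasure M (\<Inter>k. G k) \<le> capacity p M (G k)"
      using emeasure_le_capacity[OF p sets] capacity_mono[of "\<Inter>k. G k" "G k" p M] by force
    ultimately show "emeasure M (\<Inter>k. G k) < ennreal e" by simp
  qed
qed

lemma ex_powr_less: "0 < \<epsilon> \<Longrightarrow> \<exists>k::nat. (1 / 2) powr ((p + 1) * real k) < \<epsilon>"
proof -
  assume "0 < \<epsilon>"
  then obtain k where k: "(1 / 2) ^ k < \<epsilon>" using real_arch_pow_inv[of \<epsilon> "1 / 2"] by auto
  have "(1 / 2) powr ((p + 1) * real k) \<le> (1 / 2) powr (real k)"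
    using p by (intro powr_mono') (auto simp: algebra_simps)
  also have "\<dots> = (1 / 2) ^ k" by (simp add: powr_realpow)
  finally show ?thesis using k by (intro exI[of _ k]) simp
qed

lemma quasicontinuous_on_imp:
  assumes qc: "quasicontinuous_on p M U u"
  shows "u \<in> borel_measurable (restrict_space M U)" "finite_qe_on p M U u"
    "p_ae_curve_in p M U (\<lambda>l \<gamma>. continuous_on {0..l} (u \<circ> \<gamma>))"
proof -
  have "\<forall>k::nat. \<exists>G. open G \<and> capacity p M G < ennreal ((1 / 2) powr ((p + 1) * real k)) \<and>
        (\<forall>x\<in>U - G. \<bar>u x\<bar> \<noteq> \<infinity>) \<and> continuous_on (U - G) u"
    using qc unfolding quasicontinuous_on_def by auto
  then obtain G where G: "\<And>k::nat. open (G k)"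
      "\<And>k. capacity p M (G k) < ennreal ((1 / 2) powr ((p + 1) * real k))"
      "\<And>k x. x \<in> U - G k \<Longrightarrow> \<bar>u x\<bar> \<noteq> \<infinity>" "\<And>k. continuous_on (U - G k) u"
    by metis
  have small: "\<exists>k::nat. capacity p M (G k) < ennreal \<epsilon>" if "0 < \<epsilon>" for \<epsilon>
    using ex_powr_less[OF that] G(2) by (meson ennreal_leI less_imp_le less_le_trans)
  show "finite_qe_on p M U u"
    unfolding finite_qe_on_def
  proof (rule ennreal_zeroI)
    fix e :: real assume "0 < e"
    then obtain k where k: "capacity p M (G k) < ennreal e" using small by blast
    have "{x \<in> U. \<bar>u x\<bar> = \<infinity>} \<subseteq> G k" using G(3)[of _ k] by (simp add: subset_iff) metis
    from capacity_mono[OF this, of p M] k show "capacity p M {x \<in> U. \<bar>u x\<bar> = \<infinity>} < ennreal e"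
      by (rule le_less_trans)
  qed
  show "u \<in> borel_measurable (restrict_space M U)"
  proof (rule borel_measurableI)
    fix S :: "ereal set" assume "open S"
    define V where "V k = (SOME V. open V \<and> V \<inter> (U - G k) = u -` S \<inter> (U - G k))" for k
    have V: "open (V k)" "V k \<inter> (U - G k) = u -` S \<inter> (U - G k)" for k
      using someI_ex[of "\<lambda>V. open V \<and> V \<inter> (U - G k) = u -` S \<inter> (U - G k)"] G(4)[of k] \<open>open S\<close>
      unfolding V_def continuous_on_open_invariant by auto
    have null: "(\<Inter>k. G k) \<in> null_sets M" using small G(1) by (rule null_INT_small_capacity)
    define N' where "N' = u -` S \<inter> (\<Inter>k. G k)"
    have "N' \<in> sets M"
    proof -
      have "N' \<in> null_sets M"
        using null_subset_M[OF null] by (simp add: N'_def)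
      then show ?thesis by auto
    qed
    moreover have "(\<Union>k. V k - G k) \<in> sets M"
      using V(1) G(1) by (intro borel_sets_M sets.countable_UN sets.Diff) auto
    ultimately have "(\<Union>k. V k - G k) \<union> N' \<in> sets M" by auto
    moreover have "u -` S \<inter> U = ((\<Union>k. V k - G k) \<union> N') \<inter> U"
      using V(2) by (fastforce simp: N'_def)
    ultimately show "u -` S \<inter> space (restrict_space M U) \<in> sets (restrict_space M U)"
      by (simp add: space_restrict_space space_M sets_restrict_space) (metis (no_types, lifting) image_eqI inf_commute)
  qed
  obtain \<rho> where \<rho>: "\<rho> \<in> borel_measurable borel" "(\<integral>\<^sup>+x. enn_powr (\<rho> x) p \<partial>N) < \<infinity>"
    "\<And>l \<gamma>. arclength_curve (l, \<gamma>) \<Longrightarrow> curve_integral (l, \<gamma>) \<rho> < \<infinity> \<Longrightarrow>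
      \<exists>k0. \<forall>k\<ge>k0. \<gamma> ` {0..l} \<inter> G k = {}"
    using eventually_avoid_small_capacity[OF p setsN, of G] G(2) M by metis
  have "curve_integral (l, \<gamma>) \<rho> = \<infinity>"
    if \<gamma>: "arclength_curve (l, \<gamma>)" "\<gamma> ` {0..l} \<subseteq> U" "\<not> continuous_on {0..l} (u \<circ> \<gamma>)" for l \<gamma>
  proof (rule ccontr)
    assume "\<not> ?thesis"
    then obtain k where "\<gamma> ` {0..l} \<inter> G k = {}" using \<rho>(3)[OF \<gamma>(1)] by (auto simp: less_top)
    then have "continuous_on (\<gamma> ` {0..l}) u"
      using \<gamma>(2) by (intro continuous_on_subset[OF G(4)[of k]]) auto
    moreover have "continuous_on {0..l} \<gamma>" using \<gamma>(1) by (simp add: arclength_curve_def)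
    ultimately show False using \<gamma>(3) continuous_on_compose by blast
  qed
  then show "p_ae_curve_in p M U (\<lambda>l \<gamma>. continuous_on {0..l} (u \<circ> \<gamma>))"
    unfolding p_ae_curve_in_def p_exceptional_def using \<rho>(1,2)
    by (intro exI[of _ \<rho>]) (auto simp: M nn_integral_completion)
qed

text \<open>Intersecting the open sets \<open>G k \<union> U\<close> gives \<open>U\<close> up to a
  null set. A curve that misses \<open>G k\<close> cannot tell \<open>U\<close> from the open set
  \<open>G k \<union> U\<close>, so \<open>U\<close> is relatively open along almost every
  curve.\<close>

lemma quasiopen_imp:
  assumes "quasiopen p M U"
  shows "U \<in> sets M"
    and "\<exists>\<rho>. \<rho> \<in> borel_measurable borel \<and> (\<integral>\<^sup>+x. enn_powr (\<rho> x) p \<partial>N) < \<infinity> \<and>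
      (\<forall>l \<gamma>. arclength_curve (l, \<gamma>) \<longrightarrow> curve_integral (l, \<gamma>) \<rho> < \<infinity> \<longrightarrow>
        (\<exists>V. open V \<and> \<gamma> ` {0..l} \<inter> V = \<gamma> ` {0..l} \<inter> U))"
proof -
  have "\<forall>k::nat. \<exists>G. open G \<and> capacity p M G < ennreal ((1 / 2) powr ((p + 1) * real k)) \<and> open (G \<union> U)"
    using assms unfolding quasiopen_def by auto
  then obtain G where G: "\<And>k::nat. open (G k)"
      "\<And>k. capacity p M (G k) < ennreal ((1 / 2) powr ((p + 1) * real k))" "\<And>k. open (G k \<union> U)"
    by metis
  have small: "\<exists>k::nat. capacity p M (G k) < ennreal \<epsilon>" if "0 < \<epsilon>" for \<epsilon>
    using ex_powr_less[OF that] G(2) by (meson ennreal_leI less_imp_le less_le_trans)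
  have null: "(\<Inter>k. G k) \<in> null_sets M" using small G(1) by (rule null_INT_small_capacity)
  have "(\<Inter>k. G k) - U \<in> null_sets M"
    by (rule null_subset_M[OF null]) auto
  moreover have "(\<Inter>k. G k \<union> U) \<in> sets M"
    using G(3) by (intro borel_sets_M sets.countable_INT) auto
  ultimately have "(\<Inter>k. G k \<union> U) - ((\<Inter>k. G k) - U) \<in> sets M" by auto
  moreover have "(\<Inter>k. G k \<union> U) - ((\<Inter>k. G k) - U) = U" by auto
  ultimately show "U \<in> sets M" by simp
  obtain \<rho> where \<rho>: "\<rho> \<in> borel_measurable borel" "(\<integral>\<^sup>+x. enn_powr (\<rho> x) p \<partial>N) < \<infinity>"
    "\<And>l \<gamma>. arclength_curve (l, \<gamma>) \<Longrightarrow> curve_integral (l, \<gamma>) \<rho> < \<infinity> \<Longrightarrow>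
      \<exists>k0. \<forall>k\<ge>k0. \<gamma> ` {0..l} \<inter> G k = {}"
    using eventually_avoid_small_capacity[OF p setsN, of G] G(2) M by metis
  have "\<exists>V. open V \<and> \<gamma> ` {0..l} \<inter> V = \<gamma> ` {0..l} \<inter> U"
    if \<gamma>: "arclength_curve (l, \<gamma>)" "curve_integral (l, \<gamma>) \<rho> < \<infinity>" for l \<gamma>
  proof -
    obtain k where "\<gamma> ` {0..l} \<inter> G k = {}" using \<rho>(3)[OF \<gamma>] by auto
    then show ?thesis using G(3)[of k] by (intro exI[of _ "G k \<union> U"]) auto
  qed
  then show "\<exists>\<rho>. \<rho> \<in> borel_measurable borel \<and> (\<integral>\<^sup>+x. enn_powr (\<rho> x) p \<partial>N) < \<infinity> \<and>
      (\<forall>l \<gamma>. arclength_curve (l, \<gamma>) \<longrightarrow> curve_integral (l, \<gamma>) \<rho> < \<infinity> \<longrightarrow>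
        (\<exists>V. open V \<and> \<gamma> ` {0..l} \<inter> V = \<gamma> ` {0..l} \<inter> U))"
    using \<rho>(1,2) by blast
qed

text \<open>The avoidance lemma is applied to the constant sequence \<open>E\<close>, for which
  missing all sets of large index means missing \<open>E\<close>.\<close>

lemma capacity_zero_imp:
  assumes "capacity p M E = 0"
  shows "\<exists>\<rho>. \<rho> \<in> borel_measurable borel \<and> (\<integral>\<^sup>+x. enn_powr (\<rho> x) p \<partial>N) < \<infinity> \<and>
      (\<forall>l \<gamma>. arclength_curve (l, \<gamma>) \<longrightarrow> curve_integral (l, \<gamma>) \<rho> < \<infinity> \<longrightarrow> \<gamma> ` {0..l} \<inter> E = {})"
proof -
  have "capacity p (completion N) E < ennreal ((1 / 2) powr ((p + 1) * real k))" for k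
    using assms M by simp
  from eventually_avoid_small_capacity[OF p setsN this] show ?thesis by (metis order_refl)
qed

end

section \<open>Regularity of locally finite measures\<close>

lemma emeasure_UN_half_powers:
  assumes "0 < e" "\<And>k::nat. A k \<in> sets N" "\<And>k. emeasure N (A k) < ennreal (e * (1 / 2) ^ k / 4)"
  shows "emeasure N (\<Union>k. A k) \<le> ennreal (e / 2)"
proof -
  have "emeasure N (\<Union>k. A k) \<le> (\<Sum>k. emeasure N (A k))"
    using assms(2) by (intro emeasure_subadditive_countably) auto
  also have "\<dots> \<le> (\<Sum>k. ennreal (e * (1 / 2) ^ k / 4))"
    using assms(3) by (intro suminf_le summableI less_imp_le)
  finally show ?thesis using suminf_half_powers[OF \<open>0 < e\<close>] by simp
qed

text \<open>Two-sided approximation by closed and open sets is stable under complements and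
  countable unions, so it passes from open sets to all Borel sets. The set \<open>B\<close> of
  finite measure makes continuity from above available.\<close>

lemma regular_on_finite_set:
  fixes N :: "'a::metric_space measure"
  assumes N: "sets N = sets borel" and B: "B \<in> sets borel" "emeasure N B < \<infinity>"
    and "A \<in> sets borel" "0 < e"
  shows "\<exists>C V. closed C \<and> open V \<and> C \<subseteq> A \<and> A \<subseteq> V \<and> emeasure N ((V - C) \<inter> B) < ennreal e"
proof -
  have lim0: "\<exists>n. emeasure N (D n \<inter> B) < ennreal e"
    if D: "\<And>n::nat. D n \<in> sets borel" "decseq D" "(\<Inter>n. D n) = {}" and "0 < e" for D e
  proof -
    have fin: "emeasure N (D n \<inter> B) \<noteq> \<infinity>" for n
      using emeasure_mono[of "D n \<inter> B" B N] B N by (auto simp: top_unique)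
    have "(\<lambda>n. emeasure N (D n \<inter> B)) \<longlonglongrightarrow> emeasure N (\<Inter>n. D n \<inter> B)"
      using D(1,2) B(1) N fin by (intro Lim_emeasure_decseq) (auto simp: decseq_def)
    moreover have "(\<Inter>n. D n \<inter> B) = {}" using D(3) by auto
    ultimately have "(\<lambda>n. emeasure N (D n \<inter> B)) \<longlonglongrightarrow> 0" by simp
    then have "\<forall>\<^sub>F n in sequentially. emeasure N (D n \<inter> B) < ennreal e"
      using \<open>0 < e\<close> by (intro order_tendstoD(2)) auto
    then show ?thesis by (auto simp: eventually_sequentially)
  qed
  have "A \<in> sigma_sets UNIV {S. open S}" using \<open>A \<in> sets borel\<close> by (simp add: borel_def)
  then show ?thesis
    using \<open>0 < e\<close>
  proof (induction A arbitrary: e rule: sigma_sets.induct)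
    case (Basic S)
    then have S: "open S" by simp
    \<comment> \<open>Distances are compared point by point, so that an empty complement needs no
      separate treatment.\<close>
    define C where "C n = {x. \<forall>y\<in>-S. 1 / real (Suc n) \<le> dist x y}" for n
    have C: "closed (C n)" for n
    proof -
      have "C n = (\<Inter>y\<in>-S. {x. 1 / real (Suc n) \<le> dist x y})" by (auto simp: C_def)
      then show ?thesis by (auto intro!: closed_INT closed_Collect_le continuous_intros)
    qed
    have "\<exists>n. emeasure N ((S - C n) \<inter> B) < ennreal e"
    proof (rule lim0)
      show "S - C n \<in> sets borel" for n using S C[of n] by auto
      have "C n \<subseteq> C m" if "n \<le> m" for n m
      proof -
        have "1 / real (Suc m) \<le> 1 / real (Suc n)" using that by (simp add: frac_le)
        then show ?thesis by (auto simp: C_def intro: order_trans)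
      qed
      then show "decseq (\<lambda>n. S - C n)" by (auto simp: decseq_def)
      have "\<exists>n. x \<in> C n" if xS: "x \<in> S" for x
      proof -
        obtain d where d: "0 < d" "ball x d \<subseteq> S" by (rule openE[OF S xS])
        obtain n where n: "1 / real (Suc n) < d" using d(1) by (rule nat_approx_posE)
        have "1 / real (Suc n) \<le> dist x y" if "y \<in> - S" for y
        proof -
          have "y \<notin> ball x d" using d(2) that by auto
          then show ?thesis using n by simp
        qed
        then have "x \<in> C n" by (simp add: C_def)
        then show ?thesis ..
      qed
      then show "(\<Inter>n. S - C n) = {}" by auto
    qed fact
    then obtain n where "emeasure N ((S - C n) \<inter> B) < ennreal e" ..
    moreover have "C n \<subseteq> S"
    proof
      fix x assume "x \<in> C n"
      then have "x \<notin> S \<Longrightarrow> 1 / real (Suc n) \<le> dist x x" unfolding C_def by blast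
      then show "x \<in> S" by (cases "x \<in> S") auto
    qed
    ultimately show ?case using C S by blast
  next
    case Empty
    then show ?case by (intro exI[of _ "{}"]) auto
  next
    case (Compl A)
    from Compl.IH[OF Compl.prems] obtain C V where CV: "closed C" "open V" "C \<subseteq> A" "A \<subseteq> V"
        "emeasure N ((V - C) \<inter> B) < ennreal e"
      by (elim exE conjE)
    moreover have "(V - C) = (- C) - (- V)" by auto
    ultimately show ?case by (intro exI[of _ "- V"] exI[of _ "- C"]) auto
  next
    case (Union A)
    have "\<exists>C V. closed C \<and> open V \<and> C \<subseteq> A i \<and> A i \<subseteq> V \<and>
        emeasure N ((V - C) \<inter> B) < ennreal (e * (1 / 2) ^ i / 4)" for i
      using Union by (intro Union.IH) auto
    then obtain C V where CV: "\<And>i. closed (C i)" "\<And>i. open (V i)" "\<And>i. C i \<subseteq> A i" "\<And>i. A i \<subseteq> V i"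
        "\<And>i. emeasure N ((V i - C i) \<inter> B) < ennreal (e * (1 / 2) ^ i / 4)"
      by metis
    have CVb: "C i \<in> sets borel" "V i \<in> sets borel" for i using CV(1,2) by auto
    then have meas: "(\<Union>i. C i) \<in> sets borel" "(\<Union>i. V i) \<in> sets borel" "\<And>i. (V i - C i) \<inter> B \<in> sets N"
      unfolding N using B by (auto intro!: sets.countable_UN)
    \<comment> \<open>A countable union of closed sets need not be closed, so it is cut off at a
      finite \<open>n\<close> at a cost below \<open>e / 2\<close>.\<close>
    have "\<exists>n. emeasure N (((\<Union>i. C i) - (\<Union>i\<le>n. C i)) \<inter> B) < ennreal (e / 2)"
    proof (rule lim0)
      show "(\<Union>i. C i) - (\<Union>i\<le>n. C i) \<in> sets borel" for n
        using CVb meas by (auto intro!: sets.Diff sets.finite_UN)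
      show "decseq (\<lambda>n. (\<Union>i. C i) - (\<Union>i\<le>n. C i))"
        unfolding decseq_def by (auto dest: order_trans)
    qed (use Union.prems in auto)
    then obtain n where n: "emeasure N (((\<Union>i. C i) - (\<Union>i\<le>n. C i)) \<inter> B) < ennreal (e / 2)" ..
    have "emeasure N (((\<Union>i. V i) - (\<Union>i\<le>n. C i)) \<inter> B) \<le>
        emeasure N ((\<Union>i. (V i - C i) \<inter> B) \<union> ((\<Union>i. C i) - (\<Union>i\<le>n. C i)) \<inter> B)"
      using CV meas B N
      by (intro emeasure_mono) (auto intro!: sets.Un sets.Diff sets.finite_UN sets.Int)
    also have "\<dots> \<le> emeasure N (\<Union>i. (V i - C i) \<inter> B) + emeasure N (((\<Union>i. C i) - (\<Union>i\<le>n. C i)) \<inter> B)"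
      using CV meas B N by (intro emeasure_subadditive) (auto intro!: sets.Diff sets.finite_UN sets.Int)
    also have "\<dots> \<le> ennreal (e / 2) + emeasure N (((\<Union>i. C i) - (\<Union>i\<le>n. C i)) \<inter> B)"
      using Union.prems CV(5) meas by (intro add_right_mono emeasure_UN_half_powers) auto
    also have "\<dots> < ennreal (e / 2) + ennreal (e / 2)"
      using n by (simp add: ennreal_add_left_cancel_less)
    also have "\<dots> = ennreal e" using Union.prems by (simp flip: ennreal_plus)
    finally show ?case
      using CV by (intro exI[of _ "\<Union>i\<le>n. C i"] exI[of _ "\<Union>i. V i"]) (auto, blast+)
  qed
qed

definition locally_finite :: "'a::metric_space measure \<Rightarrow> bool" where
  "locally_finite N \<longleftrightarrow> sets N = sets borel \<and> (\<forall>x r. emeasure N (ball x r) < \<infinity>)"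

text \<open>Balls about a fixed centre exhaust the space; the open set found for the
  \<open>k\<close>-th ball is cut down to that ball, where its excess over \<open>A\<close> is
  controlled.\<close>

lemma locally_finite_outer_regular:
  fixes N :: "'a::metric_space measure"
  assumes N: "locally_finite N" and A: "A \<in> sets borel" and "0 < e"
  obtains V where "open V" "A \<subseteq> V" "emeasure N (V - A) < ennreal e"
proof -
  fix x0 :: 'a
  have sets: "sets N = sets borel" using N by (simp add: locally_finite_def)
  define B where "B k = ball x0 (real k)" for k
  have "\<exists>V. open V \<and> A \<subseteq> V \<and> emeasure N ((V - A) \<inter> B k) < ennreal (e * (1 / 2) ^ k / 4)" for k
  proof -
    obtain C V where CV: "closed C" "open V" "C \<subseteq> A" "A \<subseteq> V"
        "emeasure N ((V - C) \<inter> B k) < ennreal (e * (1 / 2) ^ k / 4)"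
      using regular_on_finite_set[OF sets _ _ A, of "B k" "e * (1 / 2) ^ k / 4"] N \<open>0 < e\<close>
      by (auto simp: B_def locally_finite_def)
    moreover have "emeasure N ((V - A) \<inter> B k) \<le> emeasure N ((V - C) \<inter> B k)"
      using CV A sets by (intro emeasure_mono) (auto simp: B_def)
    ultimately show ?thesis by (meson le_less_trans)
  qed
  then obtain V where V: "\<And>k. open (V k)" "\<And>k. A \<subseteq> V k"
      "\<And>k. emeasure N ((V k - A) \<inter> B k) < ennreal (e * (1 / 2) ^ k / 4)"
    by metis
  have cover: "\<exists>k. x \<in> B k" for x
    using reals_Archimedean2[of "dist x0 x"] by (auto simp: B_def)
  define W where "W = (\<Union>k. V k \<inter> B k)"
  have W: "open W" using V by (auto simp: W_def B_def)
  have "emeasure N (W - A) = emeasure N (\<Union>k. (V k - A) \<inter> B k)"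
    unfolding W_def by (intro arg_cong[where f = "emeasure N"]) auto
  also have "\<dots> \<le> ennreal (e / 2)"
    using V A sets \<open>0 < e\<close> by (intro emeasure_UN_half_powers) (auto simp: B_def)
  also have "\<dots> < ennreal e" using \<open>0 < e\<close> by (simp add: ennreal_lessI)
  finally show ?thesis using that[OF W] V(2) cover by (fastforce simp: W_def)
qed

lemma locally_finite_inner_regular:
  fixes N :: "'a::metric_space measure"
  assumes N: "locally_finite N" and A: "A \<in> sets borel" and "0 < e"
  obtains C where "closed C" "C \<subseteq> A" "emeasure N (A - C) < ennreal e"
proof -
  obtain V where V: "open V" "- A \<subseteq> V" "emeasure N (V - (- A)) < ennreal e"
    using locally_finite_outer_regular[OF N _ \<open>0 < e\<close>, of "- A"] A by (metis borel_comp)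
  moreover have "V - (- A) = A - (- V)" by auto
  ultimately show ?thesis by (intro that[of "- V"]) auto
qed

section \<open>Lusin's theorem for locally finite measures\<close>

lemma Lusin:
  fixes f :: "'a::metric_space \<Rightarrow> real"
  assumes N: "locally_finite N" and f: "f \<in> borel_measurable borel" and "0 < e"
  obtains K where "closed K" "continuous_on K f" "emeasure N (- K) < ennreal e"
proof -
  have sets: "sets N = sets borel" using N by (simp add: locally_finite_def)
  obtain q :: "nat \<Rightarrow> real" where q: "range q = \<rat>"
    using countable_rat by (metis Rats_0 empty_iff range_from_nat_into)
  define L where "L i = {x. q i < f x}" for i
  have L: "L i \<in> sets borel" for i unfolding L_def using f by measurable
  have "\<exists>C. closed C \<and> C \<subseteq> L i \<and> emeasure N (L i - C) < ennreal (e / 2 * (1 / 2) ^ i / 4)" for i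
    using locally_finite_inner_regular[OF N L, of "e / 2 * (1 / 2) ^ i / 4"] \<open>0 < e\<close> by (metis divide_pos_pos mult_pos_pos zero_less_numeral zero_less_one zero_less_power)
  then obtain C where C: "\<And>i. closed (C i)" "\<And>i. C i \<subseteq> L i"
      "\<And>i. emeasure N (L i - C i) < ennreal (e / 2 * (1 / 2) ^ i / 4)"
    by metis
  have "\<exists>D. closed D \<and> D \<subseteq> - L i \<and> emeasure N (- L i - D) < ennreal (e / 2 * (1 / 2) ^ i / 4)" for i
    using locally_finite_inner_regular[OF N, of "- L i" "e / 2 * (1 / 2) ^ i / 4"] L \<open>0 < e\<close> by (metis borel_comp divide_pos_pos mult_pos_pos zero_less_numeral zero_less_one zero_less_power)
  then obtain D where D: "\<And>i. closed (D i)" "\<And>i. D i \<subseteq> - L i"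
      "\<And>i. emeasure N (- L i - D i) < ennreal (e / 2 * (1 / 2) ^ i / 4)"
    by metis
  \<comment> \<open>Within \<open>K\<close> the level set \<open>L i\<close> coincides with
    \<open>C i\<close> and its complement with \<open>D i\<close>. So \<open>L i\<close> is both
    open and closed relative to \<open>K\<close>, for every rational height
    \<open>q i\<close>.\<close>
  define K where "K = (\<Inter>i. C i \<union> D i)"
  have "closed K" unfolding K_def using C(1) D(1) by (intro closed_INT ballI closed_Un)
  have "emeasure N (- K) \<le> emeasure N ((\<Union>i. L i - C i) \<union> (\<Union>i. - L i - D i))"
    using C(1) D(1) L sets by (intro emeasure_mono) (auto simp: K_def intro!: sets.Un sets.countable_UN)
  also have "\<dots> \<le> emeasure N (\<Union>i. L i - C i) + emeasure N (\<Union>i. - L i - D i)"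
    using C(1) D(1) L sets by (intro emeasure_subadditive) (auto intro!: sets.countable_UN)
  also have "\<dots> \<le> ennreal (e / 2 / 2) + ennreal (e / 2 / 2)"
    using C D L sets \<open>0 < e\<close> by (intro add_mono emeasure_UN_half_powers) auto
  also have "\<dots> < ennreal e" using \<open>0 < e\<close> by (auto simp: ennreal_lessI simp flip: ennreal_plus)
  finally have small: "emeasure N (- K) < ennreal e" .
  have *: "\<exists>i. a < q i \<and> q i < b" if "a < b" for a b
    using Rats_dense_in_real[OF that] q by (metis imageE)
  have "continuous_on K f"
    unfolding continuous_on_def
  proof (intro ballI order_tendstoI)
    fix x a assume "x \<in> K" "a < f x"
    then obtain i where i: "a < q i" "q i < f x" using * by blast
    then have "x \<notin> D i" using D(2) by (auto simp: L_def)
    then have "\<forall>\<^sub>F y in at x within K. y \<in> - D i"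
      using D(1)[of i] by (intro topological_tendstoD[OF tendsto_ident_at]) (auto simp: open_Compl)
    moreover have "\<forall>\<^sub>F y in at x within K. y \<in> K" by (simp add: eventually_at_filter)
    ultimately show "\<forall>\<^sub>F y in at x within K. a < f y"
    proof eventually_elim
      case (elim y)
      then have "y \<in> C i" by (auto simp: K_def)
      then show ?case using C(2) i by (force simp: L_def)
    qed
  next
    fix x a assume "x \<in> K" "f x < a"
    then obtain i where i: "f x < q i" "q i < a" using * by blast
    then have "x \<notin> C i" using C(2) by (force simp: L_def)
    then have "\<forall>\<^sub>F y in at x within K. y \<in> - C i"
      using C(1)[of i] by (intro topological_tendstoD[OF tendsto_ident_at]) (auto simp: open_Compl)
    moreover have "\<forall>\<^sub>F y in at x within K. y \<in> K" by (simp add: eventually_at_filter)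
    ultimately show "\<forall>\<^sub>F y in at x within K. f y < a"
    proof eventually_elim
      case (elim y)
      then have "y \<in> D i" by (auto simp: K_def)
      then show ?case using D(2) i by (force simp: L_def)
    qed
  qed
  then show ?thesis using that[OF \<open>closed K\<close>] small by blast
qed

text \<open>The Borel representative differs from \<open>f\<close> only inside a Borel null set
  \<open>Z\<close>, whose complement need not be closed; inner regularity supplies a large closed
  set missing \<open>Z\<close>.\<close>

lemma Lusin_completion:
  fixes f :: "'a::metric_space \<Rightarrow> real"
  assumes N: "locally_finite N" and f: "f \<in> borel_measurable (completion N)" and "0 < e"
  obtains K where "closed K" "continuous_on K f" "emeasure N (- K) < ennreal e"
proof -
  have sets: "sets N = sets borel" using N by (simp add: locally_finite_def)
  have sp: "space N = UNIV" using sets_eq_imp_space_eq[OF sets] by simp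
  obtain f' where f': "f' \<in> borel_measurable N" "AE x in N. f x = f' x"
    using completion_ex_borel_measurable_real[OF f] by blast
  then obtain Z where Z: "{x\<in>space N. f x \<noteq> f' x} \<subseteq> Z" "Z \<in> sets N" "emeasure N Z = 0"
    by (elim AE_E) auto
  have f'b: "f' \<in> borel_measurable borel" using f'(1) sets by (simp cong: measurable_cong_sets)
  obtain K where K: "closed K" "continuous_on K f'" "emeasure N (- K) < ennreal (e / 2)"
    by (rule Lusin[OF N f'b half_gt_zero[OF \<open>0 < e\<close>]])
  obtain C where C: "closed C" "C \<subseteq> - Z" "emeasure N (- Z - C) < ennreal (e / 2)"
    using Z(2) sets by (auto intro: locally_finite_inner_regular[OF N _ half_gt_zero[OF \<open>0 < e\<close>], of "- Z"])
  have "emeasure N (- (K \<inter> C)) \<le> emeasure N (- K \<union> (Z \<union> (- Z - C)))"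
    using K C Z(2) sets by (intro emeasure_mono) auto
  also have "\<dots> \<le> emeasure N (- K) + emeasure N (Z \<union> (- Z - C))"
    using K C Z(2) sets by (intro emeasure_subadditive) auto
  also have "\<dots> \<le> emeasure N (- K) + (emeasure N Z + emeasure N (- Z - C))"
    using K C Z(2) sets by (intro add_left_mono emeasure_subadditive) auto
  also have "\<dots> < ennreal (e / 2) + ennreal (e / 2)"
    using K(3) C(3) Z(3) by (auto intro: add_strict_mono)
  also have "\<dots> = ennreal e" using \<open>0 < e\<close> by (simp flip: ennreal_plus)
  finally have "emeasure N (- (K \<inter> C)) < ennreal e" .
  moreover have "continuous_on (K \<inter> C) f"
  proof (rule continuous_on_eq)
    show "continuous_on (K \<inter> C) f'" using K(2) by (rule continuous_on_subset) auto
    show "f' x = f x" if "x \<in> K \<inter> C" for x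
      using that Z(1) C(2) sp by (cases "f x = f' x") auto
  qed
  ultimately show ?thesis using that[of "K \<inter> C"] K(1) C(1) by auto
qed

section \<open>Lower semicontinuous majorants and properness\<close>

text \<open>A value above \<open>c\<close> is already exceeded by a finite partial sum, and the
  finitely many open sets that contribute to it persist near the point.\<close>

lemma lsc_sum_indicator_open:
  assumes "\<And>n::nat. open (V n)"
  shows "lsc (\<lambda>x. \<Sum>n. indicator (V n) x :: ennreal)"
  unfolding lsc_def
proof (intro allI)
  fix c
  show "open {x. c < (\<Sum>n. indicator (V n) x :: ennreal)}"
  proof (rule iffD2[OF open_subopen], intro ballI)
    fix x assume "x \<in> {x. c < (\<Sum>n. indicator (V n) x :: ennreal)}"
    then have "c < (SUP m. \<Sum>n<m. indicator (V n) x :: ennreal)"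
      by (simp add: suminf_eq_SUP)
    then obtain m where m: "c < (\<Sum>n<m. indicator (V n) x :: ennreal)"
      unfolding less_SUP_iff by blast
    define W where "W = (\<Inter>n\<in>{n. n < m \<and> x \<in> V n}. V n)"
    have "open W" unfolding W_def using assms by (intro open_INT) auto
    moreover have "x \<in> W" by (simp add: W_def)
    moreover have "c < (\<Sum>n. indicator (V n) y :: ennreal)" if "y \<in> W" for y
    proof -
      have "(\<Sum>n<m. indicator (V n) x :: ennreal) \<le> (\<Sum>n<m. indicator (V n) y)"
        using that by (intro sum_mono) (auto simp: W_def split: split_indicator)
      also have "\<dots> \<le> (\<Sum>n. indicator (V n) y)"
        by (intro sum_le_suminf summableI) auto
      finally show ?thesis using m by simp
    qed
    ultimately show "\<exists>T. open T \<and> x \<in> T \<and> T \<subseteq> {x. c < (\<Sum>n. indicator (V n) x :: ennreal)}"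
      by (intro exI[of _ W]) auto
  qed
qed

lemma lsc_enn_powr:
  assumes "lsc f" "0 < p"
  shows "lsc (\<lambda>x. enn_powr (f x) (1 / p))"
  unfolding lsc_def
proof
  fix c
  have "c < enn_powr (f x) (1 / p) \<longleftrightarrow> enn_powr c p < f x" for x
    using enn_powr_less_iff[OF \<open>0 < p\<close>, of c "enn_powr (f x) (1 / p)"] enn_powr_inverse[OF \<open>0 < p\<close>] by simp
  then show "open {x. c < enn_powr (f x) (1 / p)}"
    using assms(1) by (simp add: lsc_def)
qed

text \<open>The sum counts the naturals strictly below \<open>a\<close>, that is, it rounds
  \<open>a\<close> up. With the reverse bound that follows, a function is replaced by a sum of
  indicators of its superlevel sets at a cost of at most 1.\<close>

lemma layer_cake_le: "a \<le> (\<Sum>n. indicator {x. of_nat n < x} a :: ennreal)"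
proof (rule ccontr)
  let ?S = "\<Sum>n. indicator {x. of_nat n < x} a :: ennreal"
  assume "\<not> a \<le> ?S"
  then have less: "?S < a" by simp
  then obtain r where r: "?S = ennreal r" "0 \<le> r" by (cases ?S) (auto simp: top_unique)
  define m where "m = nat \<lfloor>r\<rfloor>"
  have m: "real m \<le> r" "r < real (Suc m)" using r(2) unfolding m_def by linarith+
  have "of_nat n < a" if "n \<le> m" for n
  proof -
    have "of_nat n = ennreal (real n)" by (simp add: ennreal_of_nat_eq_real_of_nat)
    also have "\<dots> \<le> ennreal r" using m that by (intro ennreal_leI) linarith
    also have "\<dots> < a" using less r by simp
    finally show ?thesis .
  qed
  then have "(\<Sum>n<Suc m. indicator {x. of_nat n < x} a :: ennreal) = (\<Sum>n<Suc m. 1)"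
    by (intro sum.cong) auto
  also have "\<dots> = ennreal (real (Suc m))" by (simp only: sum_constant card_lessThan mult_1_right ennreal_of_nat_eq_real_of_nat)
  finally have "ennreal (real (Suc m)) = (\<Sum>n<Suc m. indicator {x. of_nat n < x} a)" by simp
  also have "\<dots> \<le> ?S" by (intro sum_le_suminf summableI) auto
  finally have "ennreal (real (Suc m)) \<le> ennreal r" using r by simp
  then show False using r(2) m by (subst (asm) ennreal_le_iff) auto
qed

lemma layer_cake_ge: "(\<Sum>n. indicator {x. of_nat n < x} a :: ennreal) \<le> a + 1"
proof (cases a)
  case (real r)
  have iff: "of_nat n < a \<longleftrightarrow> n < nat \<lceil>r\<rceil>" for n
    using real by (auto simp: ennreal_of_nat_eq_real_of_nat ennreal_less_iff) linarith+
  have "(\<Sum>n. indicator {x. of_nat n < x} a :: ennreal) = (\<Sum>n<nat \<lceil>r\<rceil>. indicator {x. of_nat n < x} a)"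
    by (rule suminf_finite) (auto simp: iff)
  also have "\<dots> = (\<Sum>n<nat \<lceil>r\<rceil>. 1)" by (rule sum.cong) (auto simp: iff)
  also have "\<dots> = ennreal (real (nat \<lceil>r\<rceil>))" by (simp add: ennreal_of_nat_eq_real_of_nat)
  also have "\<dots> \<le> ennreal (r + 1)" using real by (intro ennreal_leI) linarith
  also have "\<dots> = a + 1" using real by simp
  finally show ?thesis .
qed simp

text \<open>The Vitali--Caratheodory theorem, applied to \<open>\<rho>\<close> to the power \<open>p\<close>.\<close>

lemma ex_lsc_majorant:
  fixes N :: "'a::metric_space measure"
  assumes N: "locally_finite N" and \<rho>: "\<rho> \<in> borel_measurable borel" and "0 < p"
    and int: "(\<integral>\<^sup>+x. enn_powr (\<rho> x) p \<partial>N) < \<infinity>"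
  obtains \<rho>' where "lsc \<rho>'" "\<And>x. \<rho> x \<le> \<rho>' x" "\<And>x. 1 \<le> \<rho>' x"
    "\<And>x r. (\<integral>\<^sup>+y\<in>ball x r. enn_powr (\<rho>' y) p \<partial>N) < \<infinity>"
proof -
  have sets: "sets N = sets borel" using N by (simp add: locally_finite_def)
  have measN: "f \<in> borel_measurable N" if "f \<in> borel_measurable borel" for f :: "'a \<Rightarrow> ennreal"
    using that sets by (simp cong: measurable_cong_sets)
  \<comment> \<open>The summand 1 forces the majorant to be at least 1, and it is why integrability
    is claimed only on balls.\<close>
  define \<phi> where "\<phi> x = enn_powr (\<rho> x) p + 1" for x
  have \<phi>[measurable]: "\<phi> \<in> borel_measurable borel" unfolding \<phi>_def using \<rho> by measurable
  define A where "A n = {x. of_nat n < \<phi> x}" for n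
  have A[measurable]: "A n \<in> sets borel" for n unfolding A_def by measurable
  have "\<exists>V. open V \<and> A n \<subseteq> V \<and> emeasure N (V - A n) < ennreal (1 * (1 / 2) ^ n / 4)" for n
    using locally_finite_outer_regular[OF N A, of "1 * (1 / 2) ^ n / 4" n] by (metis divide_pos_pos mult_1 zero_less_numeral zero_less_one zero_less_power)
  then obtain V where V: "\<And>n. open (V n)" "\<And>n. A n \<subseteq> V n"
      "\<And>n. emeasure N (V n - A n) < ennreal (1 * (1 / 2) ^ n / 4)"
    by metis
  define \<psi> where "\<psi> x = (\<Sum>n. indicator (V n) x :: ennreal)" for x
  have \<phi>_le: "\<phi> x \<le> \<psi> x" for x
  proof -
    have "\<phi> x \<le> (\<Sum>n. indicator {a. of_nat n < a} (\<phi> x))" by (rule layer_cake_le)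
    also have "\<dots> \<le> \<psi> x" unfolding \<psi>_def
      using V(2) by (intro suminf_le summableI) (auto simp: A_def split: split_indicator)
    finally show ?thesis .
  qed
  have \<psi>_le: "\<psi> x \<le> (\<phi> x + 1) + (\<Sum>n. indicator (V n - A n) x)" for x
  proof -
    have "\<psi> x \<le> (\<Sum>n. indicator {a. of_nat n < a} (\<phi> x) + indicator (V n - A n) x)"
      unfolding \<psi>_def by (intro suminf_le summableI) (auto simp: A_def split: split_indicator)
    also have "\<dots> = (\<Sum>n. indicator {a. of_nat n < a} (\<phi> x)) + (\<Sum>n. indicator (V n - A n) x)"
      by (intro suminf_add[symmetric] summableI)
    also have "\<dots> \<le> (\<phi> x + 1) + (\<Sum>n. indicator (V n - A n) x)"
      by (intro add_right_mono layer_cake_ge)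
    finally show ?thesis .
  qed
  have lsc\<psi>: "lsc \<psi>" unfolding \<psi>_def using V(1) by (rule lsc_sum_indicator_open)
  have \<psi>_int: "(\<integral>\<^sup>+y\<in>ball x r. \<psi> y \<partial>N) < \<infinity>" for x r
  proof -
    have [measurable]: "V n \<in> sets borel" for n using V(1) by auto
    have "(\<integral>\<^sup>+y\<in>ball x r. \<psi> y \<partial>N) \<le>
        (\<integral>\<^sup>+y. (enn_powr (\<rho> y) p + 2 * indicator (ball x r) y) + (\<Sum>n. indicator (V n - A n) y) \<partial>N)"
    proof (rule nn_integral_mono)
      have "\<phi> y + 1 = enn_powr (\<rho> y) p + 2" for y by (simp add: \<phi>_def add.assoc one_add_one)
      then show "\<psi> y * indicator (ball x r) y
          \<le> (enn_powr (\<rho> y) p + 2 * indicator (ball x r) y) + (\<Sum>n. indicator (V n - A n) y)" for y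
        using \<psi>_le[of y] by (auto split: split_indicator)
    qed
    also have "\<dots> = ((\<integral>\<^sup>+y. enn_powr (\<rho> y) p \<partial>N) + (\<integral>\<^sup>+y. 2 * indicator (ball x r) y \<partial>N)) +
        (\<integral>\<^sup>+y. (\<Sum>n. indicator (V n - A n) y) \<partial>N)"
    proof -
      have m: "(\<lambda>y. enn_powr (\<rho> y) p) \<in> borel_measurable N" "(\<lambda>y. 2 * indicator (ball x r) y :: ennreal) \<in> borel_measurable N"
         "(\<lambda>y. (\<Sum>n. indicator (V n - A n) y) :: ennreal) \<in> borel_measurable N"
        using \<rho> by (auto intro!: measN borel_measurable_times_ennreal borel_measurable_indicator)
      show ?thesis using m by (simp add: nn_integral_add)
    qed
    also have "(\<integral>\<^sup>+y. 2 * indicator (ball x r) y \<partial>N) = 2 * emeasure N (ball x r)"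
      using sets by (intro nn_integral_cmult_indicator) auto
    also have "(\<integral>\<^sup>+y. (\<Sum>n. indicator (V n - A n) y) \<partial>N) = (\<Sum>n. emeasure N (V n - A n))"
      using sets V by (subst nn_integral_suminf) (auto intro!: measN)
    also have "\<dots> \<le> (\<Sum>n. ennreal (1 * (1 / 2) ^ n / 4))"
      using V(3) by (intro suminf_le summableI less_imp_le)
    also have "\<dots> = ennreal (1 / 2)" by (rule suminf_half_powers) simp
    finally show ?thesis
      using int N by (auto simp: locally_finite_def ennreal_mult_less_top
          ennreal_less_top[of "1 / 2", simplified] elim!: le_less_trans)
  qed
  show ?thesis
  proof (rule that[of "\<lambda>x. enn_powr (\<psi> x) (1 / p)"])
    show "lsc (\<lambda>x. enn_powr (\<psi> x) (1 / p))" by (rule lsc_enn_powr) fact+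
    have ge: "enn_powr b (1 / p) \<le> enn_powr (\<psi> x) (1 / p)" if "b \<le> \<phi> x" for b x
      using that \<phi>_le[of x] \<open>0 < p\<close> by (intro enn_powr_mono) auto
    show "\<rho> x \<le> enn_powr (\<psi> x) (1 / p)" for x
      using ge[of "enn_powr (\<rho> x) p" x] enn_powr_inverse'[OF \<open>0 < p\<close>] by (simp add: \<phi>_def)
    show "1 \<le> enn_powr (\<psi> x) (1 / p)" for x
      using ge[of 1 x] by (simp add: \<phi>_def)
    show "(\<integral>\<^sup>+y\<in>ball x r. enn_powr (enn_powr (\<psi> y) (1 / p)) p \<partial>N) < \<infinity>" for x r
      using \<psi>_int by (simp add: enn_powr_inverse[OF \<open>0 < p\<close>])
  qed
qed

text \<open>Closed balls are compact because disjoint balls of a fixed radius inside a large ball have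
  measure bounded from below.\<close>

lemma doubling_imp_compact_cball:
  fixes M :: "'a::metric_space measure"
  assumes "complete (UNIV :: 'a set)" and d: "doubling M" and sets: "sets borel \<subseteq> sets M"
  shows "compact (cball (x0::'a) R)"
proof -
  obtain C where "C > 0" and C: "\<And>x r. r > 0 \<Longrightarrow> 0 < emeasure M (ball x (2 * r)) \<and>
     emeasure M (ball x (2 * r)) \<le> ennreal C * emeasure M (ball x r) \<and>
     emeasure M (ball x r) < \<infinity>"
    using d unfolding doubling_def by blast
  have pos: "0 < emeasure M (ball x r)" if "0 < r" for x r
    using C[of "r / 2" x] that by simp
  have iter: "emeasure M (ball x (2 ^ m * r)) \<le> ennreal (C ^ m) * emeasure M (ball x r)" if "0 < r" for x r m
  proof (induction m)
    case (Suc m)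
    have "emeasure M (ball x (2 * (2 ^ m * r))) \<le> ennreal C * emeasure M (ball x (2 ^ m * r))"
      using C[of "2 ^ m * r" x] that by simp
    also have "\<dots> \<le> ennreal C * (ennreal (C ^ m) * emeasure M (ball x r))"
      by (rule mult_left_mono[OF Suc]) simp
    finally show ?case using \<open>C > 0\<close> by (simp add: mult.assoc ennreal_mult)
  qed simp
  have "\<exists>k. finite k \<and> cball x0 R \<subseteq> (\<Union>x\<in>k. ball x e)" if "e > 0" for e
  proof (rule ccontr)
    assume no: "\<not> ?thesis"
    have "0 \<le> R" by (rule ccontr) (use no in \<open>auto intro!: exI[of _ "{}"]\<close>)
    \<comment> \<open>If no finite set of centres suffices, a finite separated set can always be
      enlarged by an uncovered point.\<close>
    have ext: "\<exists>S\<subseteq>cball x0 R. finite S \<and> card S = n \<and> (\<forall>x\<in>S. \<forall>y\<in>S. x \<noteq> y \<longrightarrow> e \<le> dist x y)" for n :: nat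
    proof (induction n)
      case 0
      show ?case by (intro exI[of _ "{}"]) auto
    next
      case (Suc n)
      then obtain S where S: "S \<subseteq> cball x0 R" "finite S" "card S = n" "\<forall>x\<in>S. \<forall>y\<in>S. x \<noteq> y \<longrightarrow> e \<le> dist x y"
        by blast
      from no S(2) obtain z where z: "z \<in> cball x0 R" "z \<notin> (\<Union>x\<in>S. ball x e)" by blast
      then have "z \<notin> S" using \<open>e > 0\<close> by auto
      then show ?case
        using S z by (intro exI[of _ "insert z S"]) (auto simp: dist_commute not_less)
    qed
    define r where "r = R + e"
    have "0 < r" using \<open>0 \<le> R\<close> \<open>e > 0\<close> by (simp add: r_def)
    \<comment> \<open>After \<open>m\<close> doublings the ball of radius \<open>e / 2\<close> about
      any point of \<open>cball x0 R\<close> contains \<open>ball x0 r\<close>; radius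
      \<open>2 * r\<close> is enough because \<open>R \<le> r\<close>.\<close>
    obtain m where m: "2 * r / (e / 2) < 2 ^ m" using real_arch_pow[of 2 "2 * r / (e / 2)"] by auto
    define T where "T = emeasure M (ball x0 r)"
    have T: "0 < T" "T < \<infinity>" using pos[OF \<open>0 < r\<close>] C[OF \<open>0 < r\<close>] by (auto simp: T_def)
    have lower: "T \<le> ennreal (C ^ m) * emeasure M (ball x (e / 2))" if "x \<in> cball x0 R" for x
    proof -
      have "ball x0 r \<subseteq> ball x (2 ^ m * (e / 2))"
      proof
        fix y assume "y \<in> ball x0 r"
        then have "dist x y < 2 * r"
          using that dist_triangle[of x y x0] \<open>e > 0\<close> by (simp add: dist_commute r_def)
        also have "2 * r \<le> 2 ^ m * (e / 2)" using m \<open>e > 0\<close> by (simp add: field_simps)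
        finally show "y \<in> ball x (2 ^ m * (e / 2))" by simp
      qed
      then have "T \<le> emeasure M (ball x (2 ^ m * (e / 2)))"
        unfolding T_def using sets by (intro emeasure_mono) auto
      also have "\<dots> \<le> ennreal (C ^ m) * emeasure M (ball x (e / 2))"
        using \<open>e > 0\<close> by (intro iter) simp
      finally show ?thesis .
    qed
    \<comment> \<open>The \<open>n\<close> disjoint balls have measure at least
      \<open>T / C ^ m\<close> each and fit into a ball of measure \<open>T\<close>, so
      \<open>n\<close> is bounded; products replace the quotient to stay in
      \<open>ennreal\<close>.\<close>
    have "of_nat n * T \<le> ennreal (C ^ m) * T" for n :: nat
    proof -
      obtain S where S: "S \<subseteq> cball x0 R" "finite S" "card S = n" "\<forall>x\<in>S. \<forall>y\<in>S. x \<noteq> y \<longrightarrow> e \<le> dist x y"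
        using ext[of n] by blast
      have "of_nat n * T = (\<Sum>x\<in>S. T)" using S by simp
      also have "\<dots> \<le> (\<Sum>x\<in>S. ennreal (C ^ m) * emeasure M (ball x (e / 2)))"
        using S lower by (intro sum_mono) auto
      also have "\<dots> = ennreal (C ^ m) * (\<Sum>x\<in>S. emeasure M (ball x (e / 2)))"
        by (simp add: sum_distrib_left)
      also have "(\<Sum>x\<in>S. emeasure M (ball x (e / 2))) = emeasure M (\<Union>x\<in>S. ball x (e / 2))"
      proof (rule sum_emeasure)
        show "disjoint_family_on (\<lambda>x. ball x (e / 2)) S"
          unfolding disjoint_family_on_def
        proof (intro ballI impI, rule ccontr)
          fix x y assume xy: "x \<in> S" "y \<in> S" "x \<noteq> y" "ball x (e / 2) \<inter> ball y (e / 2) \<noteq> {}"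
          then obtain z where "dist x z < e / 2" "dist y z < e / 2" by auto
          then have "dist x y < e" using dist_triangle[of x y z] by (simp add: dist_commute)
          then show False using S(4) xy by force
        qed
      qed (use S sets in auto)
      also have "\<dots> \<le> T"
        unfolding T_def
      proof (rule emeasure_mono)
        show "(\<Union>x\<in>S. ball x (e / 2)) \<subseteq> ball x0 r"
        proof
          fix y assume "y \<in> (\<Union>x\<in>S. ball x (e / 2))"
          then obtain x where "x \<in> S" "dist x y < e / 2" by auto
          then show "y \<in> ball x0 r"
            using S(1) dist_triangle[of x0 y x] \<open>e > 0\<close> by (force simp: r_def)
        qed
      qed (use sets in auto)
      finally show ?thesis by (simp add: mult_left_mono)
    qed
    moreover obtain t where t: "T = ennreal t" "0 < t" using T by (cases T) auto
    ultimately have "real n * t \<le> C ^ m * t" for n :: nat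
      using \<open>C > 0\<close> by (simp add: ennreal_of_nat_eq_real_of_nat ennreal_mult[symmetric] ennreal_le_iff)
    then have "real n \<le> C ^ m" for n using t by simp
    then show False using reals_Archimedean2[of "C ^ m"] by (meson not_less)
  qed
  moreover have "complete (cball x0 R)"
    using assms(1) by (metis closed_cball complete_closed_subset subset_UNIV)
  ultimately show ?thesis unfolding compact_eq_totally_bounded by blast
qed

section \<open>Infima over Lipschitz curves\<close>

lemma lip1_uminus: "lip1 \<gamma> \<Longrightarrow> lip1 (\<lambda>t. \<gamma> (l - t))"
  by (rule lip1_comp) auto

lemma curve_integral_reverse:
  assumes "lip1 \<gamma>" and [measurable]: "\<rho> \<in> borel_measurable borel"
  shows "curve_integral (l, \<lambda>t. \<gamma> (l - t)) \<rho> = curve_integral (l, \<gamma>) \<rho>"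
proof -
  have [measurable]: "\<gamma> \<in> borel_measurable borel" using assms(1) by (rule lip1_measurable)
  have [measurable]: "{0..l} \<in> sets borel" by simp
  have "curve_integral (l, \<gamma>) \<rho> = ennreal \<bar>-1\<bar> * (\<integral>\<^sup>+t. \<rho> (\<gamma> (l + (-1) * t)) * indicator {0..l} (l + (-1) * t) \<partial>lborel)"
    unfolding curve_integral_def prod.case by (rule nn_integral_real_affine) simp_all
  also have "\<dots> = curve_integral (l, \<lambda>t. \<gamma> (l - t)) \<rho>"
    unfolding curve_integral_def prod.case by (auto intro!: nn_integral_cong split: split_indicator)
  finally show ?thesis ..
qed

lemma lip1_concat:
  fixes \<gamma>1 \<gamma>2 :: "real \<Rightarrow> 'a::metric_space"
  assumes \<gamma>1: "lip1 \<gamma>1" and \<gamma>2: "lip1 \<gamma>2" and join: "\<gamma>1 l1 = \<gamma>2 0" and "0 \<le> l1" "0 \<le> l2"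
    and \<rho>[measurable]: "\<rho> \<in> borel_measurable borel"
  obtains \<gamma> where "lip1 \<gamma>" "\<gamma> 0 = \<gamma>1 0" "\<gamma> (l1 + l2) = \<gamma>2 l2"
    "curve_integral (l1 + l2, \<gamma>) \<rho> \<le> curve_integral (l1, \<gamma>1) \<rho> + curve_integral (l2, \<gamma>2) \<rho>"
proof -
  define \<gamma> where "\<gamma> t = (if t \<le> l1 then \<gamma>1 t else \<gamma>2 (t - l1))" for t
  have "lip1 \<gamma>"
  proof (rule lip1I)
    fix s t :: real assume "s \<le> t"
    consider "t \<le> l1" | "s \<le> l1" "l1 < t" | "l1 < s" by linarith
    then show "dist (\<gamma> s) (\<gamma> t) \<le> t - s"
    proof cases
      case 1
      then show ?thesis using lip1D[OF \<gamma>1, of s t] \<open>s \<le> t\<close> by (simp add: \<gamma>_def)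
    next
      case 2
      then show ?thesis
        using lip1D[OF \<gamma>1, of s l1] lip1D[OF \<gamma>2, of 0 "t - l1"] join
          dist_triangle[of "\<gamma>1 s" "\<gamma>2 (t - l1)" "\<gamma>1 l1"] by (simp add: \<gamma>_def)
    next
      case 3
      then show ?thesis using lip1D[OF \<gamma>2, of "s - l1" "t - l1"] \<open>s \<le> t\<close> by (simp add: \<gamma>_def)
    qed
  qed
  moreover have "\<gamma> 0 = \<gamma>1 0" using \<open>0 \<le> l1\<close> by (simp add: \<gamma>_def)
  moreover have "\<gamma> (l1 + l2) = \<gamma>2 l2" using \<open>0 \<le> l2\<close> join by (auto simp: \<gamma>_def)
  moreover have "curve_integral (l1 + l2, \<gamma>) \<rho> \<le> curve_integral (l1, \<gamma>1) \<rho> + curve_integral (l2, \<gamma>2) \<rho>"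
  proof -
    have [measurable]: "\<gamma>1 \<in> borel_measurable borel" "\<gamma>2 \<in> borel_measurable borel"
      using \<gamma>1 \<gamma>2 by (auto intro: lip1_measurable)
    have [measurable]: "{0..l1} \<in> sets borel" "{0..l2} \<in> sets borel" by auto
    have "curve_integral (l1 + l2, \<gamma>) \<rho> \<le>
       (\<integral>\<^sup>+t. \<rho> (\<gamma>1 t) * indicator {0..l1} t + \<rho> (\<gamma>2 (-l1 + 1 * t)) * indicator {0..l2} (-l1 + 1 * t) \<partial>lborel)"
      unfolding curve_integral_def prod.case
      by (intro nn_integral_mono) (auto simp: \<gamma>_def split: split_indicator)
    also have "\<dots> = (\<integral>\<^sup>+t. \<rho> (\<gamma>1 t) * indicator {0..l1} t \<partial>lborel) +
       (\<integral>\<^sup>+t. \<rho> (\<gamma>2 (-l1 + 1 * t)) * indicator {0..l2} (-l1 + 1 * t) \<partial>lborel)"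
      by (rule nn_integral_add) simp_all
    also have "(\<integral>\<^sup>+t. \<rho> (\<gamma>2 (-l1 + 1 * t)) * indicator {0..l2} (-l1 + 1 * t) \<partial>lborel) =
       (\<integral>\<^sup>+t. \<rho> (\<gamma>2 t) * indicator {0..l2} t \<partial>lborel)"
      using nn_integral_real_affine[of "\<lambda>t. \<rho> (\<gamma>2 t) * indicator {0..l2} t" 1 "- l1"] by simp
    finally show ?thesis by (simp add: curve_integral_def)
  qed
  ultimately show ?thesis by (rule that)
qed

text \<open>Arzela-Ascoli by a diagonal subsequence: compact balls give convergence at rational
  parameters, and the common Lipschitz constant carries it to all others. Pointwise convergence is
  stated because it is what Fatou's lemma takes.\<close>

lemma lip1_subseq_limit:
  fixes \<gamma> :: "nat \<Rightarrow> real \<Rightarrow> 'a::metric_space"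
  assumes proper: "\<And>(x::'a) r. compact (cball x r)" and \<gamma>: "\<And>i. lip1 (\<gamma> i)" and x: "(\<lambda>i. \<gamma> i 0) \<longlonglongrightarrow> x"
  obtains r \<alpha> where "strict_mono r" "lip1 \<alpha>" "\<And>t. (\<lambda>i. \<gamma> (r i) t) \<longlonglongrightarrow> \<alpha> t"
proof -
  have "Bseq (\<lambda>i. dist (\<gamma> i 0) x)"
    using x tendsto_dist_iff convergent_imp_Bseq convergentI by blast
  then obtain b where b: "\<And>i. dist (\<gamma> i 0) x \<le> b" unfolding Bseq_def by auto
  have bd: "\<gamma> i t \<in> cball x (b + \<bar>t\<bar>)" for i t
    using b[of i] lip1D[OF \<gamma>[of i], of 0 t] dist_triangle[of x "\<gamma> i t" "\<gamma> i 0"]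
    by (simp add: dist_commute)
  obtain q :: "nat \<Rightarrow> real" where q: "range q = \<rat>"
    using countable_rat by (metis Rats_0 empty_iff range_from_nat_into)
  interpret subseqs "\<lambda>n s. \<exists>y. (\<lambda>i. \<gamma> (s i) (q n)) \<longlonglongrightarrow> y"
  proof
    fix n and s :: "nat \<Rightarrow> nat"
    have "seq_compact (cball x (b + \<bar>q n\<bar>))" by (intro compact_imp_seq_compact proper)
    moreover have "\<forall>i. \<gamma> (s i) (q n) \<in> cball x (b + \<bar>q n\<bar>)" using bd by blast
    ultimately obtain y r where "strict_mono r" "((\<lambda>i. \<gamma> (s i) (q n)) \<circ> r) \<longlonglongrightarrow> y"
      by (rule seq_compactE)
    then show "\<exists>r'. strict_mono r' \<and> (\<exists>y. (\<lambda>i. \<gamma> ((s \<circ> r') i) (q n)) \<longlonglongrightarrow> y)"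
      by (intro exI[of _ r]) (auto simp: o_def)
  qed
  have conv_q: "\<exists>y. (\<lambda>i. \<gamma> (diagseq i) (q n)) \<longlonglongrightarrow> y" for n
  proof -
    have "\<exists>y. (\<lambda>i. \<gamma> ((diagseq \<circ> (+) (Suc n)) i) (q n)) \<longlonglongrightarrow> y"
    proof (rule diagseq_holds)
      fix r s :: "nat \<Rightarrow> nat" and n assume "strict_mono r" "\<exists>y. (\<lambda>i. \<gamma> (s i) (q n)) \<longlonglongrightarrow> y"
      then show "\<exists>y. (\<lambda>i. \<gamma> ((s \<circ> r) i) (q n)) \<longlonglongrightarrow> y"
        using LIMSEQ_subseq_LIMSEQ[of "\<lambda>i. \<gamma> (s i) (q n)" _ r] by (auto simp: o_def)
    qed
    then obtain y where "(\<lambda>i. \<gamma> (diagseq (i + Suc n)) (q n)) \<longlonglongrightarrow> y" by (auto simp: add.commute)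
    then have "(\<lambda>i. \<gamma> (diagseq i) (q n)) \<longlonglongrightarrow> y" by (rule LIMSEQ_offset)
    then show ?thesis ..
  qed
  have conv: "\<exists>y. (\<lambda>i. \<gamma> (diagseq i) t) \<longlonglongrightarrow> y" for t
  proof -
    have cauchy: "Cauchy (\<lambda>i. \<gamma> (diagseq i) t)"
    proof (rule metric_CauchyI)
      fix e :: real assume "0 < e"
      then have "t < t + e / 3" by simp
      from Rats_dense_in_real[OF this] q obtain n where n: "t < q n" "q n < t + e / 3" by (metis imageE)
      from conv_q[of n] have "Cauchy (\<lambda>i. \<gamma> (diagseq i) (q n))" by (auto intro: LIMSEQ_imp_Cauchy)
      from metric_CauchyD[OF this, of "e / 3"] \<open>0 < e\<close>
      obtain K where K: "\<And>i j. K \<le> i \<Longrightarrow> K \<le> j \<Longrightarrow> dist (\<gamma> (diagseq i) (q n)) (\<gamma> (diagseq j) (q n)) < e / 3"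
        by auto
      have "dist (\<gamma> (diagseq i) t) (\<gamma> (diagseq j) t) < e" if "K \<le> i" "K \<le> j" for i j
      proof -
        have "dist (\<gamma> (diagseq k) (q n)) (\<gamma> (diagseq k) t) < e / 3" for k
          using lip1D[OF \<gamma>[of "diagseq k"], of "q n" t] n by simp
        from this[of i] this[of j] K[OF that]
        show ?thesis
          using dist_triangle[of "\<gamma> (diagseq i) t" "\<gamma> (diagseq j) t" "\<gamma> (diagseq i) (q n)"]
            dist_triangle[of "\<gamma> (diagseq i) (q n)" "\<gamma> (diagseq j) t" "\<gamma> (diagseq j) (q n)"]
          by (simp add: dist_commute)
      qed
      then show "\<exists>M. \<forall>m\<ge>M. \<forall>n\<ge>M. dist (\<gamma> (diagseq m) t) (\<gamma> (diagseq n) t) < e" by blast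
    qed
    have "complete (cball x (b + \<bar>t\<bar>))" by (intro compact_imp_complete proper)
    then obtain y where "(\<lambda>i. \<gamma> (diagseq i) t) \<longlonglongrightarrow> y"
      by (rule completeE[OF _ _ cauchy]) (use bd in auto)
    then show ?thesis ..
  qed
  define \<alpha> where "\<alpha> t = (SOME y. (\<lambda>i. \<gamma> (diagseq i) t) \<longlonglongrightarrow> y)" for t
  have \<alpha>: "(\<lambda>i. \<gamma> (diagseq i) t) \<longlonglongrightarrow> \<alpha> t" for t
    using someI_ex[OF conv[of t]] by (simp add: \<alpha>_def)
  have "lip1 \<alpha>"
    unfolding lip1_def
  proof (intro allI)
    fix s t
    have "(\<lambda>i. dist (\<gamma> (diagseq i) s) (\<gamma> (diagseq i) t)) \<longlonglongrightarrow> dist (\<alpha> s) (\<alpha> t)"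
      by (intro tendsto_dist \<alpha>)
    then show "dist (\<alpha> s) (\<alpha> t) \<le> \<bar>s - t\<bar>"
      by (rule LIMSEQ_le_const2) (use lip1D[OF \<gamma>] in auto)
  qed
  then show ?thesis using that[OF subseq_diagseq _ \<alpha>] by blast
qed

text \<open>Infima over 1-Lipschitz curves rather than curves parametrized by arc length, because
  only the former are preserved by locally uniform limits.\<close>

definition path_inf :: "'a::metric_space set \<Rightarrow> ('a \<Rightarrow> real) \<Rightarrow> ('a \<Rightarrow> ennreal) \<Rightarrow> 'a \<Rightarrow> real" where
  "path_inf K \<phi> \<rho> x = enn2real (min 1 (INF c \<in> {(l, \<gamma>). 0 \<le> l \<and> lip1 \<gamma> \<and> \<gamma> 0 = x \<and> \<gamma> l \<in> K}.
      ennreal (\<phi> (snd c (fst c))) + curve_integral c \<rho>))"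

lemma path_inf_nonneg: "0 \<le> path_inf K \<phi> \<rho> x"
  by (simp add: path_inf_def)

text \<open>The cap at 1 keeps the value finite even if no curve from \<open>x\<close> reaches
  \<open>K\<close>, when the infimum is infinite.\<close>

lemma ennreal_path_inf:
  "ennreal (path_inf K \<phi> \<rho> x) = min 1 (INF c \<in> {(l, \<gamma>). 0 \<le> l \<and> lip1 \<gamma> \<and> \<gamma> 0 = x \<and> \<gamma> l \<in> K}.
      ennreal (\<phi> (snd c (fst c))) + curve_integral c \<rho>)"
proof -
  have "min 1 a < (top :: ennreal)" for a by (simp add: min_less_iff_disj)
  then show ?thesis unfolding path_inf_def by (rule ennreal_enn2real)
qed

lemma path_inf_le_1: "path_inf K \<phi> \<rho> x \<le> 1"
proof -
  have "ennreal (path_inf K \<phi> \<rho> x) \<le> ennreal 1" unfolding ennreal_path_inf by simp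
  then show ?thesis by (simp only: ennreal_le_iff zero_le_one)
qed

lemma path_inf_upper:
  assumes "0 \<le> l" "lip1 \<gamma>" "\<gamma> l \<in> K"
  shows "ennreal (path_inf K \<phi> \<rho> (\<gamma> 0)) \<le> ennreal (\<phi> (\<gamma> l)) + curve_integral (l, \<gamma>) \<rho>"
  unfolding ennreal_path_inf using assms
  by (intro min.coboundedI2 INF_lower2[of "(l, \<gamma>)"]) auto

text \<open>Extremality: a function \<open>w\<close> whose change along curves is controlled by
  \<open>\<rho>\<close> and which equals \<open>\<phi>\<close> on \<open>K\<close> lies below
  \<open>path_inf\<close>, hence agrees with it on \<open>K\<close> by
  \<open>path_inf_on\<close>.\<close>

lemma path_inf_lower:
  assumes "w x \<le> 1"
    and "\<And>l \<gamma>. 0 \<le> l \<Longrightarrow> lip1 \<gamma> \<Longrightarrow> \<gamma> 0 = x \<Longrightarrow> \<gamma> l \<in> K \<Longrightarrow>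
      ennreal (w x) \<le> ennreal (\<phi> (\<gamma> l)) + curve_integral (l, \<gamma>) \<rho>"
  shows "w x \<le> path_inf K \<phi> \<rho> x"
proof -
  have "ennreal (w x) \<le> ennreal (path_inf K \<phi> \<rho> x)"
    unfolding ennreal_path_inf using assms by (intro min.boundedI INF_greatest) auto
  then show ?thesis using path_inf_nonneg[of K \<phi> \<rho> x] by (simp add: ennreal_le_iff)
qed

text \<open>Below the cap the value is the infimum itself, so a bound \<open>c \<le> 1\<close>
  yields a near-minimizing curve.\<close>

lemma path_inf_less:
  assumes "path_inf K \<phi> \<rho> x < c" "c \<le> 1"
  obtains l \<gamma> where "0 \<le> l" "lip1 \<gamma>" "\<gamma> 0 = x" "\<gamma> l \<in> K"
    "ennreal (\<phi> (\<gamma> l)) + curve_integral (l, \<gamma>) \<rho> < ennreal c"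
proof -
  have "ennreal (path_inf K \<phi> \<rho> x) < ennreal c" using le_less_trans[OF path_inf_nonneg assms(1)] assms(1) by (rule ennreal_lessI)
  moreover have "ennreal c \<le> 1" using assms(2) by simp
  ultimately have "(INF c \<in> {(l, \<gamma>). 0 \<le> l \<and> lip1 \<gamma> \<and> \<gamma> 0 = x \<and> \<gamma> l \<in> K}.
      ennreal (\<phi> (snd c (fst c))) + curve_integral c \<rho>) < ennreal c"
    unfolding ennreal_path_inf min_less_iff_disj by auto
  then show ?thesis unfolding INF_less_iff using that by auto
qed

lemma path_inf_on:
  assumes "x \<in> K" "0 \<le> \<phi> x"
  shows "path_inf K \<phi> \<rho> x \<le> \<phi> x"
proof -
  have "curve_integral (0, \<lambda>_. x) \<rho> = 0"
    unfolding curve_integral_def prod.case by (subst nn_integral_cmult_indicator) auto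
  moreover have "lip1 (\<lambda>_. x)" by (simp add: lip1_def)
  ultimately have "ennreal (path_inf K \<phi> \<rho> x) \<le> ennreal (\<phi> x)"
    using path_inf_upper[of 0 "\<lambda>_. x" K \<phi> \<rho>] assms by simp
  then show ?thesis using assms by (simp add: ennreal_le_iff)
qed

text \<open>A competitor from the end of \<open>\<gamma>\<close>, preceded by
  \<open>\<gamma>\<close>, is a competitor from its start; reversing \<open>\<gamma>\<close> gives
  the other inequality. The finite integral \<open>r\<close> is subtracted on the left so that the
  capped infimum can be bounded termwise.\<close>

lemma path_inf_upper_gradient:
  assumes "0 \<le> l" "lip1 \<gamma>" and \<rho>: "\<rho> \<in> borel_measurable borel"
  shows "ennreal \<bar>path_inf K \<phi> \<rho> (\<gamma> 0) - path_inf K \<phi> \<rho> (\<gamma> l)\<bar> \<le> curve_integral (l, \<gamma>) \<rho>"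
proof -
  have *: "ennreal (path_inf K \<phi> \<rho> (\<gamma> 0)) \<le> ennreal (path_inf K \<phi> \<rho> (\<gamma> l)) + curve_integral (l, \<gamma>) \<rho>"
    if \<gamma>: "lip1 \<gamma>" for \<gamma>
  proof (cases "curve_integral (l, \<gamma>) \<rho>")
    case (real r)
    define S where "S = {(l', \<gamma>'). 0 \<le> l' \<and> lip1 \<gamma>' \<and> \<gamma>' 0 = \<gamma> l \<and> \<gamma>' l' \<in> K}"
    define J where "J c = ennreal (\<phi> (snd c (fst c))) + curve_integral c \<rho>" for c :: "real \<times> (real \<Rightarrow> 'a)"
    have le: "ennreal (path_inf K \<phi> \<rho> (\<gamma> 0)) \<le> J c + ennreal r" if cS: "c \<in> S" for c
    proof -
      obtain l' \<gamma>' where c: "c = (l', \<gamma>')" "0 \<le> l'" "lip1 \<gamma>'" "\<gamma>' 0 = \<gamma> l" "\<gamma>' l' \<in> K"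
        using cS by (auto simp: S_def)
      obtain \<beta> where \<beta>: "lip1 \<beta>" "\<beta> 0 = \<gamma> 0" "\<beta> (l + l') = \<gamma>' l'"
        "curve_integral (l + l', \<beta>) \<rho> \<le> curve_integral (l, \<gamma>) \<rho> + curve_integral (l', \<gamma>') \<rho>"
        using lip1_concat[OF \<gamma> c(3) c(4)[symmetric] \<open>0 \<le> l\<close> c(2) \<rho>] by blast
      have "ennreal (path_inf K \<phi> \<rho> (\<beta> 0)) \<le> ennreal (\<phi> (\<beta> (l + l'))) + curve_integral (l + l', \<beta>) \<rho>"
        using \<beta> c \<open>0 \<le> l\<close> by (intro path_inf_upper) auto
      also have "\<dots> \<le> ennreal (\<phi> (\<gamma>' l')) + (curve_integral (l, \<gamma>) \<rho> + curve_integral (l', \<gamma>') \<rho>)"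
        unfolding \<beta>(3) by (intro add_left_mono \<beta>(4))
      finally show ?thesis using c \<beta>(2) real by (simp add: J_def add_ac)
    qed
    define m where "m = min 1 (INF c\<in>S. J c)"
    have m: "ennreal (path_inf K \<phi> \<rho> (\<gamma> l)) = m"
      unfolding ennreal_path_inf m_def S_def J_def ..
    have "ennreal (path_inf K \<phi> \<rho> (\<gamma> 0)) - ennreal r \<le> m"
      unfolding m_def
    proof (intro min.boundedI INF_greatest)
      show "ennreal (path_inf K \<phi> \<rho> (\<gamma> 0)) - ennreal r \<le> 1"
        using path_inf_le_1[of K \<phi> \<rho> "\<gamma> 0"] by (intro order_trans[OF diff_le_self_ennreal]) simp
      show "ennreal (path_inf K \<phi> \<rho> (\<gamma> 0)) - ennreal r \<le> J c" if "c \<in> S" for c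
        using le[OF that] by (simp add: ennreal_minus_le_iff add.commute)
    qed
    then show ?thesis
      unfolding m real by (simp add: ennreal_minus_le_iff add.commute)
  qed simp
  show ?thesis
    unfolding ennreal_abs_diff_le_iff[OF path_inf_nonneg path_inf_nonneg]
    using *[OF \<open>lip1 \<gamma>\<close>] *[OF lip1_uminus[OF \<open>lip1 \<gamma>\<close>, of l]] curve_integral_reverse[OF \<open>lip1 \<gamma>\<close> \<rho>, of l]
    by simp
qed

lemma length_le_curve_integral:
  assumes "\<And>x. 1 \<le> \<rho> x" "0 \<le> l"
  shows "ennreal l \<le> curve_integral (l, \<gamma>) \<rho>"
proof -
  have "ennreal l = (\<integral>\<^sup>+t. indicator {0..l} t \<partial>lborel)" using \<open>0 \<le> l\<close> by simp
  also have "\<dots> \<le> curve_integral (l, \<gamma>) \<rho>"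
    unfolding curve_integral_def prod.case using assms by (intro nn_integral_mono) (auto split: split_indicator)
  finally show ?thesis .
qed

text \<open>Fatou's lemma. A parameter of \<open>{0..l}\<close> below \<open>l\<close> eventually
  belongs to \<open>{0..L i}\<close>, and the single parameter \<open>l\<close> is
  discarded.\<close>

lemma curve_integral_le_liminf:
  assumes \<rho>: "lsc \<rho>" and \<gamma>: "\<And>i. lip1 (\<gamma> i)" and \<alpha>: "\<And>t. (\<lambda>i. \<gamma> i t) \<longlonglongrightarrow> \<alpha> t" and l: "L \<longlonglongrightarrow> l"
  shows "curve_integral (l, \<alpha>) \<rho> \<le> liminf (\<lambda>i. curve_integral (L i, \<gamma> i) \<rho>)"
proof -
  have [measurable]: "\<rho> \<in> borel_measurable borel" "\<And>i. \<gamma> i \<in> borel_measurable borel"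
    using \<rho> \<gamma> by (auto intro: lsc_measurable lip1_measurable)
  have [measurable]: "{0..x} \<in> sets borel" for x :: real by simp
  have "curve_integral (l, \<alpha>) \<rho> \<le> (\<integral>\<^sup>+t. liminf (\<lambda>i. \<rho> (\<gamma> i t) * indicator {0..L i} t) \<partial>lborel)"
    unfolding curve_integral_def prod.case
  proof (rule nn_integral_mono_AE)
    show "AE t in lborel. \<rho> (\<alpha> t) * indicator {0..l} t \<le> liminf (\<lambda>i. \<rho> (\<gamma> i t) * indicator {0..L i} t)"
      using AE_lborel_singleton[of l]
    proof eventually_elim
      case (elim t)
      show ?case
      proof (cases "t \<in> {0..l}")
        case True
        then have "t < l" using elim by auto
        then have "\<forall>\<^sub>F i in sequentially. t < L i" using order_tendstoD(1)[OF l] by blast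
        then have "\<forall>\<^sub>F i in sequentially. \<rho> (\<gamma> i t) \<le> \<rho> (\<gamma> i t) * indicator {0..L i} t"
          by eventually_elim (use True in auto)
        then have "liminf (\<lambda>i. \<rho> (\<gamma> i t)) \<le> liminf (\<lambda>i. \<rho> (\<gamma> i t) * indicator {0..L i} t)"
          by (rule Liminf_mono)
        then show ?thesis using lsc_le_Liminf[OF \<rho> \<alpha>[of t]] True by simp
      qed simp
    qed
  qed
  also have "\<dots> \<le> liminf (\<lambda>i. \<integral>\<^sup>+t. \<rho> (\<gamma> i t) * indicator {0..L i} t \<partial>lborel)"
    by (rule nn_integral_liminf) simp
  finally show ?thesis by (simp add: curve_integral_def)
qed

text \<open>Sublevel sets are closed by the direct method: near-minimizing curves from points
  tending to \<open>x\<close> subconverge to a competitor from \<open>x\<close>. Closedness of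
  \<open>K\<close> and continuity of \<open>\<phi>\<close> on \<open>K\<close> take care of the end
  point, semicontinuity of \<open>\<rho>\<close> of the integral.\<close>

lemma open_path_inf:
  fixes K :: "'a::metric_space set"
  assumes proper: "\<And>(x::'a) r. compact (cball x r)"
    and \<rho>: "lsc \<rho>" "\<And>x. 1 \<le> \<rho> x" and K: "closed K" and \<phi>: "continuous_on K \<phi>" "\<And>x. 0 \<le> \<phi> x"
  shows "open {x. c < path_inf K \<phi> \<rho> x}"
proof -
  consider "c < 0" | "1 \<le> c" | "0 \<le> c" "c < 1" by linarith
  then show ?thesis
  proof cases
    case 1
    then have "{x. c < path_inf K \<phi> \<rho> x} = UNIV" using path_inf_nonneg[of K \<phi> \<rho>] by (auto intro: less_le_trans)
    then show ?thesis by simp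
  next
    case 2
    then have "{x. c < path_inf K \<phi> \<rho> x} = {}" using path_inf_le_1[of K \<phi> \<rho>] by (auto simp: not_less intro: order_trans)
    then show ?thesis by simp
  next
    case 3
    have "closed {x. path_inf K \<phi> \<rho> x \<le> c}"
      unfolding closed_sequential_limits
    proof (intro allI impI, elim conjE)
      fix X x assume X: "\<forall>n. X n \<in> {x. path_inf K \<phi> \<rho> x \<le> c}" and lim: "X \<longlonglongrightarrow> x"
      \<comment> \<open>The slack tends to 0 and keeps \<open>c + \<delta> n\<close> within the cap
        1, which then also bounds the lengths of the curves.\<close>
      define \<delta> where "\<delta> n = (1 - c) / real (Suc n)" for n
      have \<delta>: "0 < \<delta> n" "c + \<delta> n \<le> 1" for n
      proof -
        have "(1 - c) / real (Suc n) \<le> (1 - c) / 1" using 3 by (intro divide_left_mono) auto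
        then show "0 < \<delta> n" "c + \<delta> n \<le> 1" using 3 by (auto simp: \<delta>_def)
      qed
      have \<delta>0: "\<delta> \<longlonglongrightarrow> 0"
        unfolding \<delta>_def using LIMSEQ_Suc[OF lim_const_over_n[of "1 - c"]] by simp
      have "\<exists>l \<gamma>. 0 \<le> l \<and> lip1 \<gamma> \<and> \<gamma> 0 = X n \<and> \<gamma> l \<in> K \<and>
          ennreal (\<phi> (\<gamma> l)) + curve_integral (l, \<gamma>) \<rho> < ennreal (c + \<delta> n)" for n
      proof -
        have "path_inf K \<phi> \<rho> (X n) < c + \<delta> n" using X \<delta>(1)[of n] by (auto intro: le_less_trans)
        from path_inf_less[OF this \<delta>(2)] show ?thesis by metis
      qed
      then obtain L \<gamma> where L: "\<And>n. 0 \<le> L n" and \<gamma>: "\<And>n. lip1 (\<gamma> n)" "\<And>n. \<gamma> n 0 = X n" "\<And>n. \<gamma> n (L n) \<in> K"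
          and small: "\<And>n. ennreal (\<phi> (\<gamma> n (L n))) + curve_integral (L n, \<gamma> n) \<rho> < ennreal (c + \<delta> n)"
        by metis
      have L1: "L n \<in> {0..1}" for n
      proof -
        have "ennreal (L n) \<le> curve_integral (L n, \<gamma> n) \<rho>" by (rule length_le_curve_integral[OF \<rho>(2) L])
        also have "\<dots> \<le> ennreal (\<phi> (\<gamma> n (L n))) + curve_integral (L n, \<gamma> n) \<rho>" by simp
        also have "\<dots> \<le> ennreal (c + \<delta> n)" using small by (rule less_imp_le)
        also have "\<dots> \<le> ennreal 1" using \<delta>(2) by (rule ennreal_leI)
        finally show ?thesis using L by (simp del: ennreal_1)
      qed
      have lim0: "(\<lambda>n. \<gamma> n 0) \<longlonglongrightarrow> x" using lim \<gamma>(2) by simp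
      obtain r \<alpha> where r: "strict_mono r" and \<alpha>: "lip1 \<alpha>" "\<And>t. (\<lambda>i. \<gamma> (r i) t) \<longlonglongrightarrow> \<alpha> t"
        by (rule lip1_subseq_limit[OF proper \<gamma>(1) lim0]) (rule that)
      have "seq_compact {0..1::real}" by (intro compact_imp_seq_compact) simp
      moreover have "\<forall>i. L (r i) \<in> {0..1}" using L1 by blast
      ultimately obtain l s where l: "l \<in> {0..1}" and s: "strict_mono s" and Ll: "((\<lambda>i. L (r i)) \<circ> s) \<longlonglongrightarrow> l"
        by (rule seq_compactE)
      define k where "k i = r (s i)" for i
      have k: "strict_mono k" using strict_mono_o[OF r s] by (simp add: k_def[abs_def] o_def)
      have \<alpha>k: "(\<lambda>i. \<gamma> (k i) t) \<longlonglongrightarrow> \<alpha> t" for t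
        using LIMSEQ_subseq_LIMSEQ[OF \<alpha>(2)[of t] s] by (simp add: k_def o_def)
      have Lk: "(\<lambda>i. L (k i)) \<longlonglongrightarrow> l" using Ll by (simp add: k_def o_def)
      have "\<alpha> 0 = x"
        using \<alpha>k[of 0] LIMSEQ_subseq_LIMSEQ[OF lim k] \<gamma>(2) by (auto simp: o_def intro: LIMSEQ_unique)
      \<comment> \<open>Convergence at the fixed parameter \<open>l\<close> is enough, since the
        Lipschitz bound absorbs the moving parameter \<open>L (k i)\<close>.\<close>
      have ends: "(\<lambda>i. \<gamma> (k i) (L (k i))) \<longlonglongrightarrow> \<alpha> l"
      proof (rule metric_tendsto_imp_tendsto[where f = "\<lambda>i. \<bar>L (k i) - l\<bar> + dist (\<gamma> (k i) l) (\<alpha> l)" and a = 0])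
        have "(\<lambda>i. L (k i) - l) \<longlonglongrightarrow> 0" using tendsto_diff[OF Lk tendsto_const[of l]] by simp
        then have a1: "(\<lambda>i. \<bar>L (k i) - l\<bar>) \<longlonglongrightarrow> 0" by (rule tendsto_rabs_zero)
        have a2: "(\<lambda>i. dist (\<gamma> (k i) l) (\<alpha> l)) \<longlonglongrightarrow> 0" using tendsto_dist[OF \<alpha>k[of l] tendsto_const[of "\<alpha> l"]] by simp
        show "(\<lambda>i. \<bar>L (k i) - l\<bar> + dist (\<gamma> (k i) l) (\<alpha> l)) \<longlonglongrightarrow> 0"
          using tendsto_add[OF a1 a2] by simp
        have "dist (\<gamma> (k i) (L (k i))) (\<alpha> l) \<le> \<bar>L (k i) - l\<bar> + dist (\<gamma> (k i) l) (\<alpha> l)" for i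
          using lip1D[OF \<gamma>(1)[of "k i"], of "L (k i)" l] dist_triangle[of "\<gamma> (k i) (L (k i))" "\<alpha> l" "\<gamma> (k i) l"]
          by simp
        then show "\<forall>\<^sub>F i in sequentially. dist (\<gamma> (k i) (L (k i))) (\<alpha> l) \<le> dist (\<bar>L (k i) - l\<bar> + dist (\<gamma> (k i) l) (\<alpha> l)) 0"
          by (auto simp: dist_real_def)
      qed
      have "\<alpha> l \<in> K" by (rule closed_sequentially[OF K _ ends]) (rule \<gamma>(3))
      have \<phi>lim: "(\<lambda>i. \<phi> (\<gamma> (k i) (L (k i)))) \<longlonglongrightarrow> \<phi> (\<alpha> l)"
        using \<phi>(1) \<gamma>(3) \<open>\<alpha> l \<in> K\<close> ends unfolding continuous_on_sequentially by (auto simp: o_def)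
      have \<delta>k: "(\<lambda>i. \<delta> (k i)) \<longlonglongrightarrow> 0" using LIMSEQ_subseq_LIMSEQ[OF \<delta>0 k] by (simp add: o_def)
      have ci: "\<phi> (\<gamma> n (L n)) \<le> c + \<delta> n \<and> curve_integral (L n, \<gamma> n) \<rho> \<le> ennreal (c + \<delta> n - \<phi> (\<gamma> n (L n)))" for n
      proof -
        have "curve_integral (L n, \<gamma> n) \<rho> < top" using small[of n]
          by (cases "curve_integral (L n, \<gamma> n) \<rho>") auto
        then obtain I where I: "curve_integral (L n, \<gamma> n) \<rho> = ennreal I" "0 \<le> I"
          by (cases "curve_integral (L n, \<gamma> n) \<rho>") auto
        have "ennreal (\<phi> (\<gamma> n (L n)) + I) < ennreal (c + \<delta> n)" using small[of n] I \<phi>(2) by simp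
        then have "\<phi> (\<gamma> n (L n)) + I \<le> c + \<delta> n"
          using I \<phi>(2) by (subst (asm) ennreal_less_iff) auto
        then show ?thesis using I by (auto intro!: ennreal_leI)
      qed
      have rlim: "(\<lambda>i. c + \<delta> (k i) - \<phi> (\<gamma> (k i) (L (k i)))) \<longlonglongrightarrow> c - \<phi> (\<alpha> l)"
        using tendsto_diff[OF tendsto_add[OF tendsto_const[of c] \<delta>k] \<phi>lim] by simp
      then have "0 \<le> c - \<phi> (\<alpha> l)" by (rule LIMSEQ_le_const) (use ci in auto)
      have "curve_integral (l, \<alpha>) \<rho> \<le> liminf (\<lambda>i. curve_integral (L (k i), \<gamma> (k i)) \<rho>)"
        by (intro curve_integral_le_liminf \<rho>(1) \<gamma>(1) \<alpha>k Lk)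
      also have "\<dots> \<le> liminf (\<lambda>i. ennreal (c + \<delta> (k i) - \<phi> (\<gamma> (k i) (L (k i)))))"
        using ci by (intro Liminf_mono) auto
      also have "\<dots> = ennreal (c - \<phi> (\<alpha> l))"
        by (intro lim_imp_Liminf tendsto_ennrealI rlim) simp
      finally have int: "curve_integral (l, \<alpha>) \<rho> \<le> ennreal (c - \<phi> (\<alpha> l))" .
      have "ennreal (path_inf K \<phi> \<rho> (\<alpha> 0)) \<le> ennreal (\<phi> (\<alpha> l)) + curve_integral (l, \<alpha>) \<rho>"
        using l \<alpha>(1) \<open>\<alpha> l \<in> K\<close> by (intro path_inf_upper) auto
      also have "\<dots> \<le> ennreal (\<phi> (\<alpha> l)) + ennreal (c - \<phi> (\<alpha> l))" by (intro add_left_mono int)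
      also have "\<dots> = ennreal c" using \<phi>(2) \<open>0 \<le> c - \<phi> (\<alpha> l)\<close> by (simp flip: ennreal_plus)
      finally show "x \<in> {x. path_inf K \<phi> \<rho> x \<le> c}" using \<open>\<alpha> 0 = x\<close> 3 by simp
    qed
    then show ?thesis by (simp add: closed_def Collect_neg_eq[symmetric] not_le)
  qed
qed

section \<open>Functions with an upper gradient\<close>

lemma lsc_cmult:
  assumes "lsc f" "0 < c"
  shows "lsc (\<lambda>x. ennreal c * f x)"
  unfolding lsc_def
proof
  fix a
  have inv: "ennreal (1 / c) * (ennreal c * b) = b" "ennreal c * (ennreal (1 / c) * b) = b" for b
    using \<open>0 < c\<close> by (simp_all add: mult.assoc[symmetric] ennreal_mult[symmetric])
  have "a < ennreal c * f x \<longleftrightarrow> ennreal (1 / c) * a < f x" for x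
    using ennreal_mult_strict_left_mono[of a "ennreal c * f x" "ennreal (1 / c)"]
      ennreal_mult_strict_left_mono[of "ennreal (1 / c) * a" "f x" "ennreal c"] \<open>0 < c\<close>
    by (auto simp: inv)
  then show "open {x. a < ennreal c * f x}" using assms(1) by (simp add: lsc_def)
qed

lemma open_less_add:
  fixes f g :: "'a::topological_space \<Rightarrow> real"
  assumes f: "\<And>c. open {x. c < f x}" and g: "\<And>c. open {x. c < g x}"
  shows "open {x. a < f x + g x}"
proof (rule iffD2[OF open_subopen], intro ballI)
  fix x assume x: "x \<in> {x. a < f x + g x}"
  define d where "d = (f x + g x - a) / 2"
  have "0 < d" using x by (simp add: d_def)
  have "y \<in> {x. a < f x + g x}" if "y \<in> {y. f x - d < f y} \<inter> {y. g x - d < g y}" for y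
    using that by (simp add: d_def field_simps)
  then show "\<exists>T. open T \<and> x \<in> T \<and> T \<subseteq> {x. a < f x + g x}"
    using f g \<open>0 < d\<close> by (intro exI[of _ "{y. f x - d < f y} \<inter> {y. g x - d < g y}"]) auto
qed

lemma curve_integral_cmult:
  assumes "lip1 \<gamma>" and [measurable]: "\<rho> \<in> borel_measurable borel"
  shows "curve_integral (l, \<gamma>) (\<lambda>x. ennreal c * \<rho> x) = ennreal c * curve_integral (l, \<gamma>) \<rho>"
proof -
  have [measurable]: "\<gamma> \<in> borel_measurable borel" using assms(1) by (rule lip1_measurable)
  show ?thesis
    unfolding curve_integral_def prod.case
    by (subst nn_integral_cmult[symmetric]) (auto simp: mult.assoc)
qed

text \<open>If the curve meets \<open>K\<close>, the piece before the first visit pays for the value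
  at the start, and the reversed curve pays for the value at the end; both pieces are off
  \<open>K\<close> up to one parameter. The two costs need not be added, because
  \<open>\<bar>a - b\<bar> \<le> max a b\<close> for nonnegative numbers.\<close>

lemma zero_set_upper_gradient:
  fixes h :: "'a::metric_space \<Rightarrow> real"
  assumes K: "closed K" "\<And>x. x \<in> K \<Longrightarrow> h x = 0" and "\<And>x. 0 \<le> h x"
    and \<sigma>[measurable]: "\<sigma> \<in> borel_measurable borel"
    and ug: "\<And>l \<gamma>. 0 \<le> l \<Longrightarrow> lip1 \<gamma> \<Longrightarrow> ennreal \<bar>h (\<gamma> 0) - h (\<gamma> l)\<bar> \<le> curve_integral (l, \<gamma>) \<sigma>"
    and l: "0 \<le> l" and \<gamma>: "lip1 \<gamma>"
  shows "ennreal \<bar>h (\<gamma> 0) - h (\<gamma> l)\<bar> \<le> curve_integral (l, \<gamma>) (\<lambda>x. \<sigma> x * indicator (- K) x)"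
proof -
  have K_meas[measurable]: "K \<in> sets borel" using K(1) by simp
  show ?thesis
  proof (cases "\<exists>t\<in>{0..l}. \<gamma> t \<in> K")
    case False
    then have "curve_integral (l, \<gamma>) (\<lambda>x. \<sigma> x * indicator (- K) x) = curve_integral (l, \<gamma>) \<sigma>"
      unfolding curve_integral_def prod.case by (intro nn_integral_cong) (auto split: split_indicator)
    then show ?thesis using ug[OF l \<gamma>] by simp
  next
    case True
    have *: "ennreal (h (\<gamma> 0)) \<le> curve_integral (l, \<gamma>) (\<lambda>x. \<sigma> x * indicator (- K) x)"
      if \<gamma>: "lip1 \<gamma>" and hit: "\<exists>t\<in>{0..l}. \<gamma> t \<in> K" for \<gamma>
    proof -
      define T where "T = {0..l} \<inter> \<gamma> -` K"
      have "closed T" unfolding T_def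
        using continuous_closed_preimage[OF lip1_continuous[OF \<gamma>] _ K(1), of "{0..l}"] by simp
      moreover have "T \<noteq> {}" "bdd_below T" using hit by (auto simp: T_def bdd_below_def)
      ultimately have inf: "Inf T \<in> T" by (intro closed_contains_Inf)
      have low: "t \<notin> T" if "t < Inf T" for t
        using cInf_lower[of t T] \<open>bdd_below T\<close> that by auto
      have "ennreal (h (\<gamma> 0)) \<le> curve_integral (Inf T, \<gamma>) \<sigma>"
        using ug[of "Inf T" \<gamma>] \<gamma> inf K(2) assms(3)[of "\<gamma> 0"] by (simp add: T_def)
      also have "\<dots> \<le> curve_integral (l, \<gamma>) (\<lambda>x. \<sigma> x * indicator (- K) x)"
        unfolding curve_integral_def prod.case
      proof (rule nn_integral_mono_AE)
        show "AE t in lborel. \<sigma> (\<gamma> t) * indicator {0..Inf T} t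
            \<le> \<sigma> (\<gamma> t) * indicator (- K) (\<gamma> t) * indicator {0..l} t"
          using AE_lborel_singleton[of "Inf T"]
        proof eventually_elim
          case (elim t)
          show ?case
          proof (cases "t \<in> {0..Inf T}")
            case True
            then have "t \<notin> T" "t \<in> {0..l}" using elim low[of t] inf by (auto simp: T_def)
            then have "\<gamma> t \<notin> K" by (auto simp: T_def)
            then show ?thesis using \<open>t \<in> {0..l}\<close> True by simp
          qed simp
        qed
      qed
      finally show ?thesis .
    qed
    let ?I = "curve_integral (l, \<gamma>) (\<lambda>x. \<sigma> x * indicator (- K) x)"
    have "(\<lambda>x. \<sigma> x * indicator (- K) x) \<in> borel_measurable borel" by measurable
    from curve_integral_reverse[OF \<gamma> this, of l]
    have "curve_integral (l, \<lambda>t. \<gamma> (l - t)) (\<lambda>x. \<sigma> x * indicator (- K) x) = ?I" .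
    moreover have "\<exists>t\<in>{0..l}. \<gamma> (l - t) \<in> K"
    proof -
      from True obtain t where "t \<in> {0..l}" "\<gamma> t \<in> K" by blast
      then show ?thesis by (intro bexI[of _ "l - t"]) auto
    qed
    ultimately have "ennreal (h (\<gamma> 0)) \<le> ?I" "ennreal (h (\<gamma> l)) \<le> ?I"
      using *[OF \<gamma> True] *[OF lip1_uminus[OF \<gamma>, of l]] by auto
    moreover have "\<bar>h (\<gamma> 0) - h (\<gamma> l)\<bar> \<le> max (h (\<gamma> 0)) (h (\<gamma> l))"
      using assms(3)[of "\<gamma> 0"] assms(3)[of "\<gamma> l"] by linarith
    then have "ennreal \<bar>h (\<gamma> 0) - h (\<gamma> l)\<bar> \<le> ennreal (max (h (\<gamma> 0)) (h (\<gamma> l)))" by (rule ennreal_leI)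
    ultimately show ?thesis by (auto simp: max_def split: if_splits)
  qed
qed

lemma curve_integral_clamped:
  "curve_integral (l, \<gamma>) g = curve_integral (l, \<lambda>t. \<gamma> (clamp_to l t)) g"
  unfolding curve_integral_clamp[of l \<gamma>] by (simp add: curve_integral_def)

section \<open>The weighted measure and capacity estimates\<close>

locale lsc_weight =
  fixes N :: "'a::metric_space measure" and p :: real and \<rho> :: "'a \<Rightarrow> ennreal"
  assumes proper: "\<And>(x::'a) r. compact (cball x r)"
    and N: "locally_finite N" and p: "0 < p"
    and \<rho>: "lsc \<rho>" "\<And>x. 1 \<le> \<rho> x"
    and \<rho>_int: "\<And>x r. (\<integral>\<^sup>+y\<in>ball x r. enn_powr (\<rho> y) p \<partial>N) < \<infinity>"
begin

text \<open>Since \<open>1 \<le> \<rho>\<close>, this measure dominates both \<open>N\<close> and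
  the \<open>p\<close>-energy of \<open>\<rho>\<close>, so smallness is asked of
  \<open>\<nu>\<close> alone. Lusin's theorem and outer regularity are applied to it.\<close>

definition \<nu> :: "'a measure" where
  "\<nu> = density N (\<lambda>x. enn_powr (\<rho> x) p)"

lemma sets_N [simp]: "sets N = sets borel"
  using N by (simp add: locally_finite_def)

lemma measurable_N: "f \<in> borel_measurable borel \<Longrightarrow> f \<in> borel_measurable N"
  by (simp cong: measurable_cong_sets)

lemma \<rho>_measurable [measurable]: "\<rho> \<in> borel_measurable borel"
  using \<rho>(1) by (rule lsc_measurable)

lemma \<rho>_powr_measurable [measurable]: "(\<lambda>x. enn_powr (\<rho> x) p) \<in> borel_measurable N"
  by (intro measurable_N) measurable

lemma sets_\<nu> [simp]: "sets \<nu> = sets borel"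
  by (simp add: \<nu>_def)

lemma emeasure_\<nu>:
  "A \<in> sets borel \<Longrightarrow> emeasure \<nu> A = (\<integral>\<^sup>+x\<in>A. enn_powr (\<rho> x) p \<partial>N)"
  by (simp add: \<nu>_def emeasure_density)

lemma locally_finite_\<nu>: "locally_finite \<nu>"
  using \<rho>_int by (simp add: locally_finite_def emeasure_\<nu>)

lemma \<nu>_null: "A \<in> sets borel \<Longrightarrow> emeasure N A = 0 \<Longrightarrow> emeasure \<nu> A = 0"
proof -
  assume [measurable]: "A \<in> sets borel" and 0: "emeasure N A = 0"
  have "(\<lambda>x. enn_powr (\<rho> x) p * indicator A x) \<in> borel_measurable N"
    by (intro measurable_N) measurable
  moreover have "A \<in> null_sets N" using 0 by (simp add: null_sets_def)
  from AE_not_in[OF this] have "AE x in N. enn_powr (\<rho> x) p * indicator A x = 0"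
    by eventually_elim simp
  ultimately show ?thesis
    by (simp add: emeasure_\<nu> nn_integral_0_iff_AE)
qed

text \<open>\<open>h / \<tau>\<close> is a test function whose gradient may be cut off on
  \<open>K\<close>. The two summands of the constant belong to the two terms of the norm; in the
  first, \<open>h\<close> is bounded by 1 and 1 by the \<open>p\<close>-th power of
  \<open>\<rho>\<close>.\<close>

lemma capacity_superlevel_le:
  fixes h :: "'a \<Rightarrow> real"
  assumes K: "closed K" "\<And>x. x \<in> K \<Longrightarrow> h x = 0" and h: "\<And>x. 0 \<le> h x" "\<And>x. h x \<le> 1"
    and h_meas [measurable]: "h \<in> borel_measurable borel"
    and ug: "\<And>l \<gamma>. 0 \<le> l \<Longrightarrow> lip1 \<gamma> \<Longrightarrow>
      ennreal \<bar>h (\<gamma> 0) - h (\<gamma> l)\<bar> \<le> curve_integral (l, \<gamma>) (\<lambda>x. ennreal c * \<rho> x)"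
    and "0 < c" "0 < \<tau>"
  shows "capacity p (completion N) {x. \<tau> < h x} \<le>
    ennreal ((1 / \<tau>) powr p + (c / \<tau>) powr p) * emeasure \<nu> (- K)"
proof -
  have [measurable]: "- K \<in> sets borel" "- K \<in> sets N" using K(1) by auto
  define g where "g x = ennreal (c / \<tau>) * (\<rho> x * indicator (- K) x)" for x
  have g[measurable]: "g \<in> borel_measurable borel" unfolding g_def by measurable
  have one_le: "1 \<le> enn_powr (\<rho> x) p" for x
    using enn_powr_mono[OF \<rho>(2) p, of x] by simp
  have "capacity p (completion N) {x. \<tau> < h x} \<le>
    (\<integral>\<^sup>+x. enn_powr (ennreal (h x / \<tau>)) p \<partial>completion N) + (\<integral>\<^sup>+x. enn_powr (g x) p \<partial>completion N)"
  proof (rule capacity_le_test[OF p])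
    show "(\<lambda>x. h x / \<tau>) \<in> borel_measurable (completion N)"
      by (intro measurable_completion) (simp cong: measurable_cong_sets)
    show "0 \<le> h x / \<tau>" for x using h \<open>0 < \<tau>\<close> by simp
    show "1 \<le> h x / \<tau>" if "x \<in> {x. \<tau> < h x}" for x using that \<open>0 < \<tau>\<close> by simp
    fix l :: real and \<gamma> :: "real \<Rightarrow> 'a" assume arc: "arclength_curve (l, \<gamma>)"
    let ?\<gamma> = "\<lambda>t. \<gamma> (clamp_to l t)"
    have l: "0 \<le> l" using arc by (simp add: arclength_curve_def)
    have lip: "lip1 ?\<gamma>" using arc by (rule arclength_curve_clamp_lip1)
    have m: "(\<lambda>x. ennreal c * \<rho> x) \<in> borel_measurable borel" by measurable
    have "ennreal \<bar>h (?\<gamma> 0) - h (?\<gamma> l)\<bar> \<le> curve_integral (l, ?\<gamma>) (\<lambda>x. ennreal c * \<rho> x * indicator (- K) x)"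
      by (rule zero_set_upper_gradient[OF K h(1) m ug l lip])
    then have "ennreal (1 / \<tau>) * ennreal \<bar>h (?\<gamma> 0) - h (?\<gamma> l)\<bar> \<le>
        ennreal (1 / \<tau>) * curve_integral (l, ?\<gamma>) (\<lambda>x. ennreal c * \<rho> x * indicator (- K) x)"
      by (rule mult_left_mono) simp
    also have "\<dots> = curve_integral (l, ?\<gamma>) (\<lambda>x. ennreal (1 / \<tau>) * (ennreal c * \<rho> x * indicator (- K) x))"
      by (rule curve_integral_cmult[symmetric, OF lip]) measurable
    also have "(\<lambda>x. ennreal (1 / \<tau>) * (ennreal c * \<rho> x * indicator (- K) x)) = g"
      using \<open>0 < c\<close> \<open>0 < \<tau>\<close> by (auto simp: fun_eq_iff g_def mult.assoc[symmetric] ennreal_mult[symmetric])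
    also have "ennreal (1 / \<tau>) * ennreal \<bar>h (?\<gamma> 0) - h (?\<gamma> l)\<bar> = ennreal \<bar>h (\<gamma> 0) / \<tau> - h (\<gamma> l) / \<tau>\<bar>"
      using l \<open>0 < \<tau>\<close> by (simp add: clamp_to_def ennreal_mult[symmetric] diff_divide_distrib[symmetric])
    finally show "ennreal \<bar>h (\<gamma> 0) / \<tau> - h (\<gamma> l) / \<tau>\<bar> \<le> curve_integral (l, \<gamma>) g"
      by (simp add: curve_integral_clamped[of l \<gamma>])
  qed (rule g)
  also have "\<dots> = (\<integral>\<^sup>+x. enn_powr (ennreal (h x / \<tau>)) p \<partial>N) + (\<integral>\<^sup>+x. enn_powr (g x) p \<partial>N)"
    by (simp add: nn_integral_completion)
  also have "\<dots> \<le> (\<integral>\<^sup>+x. ennreal ((1 / \<tau>) powr p) * (enn_powr (\<rho> x) p * indicator (- K) x) \<partial>N) +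
      (\<integral>\<^sup>+x. ennreal ((c / \<tau>) powr p) * (enn_powr (\<rho> x) p * indicator (- K) x) \<partial>N)"
  proof (intro add_mono nn_integral_mono)
    fix x
    show "enn_powr (ennreal (h x / \<tau>)) p \<le> ennreal ((1 / \<tau>) powr p) * (enn_powr (\<rho> x) p * indicator (- K) x)"
    proof (cases "x \<in> K")
      case False
      have "enn_powr (ennreal (h x / \<tau>)) p \<le> ennreal ((1 / \<tau>) powr p) * 1"
        using h[of x] \<open>0 < \<tau>\<close> p
        by (simp add: enn_powr_ennreal) (intro ennreal_leI powr_mono2, auto simp: divide_right_mono)
      also have "\<dots> \<le> ennreal ((1 / \<tau>) powr p) * enn_powr (\<rho> x) p"
        by (intro mult_left_mono one_le) simp
      finally show ?thesis using False by simp
    qed (use K in simp)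
    show "enn_powr (g x) p \<le> ennreal ((c / \<tau>) powr p) * (enn_powr (\<rho> x) p * indicator (- K) x)"
      using \<open>0 < c\<close> \<open>0 < \<tau>\<close>
      by (auto simp: g_def enn_powr_mult[OF p] enn_powr_ennreal split: split_indicator)
  qed
  also have "\<dots> = ennreal ((1 / \<tau>) powr p) * emeasure \<nu> (- K) + ennreal ((c / \<tau>) powr p) * emeasure \<nu> (- K)"
    by (simp add: emeasure_\<nu> nn_integral_cmult)
  also have "\<dots> = ennreal ((1 / \<tau>) powr p + (c / \<tau>) powr p) * emeasure \<nu> (- K)"
    by (simp add: ring_distribs)
  finally show ?thesis .
qed

text \<open>The lower semicontinuous majorants \<open>F\<close> of \<open>w\<close> and \<open>F'\<close> of \<open>1 - w\<close> built from a large
  closed set \<open>K\<close> on which \<open>w\<close> is continuous are exact on \<open>K\<close>.  Hence \<open>F + F' - 1\<close>, which bounds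
  \<open>F - w\<close>, vanishes on \<open>K\<close>, and its superlevel sets are open with small capacity.\<close>

lemma lower_quasicontinuous:
  fixes w :: "'a \<Rightarrow> real"
  assumes w_meas: "w \<in> borel_measurable borel" and w: "\<And>x. 0 \<le> w x" "\<And>x. w x \<le> 1"
    and ug: "\<And>l \<gamma>. 0 \<le> l \<Longrightarrow> lip1 \<gamma> \<Longrightarrow>
      ennreal \<bar>w (\<gamma> 0) - w (\<gamma> l)\<bar> \<le> curve_integral (l, \<gamma>) (\<lambda>x. ennreal c * \<rho> x)"
    and "1 \<le> c" "0 < \<epsilon>"
  shows "\<exists>G. open G \<and> capacity p (completion N) G < ennreal \<epsilon> \<and>
    (\<forall>a. \<exists>V. open V \<and> {x. a < w x} - G = V - G)"
proof -
  define \<sigma> where "\<sigma> x = ennreal c * \<rho> x" for x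
  have \<sigma>: "lsc \<sigma>" unfolding \<sigma>_def using \<rho>(1) \<open>1 \<le> c\<close> by (intro lsc_cmult) auto
  have \<sigma>1: "1 \<le> \<sigma> x" for x
    using mult_mono[of 1 "ennreal c" 1 "\<rho> x"] \<rho>(2)[of x] \<open>1 \<le> c\<close> by (simp add: \<sigma>_def)
  have \<sigma>_meas: "\<sigma> \<in> borel_measurable borel" using \<sigma> by (rule lsc_measurable)
  define \<tau> where "\<tau> i = (1 / 2 :: real) ^ i" for i :: nat
  have \<tau>: "0 < \<tau> i" for i by (simp add: \<tau>_def)
  \<comment> \<open>The constant of \<open>capacity_superlevel_le\<close> at level
    \<open>\<tau> i\<close>, with gradient factor \<open>2 * c\<close> because \<open>h\<close> adds
    the gradients of \<open>F\<close> and \<open>F'\<close>. Then \<open>\<delta> i\<close> makes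
    \<open>B i * \<delta> i\<close> the \<open>i\<close>-th term of a series with sum
    \<open>\<epsilon> / 2\<close>.\<close>
  define B where "B i = (1 / \<tau> i) powr p + (2 * c / \<tau> i) powr p" for i
  have B: "0 < B i" for i using \<tau>[of i] \<open>1 \<le> c\<close> by (auto simp: B_def intro!: add_pos_nonneg)
  define \<delta> where "\<delta> i = \<epsilon> * (1 / 2) ^ i / 4 / B i" for i
  have \<delta>: "0 < \<delta> i" for i using B \<open>0 < \<epsilon>\<close> by (simp add: \<delta>_def)
  have "\<exists>K. closed K \<and> continuous_on K w \<and> emeasure \<nu> (- K) < ennreal (\<delta> i)" for i
    using Lusin[OF locally_finite_\<nu> w_meas \<delta>[of i]] by metis
  then obtain K where K: "\<And>i. closed (K i)" "\<And>i. continuous_on (K i) w"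
      "\<And>i. emeasure \<nu> (- K i) < ennreal (\<delta> i)" by metis
  define F where "F i = path_inf (K i) w \<sigma>" for i
  define F' where "F' i = path_inf (K i) (\<lambda>x. 1 - w x) \<sigma>" for i
  define h where "h i x = F i x + F' i x - 1" for i x
  have F_ge: "w x \<le> F i x" for i x
    unfolding F_def
  proof (rule path_inf_lower)
    fix l :: real and \<gamma> :: "real \<Rightarrow> 'a" assume "0 \<le> l" "lip1 \<gamma>" "\<gamma> 0 = x"
    then show "ennreal (w x) \<le> ennreal (w (\<gamma> l)) + curve_integral (l, \<gamma>) \<sigma>"
      using ug[of l \<gamma>] unfolding ennreal_abs_diff_le_iff[OF w(1) w(1)] \<sigma>_def by simp
  qed (rule w)
  have F'_ge: "1 - w x \<le> F' i x" for i x
    unfolding F'_def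
  proof (rule path_inf_lower[where w = "\<lambda>x. 1 - w x"])
    fix l :: real and \<gamma> :: "real \<Rightarrow> 'a" assume *: "0 \<le> l" "lip1 \<gamma>" "\<gamma> 0 = x"
    have eq: "(1 - w (\<gamma> 0)) - (1 - w (\<gamma> l)) = - (w (\<gamma> 0) - w (\<gamma> l))" by simp
    have "ennreal \<bar>(1 - w (\<gamma> 0)) - (1 - w (\<gamma> l))\<bar> \<le> curve_integral (l, \<gamma>) \<sigma>"
      using ug[of l \<gamma>] * unfolding eq abs_minus_cancel \<sigma>_def by simp
    then show "ennreal (1 - w x) \<le> ennreal (1 - w (\<gamma> l)) + curve_integral (l, \<gamma>) \<sigma>"
      using w(2) * by (subst (asm) ennreal_abs_diff_le_iff) auto
  qed (use w in auto)
  have open_F: "open {x. a < F i x}" for i a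
    unfolding F_def by (rule open_path_inf[OF proper \<sigma> \<sigma>1 K(1,2) w(1)])
  have open_F': "open {x. a < F' i x}" for i a
    unfolding F'_def using w(2) K(2) by (intro open_path_inf[OF proper \<sigma> \<sigma>1 K(1)]) (auto intro!: continuous_intros)
  have open_h: "open {x. a < h i x}" for i a
    using open_less_add[OF open_F open_F', of "a + 1" i i] by (simp add: h_def algebra_simps)
  define G where "G = (\<Union>i. {x. \<tau> i < h i x})"
  have cap_i: "capacity p (completion N) {x. \<tau> i < h i x} < ennreal (\<epsilon> * (1 / 2) ^ i / 4)" for i
  proof -
    have "capacity p (completion N) {x. \<tau> i < h i x} \<le> ennreal (B i) * emeasure \<nu> (- K i)"
      unfolding B_def
    proof (rule capacity_superlevel_le)
      show "h i x = 0" if "x \<in> K i" for x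
      proof -
        have "F i x \<le> w x" "F' i x \<le> 1 - w x"
          unfolding F_def F'_def using that w by (auto intro!: path_inf_on)
        then show ?thesis using F_ge[of x i] F'_ge[of x i] by (simp add: h_def)
      qed
      show "0 \<le> h i x" for x using F_ge[of x i] F'_ge[of x i] by (simp add: h_def)
      show "h i x \<le> 1" for x
        using path_inf_le_1[of "K i" w \<sigma> x] path_inf_le_1[of "K i" "\<lambda>x. 1 - w x" \<sigma> x]
        by (simp add: h_def F_def F'_def)
      show "h i \<in> borel_measurable borel"
        using open_h by (intro borel_measurable_iff_greater[THEN iffD2]) auto
      fix l :: real and \<gamma> :: "real \<Rightarrow> 'a" assume l: "0 \<le> l" and \<gamma>: "lip1 \<gamma>"
      have "\<bar>h i (\<gamma> 0) - h i (\<gamma> l)\<bar> \<le> \<bar>F i (\<gamma> 0) - F i (\<gamma> l)\<bar> + \<bar>F' i (\<gamma> 0) - F' i (\<gamma> l)\<bar>"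
        by (simp add: h_def)
      then have "ennreal \<bar>h i (\<gamma> 0) - h i (\<gamma> l)\<bar> \<le> ennreal \<bar>F i (\<gamma> 0) - F i (\<gamma> l)\<bar> + ennreal \<bar>F' i (\<gamma> 0) - F' i (\<gamma> l)\<bar>"
        by (metis abs_ge_zero ennreal_leI ennreal_plus)
      also have "\<dots> \<le> curve_integral (l, \<gamma>) \<sigma> + curve_integral (l, \<gamma>) \<sigma>"
        unfolding F_def F'_def by (intro add_mono path_inf_upper_gradient l \<gamma> \<sigma>_meas)
      also have "\<dots> = ennreal (2 * c) * curve_integral (l, \<gamma>) \<rho>"
        using \<open>1 \<le> c\<close> unfolding \<sigma>_def curve_integral_cmult[OF \<gamma> \<rho>_measurable]
        by (simp add: ennreal_mult mult_2[symmetric] mult.assoc)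
      also have "\<dots> = curve_integral (l, \<gamma>) (\<lambda>x. ennreal (2 * c) * \<rho> x)"
        by (rule curve_integral_cmult[symmetric, OF \<gamma> \<rho>_measurable])
      finally show "ennreal \<bar>h i (\<gamma> 0) - h i (\<gamma> l)\<bar> \<le> curve_integral (l, \<gamma>) (\<lambda>x. ennreal (2 * c) * \<rho> x)" .
    qed (use K \<tau> \<open>1 \<le> c\<close> in auto)
    also have "\<dots> < ennreal (B i) * ennreal (\<delta> i)"
      using K(3)[of i] B[of i] by (intro ennreal_mult_strict_left_mono) auto
    also have "\<dots> = ennreal (\<epsilon> * (1 / 2) ^ i / 4)"
      using B[of i] \<delta>[of i] by (subst ennreal_mult[symmetric]) (auto simp: \<delta>_def)
    finally show ?thesis .
  qed
  have "open G" unfolding G_def using open_h by auto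
  moreover have "capacity p (completion N) G < ennreal \<epsilon>"
    unfolding G_def using cap_i sets_eq_imp_space_eq[OF sets_N]
    by (intro capacity_Union_less p \<open>0 < \<epsilon>\<close>) auto
  moreover have "\<exists>V. open V \<and> {x. a < w x} - G = V - G" for a
  proof (intro exI conjI)
    show "open (\<Union>i. {x. a + \<tau> i < F i x})" using open_F by blast
    \<comment> \<open>Off \<open>G\<close> one has \<open>w \<le> F i \<le> w + \<tau> i\<close>, so
      a superlevel set of \<open>w\<close> is a union of open superlevel sets of the
      \<open>F i\<close>, with levels raised by \<open>\<tau> i\<close>.\<close>
    have "a < w x \<longleftrightarrow> (\<exists>i. a + \<tau> i < F i x)" if "x \<notin> G" for x
    proof
      assume "a < w x"
      then obtain i where "\<tau> i < w x - a"
        using real_arch_pow_inv[of "w x - a" "1 / 2"] by (auto simp: \<tau>_def)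
      then show "\<exists>i. a + \<tau> i < F i x" using F_ge[of x i] by (intro exI[of _ i]) linarith
    next
      assume "\<exists>i. a + \<tau> i < F i x"
      then obtain i where "a + \<tau> i < F i x" ..
      moreover have "h i x \<le> \<tau> i" using that by (auto simp: G_def not_less)
      ultimately show "a < w x" using F'_ge[of x i] by (simp add: h_def)
    qed
    then show "{x. a < w x} - G = (\<Union>i. {x. a + \<tau> i < F i x}) - G" by auto
  qed
  ultimately show ?thesis by blast
qed

text \<open>A null set need not have small capacity; the condition on curves provides it. If
  \<open>W\<close> is open, contains \<open>Z\<close> and is \<open>\<nu>\<close>-small, the capped
  path distance to the complement of \<open>W\<close> vanishes off \<open>W\<close> and equals 1 on
  \<open>E\<close>, since no curve of finite weight leaves a point of \<open>E\<close>.\<close>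

lemma ex_open_small_capacity:
  assumes Z: "Z \<in> sets borel" "emeasure N Z = 0" "E \<subseteq> Z"
    and E: "\<And>l \<gamma>. 0 \<le> l \<Longrightarrow> lip1 \<gamma> \<Longrightarrow> \<gamma> 0 \<in> E \<Longrightarrow> \<gamma> l \<noteq> \<gamma> 0 \<Longrightarrow> curve_integral (l, \<gamma>) \<rho> = \<infinity>"
    and "0 < \<epsilon>"
  shows "\<exists>G. open G \<and> E \<subseteq> G \<and> capacity p (completion N) G < ennreal \<epsilon>"
proof -
  \<comment> \<open>The constant of \<open>capacity_superlevel_le\<close> for \<open>c = 1\<close>
    and \<open>\<tau> = 1 / 2\<close>; any level below 1 would give an open set containing
    \<open>E\<close>.\<close>
  define B where "B = (1 / (1 / 2)) powr p + (1 / (1 / 2)) powr p"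
  have "0 < B" by (simp add: B_def)
  then have "0 < \<epsilon> / B" using \<open>0 < \<epsilon>\<close> by simp
  then obtain W where W: "open W" "Z \<subseteq> W" "emeasure \<nu> (W - Z) < ennreal (\<epsilon> / B)"
    by (rule locally_finite_outer_regular[OF locally_finite_\<nu> Z(1)])
  have "emeasure \<nu> W \<le> emeasure \<nu> (W - Z) + emeasure \<nu> Z"
    using W Z emeasure_subadditive[of "W - Z" \<nu> Z] by (simp add: Un_absorb2)
  then have \<nu>W: "emeasure \<nu> W < ennreal (\<epsilon> / B)"
    using W(3) \<nu>_null[OF Z(1,2)] by simp
  define h where "h = path_inf (- W) (\<lambda>_. 0) \<rho>"
  have open_h: "open {x. a < h x}" for a
    unfolding h_def using W(1) by (intro open_path_inf[OF proper \<rho>]) auto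
  have h1: "1 \<le> h x" if "x \<in> E" for x
    unfolding h_def
  proof (rule path_inf_lower[where w = "\<lambda>_. 1"])
    fix l :: real and \<gamma> :: "real \<Rightarrow> 'a" assume "0 \<le> l" "lip1 \<gamma>" "\<gamma> 0 = x" "\<gamma> l \<in> - W"
    moreover have "x \<in> W" using that Z(3) W(2) by blast
    ultimately have "curve_integral (l, \<gamma>) \<rho> = \<infinity>" using that by (intro E) auto
    then show "ennreal 1 \<le> ennreal 0 + curve_integral (l, \<gamma>) \<rho>" by simp
  qed simp
  have "capacity p (completion N) {x. 1 / 2 < h x} \<le> ennreal B * emeasure \<nu> (- (- W))"
    unfolding B_def
  proof (rule capacity_superlevel_le)
    show "h x = 0" if "x \<in> - W" for x
      using path_inf_on[OF that, of "\<lambda>_. 0" \<rho>] path_inf_nonneg[of "- W" "\<lambda>_. 0" \<rho> x] by (simp add: h_def)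
    show "h \<in> borel_measurable borel"
      using open_h by (intro borel_measurable_iff_greater[THEN iffD2]) auto
    show "ennreal \<bar>h (\<gamma> 0) - h (\<gamma> l)\<bar> \<le> curve_integral (l, \<gamma>) (\<lambda>x. ennreal 1 * \<rho> x)"
      if "0 \<le> l" "lip1 \<gamma>" for l \<gamma>
      using path_inf_upper_gradient[OF that \<rho>_measurable] by (simp add: h_def)
  qed (use W(1) path_inf_nonneg path_inf_le_1 in \<open>auto simp: h_def\<close>)
  also have "\<dots> < ennreal B * ennreal (\<epsilon> / B)"
    using \<nu>W \<open>0 < B\<close> by (intro ennreal_mult_strict_left_mono) auto
  also have "\<dots> = ennreal \<epsilon>"
    using \<open>0 < B\<close> \<open>0 < \<epsilon>\<close> by (subst ennreal_mult[symmetric]) auto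
  finally show ?thesis
    using h1 open_h[of "1 / 2"] by (intro exI[of _ "{x. 1 / 2 < h x}"]) force
qed

end

section \<open>Functions continuous along curves\<close>

text \<open>The curve \<open>\<beta>\<close> runs from \<open>x\<close> to the end point of \<open>\<gamma> n\<close> and back to \<open>x\<close>, for
  \<open>n = 0, 1, \<dots>\<close> in turn; on the \<open>n\<close>-th loop \<open>d n t\<close> is the parameter on \<open>\<gamma> n\<close>.\<close>

lemma infinite_concat:
  fixes \<gamma> :: "nat \<Rightarrow> real \<Rightarrow> 'a::metric_space"
  assumes \<gamma>: "\<And>n. lip1 (\<gamma> n)" "\<And>n. \<gamma> n 0 = x" and l: "\<And>n. 0 < l n"
    and \<rho>[measurable]: "\<rho> \<in> borel_measurable borel" and \<rho>1: "\<And>x. 1 \<le> \<rho> x"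
    and small: "\<And>n. curve_integral (l n, \<gamma> n) \<rho> \<le> ennreal ((1 / 2) ^ n)"
  obtains T \<beta> where "0 \<le> T" "lip1 \<beta>" "\<beta> T = x" "curve_integral (T, \<beta>) \<rho> < \<infinity>"
    "\<And>\<delta>. 0 < \<delta> \<Longrightarrow> \<exists>n t. 0 \<le> t \<and> t \<le> T \<and> T - t < \<delta> \<and> \<beta> t = \<gamma> n (l n)"
proof -
  have l_le: "l n \<le> (1 / 2) ^ n" for n
  proof -
    have "ennreal (l n) \<le> curve_integral (l n, \<gamma> n) \<rho>"
      using l[of n] by (intro length_le_curve_integral \<rho>1) auto
    also note small
    finally show ?thesis by (subst (asm) ennreal_le_iff) auto
  qed
  have summ: "summable (\<lambda>n. 2 * l n)"
  proof (rule summable_comparison_test')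
    show "summable (\<lambda>n. 2 * (1 / 2 :: real) ^ n)" by (intro summable_mult summable_geometric) simp
    show "norm (2 * l n) \<le> 2 * (1 / 2) ^ n" for n using l_le[of n] l[of n] by simp
  qed
  define \<theta> where "\<theta> n = (\<Sum>i<n. 2 * l i)" for n
  define T where "T = (\<Sum>n. 2 * l n)"
  have \<theta>_lim: "\<theta> \<longlonglongrightarrow> T" unfolding \<theta>_def T_def using summ by (rule summable_LIMSEQ)
  have \<theta>_Suc: "\<theta> (Suc n) = \<theta> n + 2 * l n" for n by (simp add: \<theta>_def)
  have \<theta>_mono: "\<theta> m \<le> \<theta> n" if "m \<le> n" for m n
    unfolding \<theta>_def using that l by (intro sum_mono2) (auto intro: less_imp_le)
  have \<theta>0: "\<theta> 0 = 0" by (simp add: \<theta>_def)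
  have \<theta>_le_T: "\<theta> n \<le> T" for n
    using \<theta>_lim \<theta>_mono by (intro incseq_le) (auto simp: incseq_def)
  have "0 \<le> T" using \<theta>_le_T[of 0] \<theta>0 by simp
  \<comment> \<open>A tent of height \<open>l n\<close> over the \<open>n\<close>-th time interval,
    which has length \<open>2 * l n\<close>: up to the tip \<open>\<gamma> n\<close> is run
    outwards, afterwards back.\<close>
  define d where "d n t = max 0 (min (t - \<theta> n) (\<theta> (Suc n) - t))" for n t
  have d_nonneg: "0 \<le> d n t" for n t by (simp add: d_def)
  have d_lip: "\<bar>d n s - d n t\<bar> \<le> \<bar>s - t\<bar>" for n s t by (auto simp: d_def)
  have d_pos: "0 < d n t \<longleftrightarrow> \<theta> n < t \<and> t < \<theta> (Suc n)" for n t by (auto simp: d_def)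
  have unique: "m = n" if "0 < d m t" "0 < d n t" for m n t
    using that \<theta>_mono[of "Suc m" n] \<theta>_mono[of "Suc n" m] unfolding d_pos
    by (cases m n rule: linorder_cases) auto
  define \<beta> where "\<beta> t = (if \<exists>n. 0 < d n t then \<gamma> (THE n. 0 < d n t) (d (THE n. 0 < d n t) t) else x)" for t
  have \<beta>_eq: "\<beta> t = \<gamma> n (d n t)" if "0 < d n t" for n t
  proof -
    have "(THE n. 0 < d n t) = n" using that unique by (intro the_equality) auto
    then show ?thesis using that by (auto simp: \<beta>_def)
  qed
  have \<beta>_x: "\<beta> t = x" if "\<And>n. d n t = 0" for t using that by (simp add: \<beta>_def)
  have near: "dist (\<beta> t) x \<le> d n t" if "0 < d n t" for n t
    using \<beta>_eq[OF that] lip1D[OF \<gamma>(1)[of n], of "d n t" 0] \<gamma>(2)[of n] d_nonneg[of n t] by simp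
  have "lip1 \<beta>"
  proof (rule lip1I)
    fix s t :: real assume "s \<le> t"
    have case_s: "dist (\<beta> s) x \<le> t - s" if "0 < d m s" "\<theta> (Suc m) \<le> t" for m
      using near[OF that(1)] that(1)[unfolded d_pos] that(2) by (simp add: d_def)
    have case_t: "dist (\<beta> t) x \<le> t - s" if "0 < d n t" "s \<le> \<theta> n" for n
      using near[OF that(1)] that(1)[unfolded d_pos] that(2) by (simp add: d_def)
    consider m n where "0 < d m s" "0 < d n t" | m where "0 < d m s" "\<And>n. d n t = 0"
      | n where "\<And>m. d m s = 0" "0 < d n t" | "\<And>m. d m s = 0" "\<And>n. d n t = 0"
      using d_nonneg by (metis less_eq_real_def)
    then show "dist (\<beta> s) (\<beta> t) \<le> t - s"
    proof cases
      case (1 m n)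
      show ?thesis
      proof (cases "m = n")
        case True
        then show ?thesis
          using \<beta>_eq[OF 1(1)] \<beta>_eq[OF 1(2)] lip1D[OF \<gamma>(1)[of n], of "d n s" "d n t"] d_lip[of n s t] \<open>s \<le> t\<close>
          by simp
      next
        case False
        have "\<not> n < m" using 1 \<theta>_mono[of "Suc n" m] \<open>s \<le> t\<close> by (auto simp: d_pos)
        then have "Suc m \<le> n" using False by simp
        then have "\<theta> (Suc m) \<le> \<theta> n" by (rule \<theta>_mono)
        moreover have "dist (\<beta> s) x \<le> \<theta> (Suc m) - s" "dist (\<beta> t) x \<le> t - \<theta> n"
          using near[OF 1(1)] near[OF 1(2)] 1 by (auto simp: d_def d_pos)
        ultimately show ?thesis using dist_triangle[of "\<beta> s" "\<beta> t" x] by (simp add: dist_commute)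
      qed
    next
      case (2 m)
      have "\<theta> (Suc m) \<le> t" using 2(1) 2(2)[of m] \<open>s \<le> t\<close> d_pos[of m t] by (auto simp: d_pos)
      then show ?thesis using case_s[OF 2(1)] \<beta>_x[OF 2(2)] by simp
    next
      case (3 n)
      have "s \<le> \<theta> n" using 3(2) 3(1)[of n] \<open>s \<le> t\<close> d_pos[of n s] by (auto simp: d_pos)
      then show ?thesis using case_t[OF 3(2)] \<beta>_x[OF 3(1)] by (simp add: dist_commute)
    next
      case 4
      then show ?thesis using \<beta>_x \<open>s \<le> t\<close> by simp
    qed
  qed
  moreover have "\<beta> T = x" 
  proof (rule \<beta>_x)
    show "d n T = 0" for n using d_pos[of n T] d_nonneg[of n T] \<theta>_le_T[of "Suc n"] by auto
  qed
  moreover have "curve_integral (T, \<beta>) \<rho> < \<infinity>"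
  proof -
    have [measurable]: "\<gamma> n \<in> borel_measurable borel" for n using \<gamma>(1) by (rule lip1_measurable)
    have [measurable]: "{0..l n} \<in> sets borel" for n by simp
    define Q where "Q n t = \<rho> (\<gamma> n t) * indicator {0..l n} t" for n t
    have Q[measurable]: "Q n \<in> borel_measurable borel" for n unfolding Q_def by measurable
    have Q_int: "(\<integral>\<^sup>+t. Q n t \<partial>lborel) \<le> ennreal ((1 / 2) ^ n)" for n
      using small[of n] by (simp add: Q_def curve_integral_def)
    \<comment> \<open>The two summands are the way out and the way back; the form
      \<open>- \<theta> n + 1 * t\<close> matches the affine substitution rule applied
      afterwards.\<close>
    have "curve_integral (T, \<beta>) \<rho> \<le> (\<integral>\<^sup>+t. (\<Sum>n. Q n (- \<theta> n + 1 * t) + Q n (\<theta> (Suc n) + (-1) * t)) \<partial>lborel)"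
      unfolding curve_integral_def prod.case
    proof (rule nn_integral_mono_AE)
      have "AE t in lborel. t \<notin> insert T (range \<theta>)"
        by (rule AE_not_in) (intro countable_imp_null_set_lborel, simp)
      then show "AE t in lborel. \<rho> (\<beta> t) * indicator {0..T} t
          \<le> (\<Sum>n. Q n (- \<theta> n + 1 * t) + Q n (\<theta> (Suc n) + (-1) * t))"
      proof eventually_elim
        case (elim t)
        show ?case
        proof (cases "t \<in> {0..T}")
          case True
          then have "t < T" using elim by auto
          then have "\<forall>\<^sub>F n in sequentially. t < \<theta> n" using order_tendstoD(1)[OF \<theta>_lim] by blast
          then obtain n0 where "t < \<theta> n0" by (auto simp: eventually_sequentially)
          define n where "n = (LEAST n. t < \<theta> (Suc n))"
          have ex: "t < \<theta> (Suc n0)" using \<open>t < \<theta> n0\<close> \<theta>_mono[of n0 "Suc n0"] by simp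
          have n1: "t < \<theta> (Suc n)" unfolding n_def by (rule LeastI, rule ex)
          have n2: "\<theta> n \<le> t"
          proof (cases n)
            case 0
            then show ?thesis using True \<theta>0 by simp
          next
            case (Suc k)
            then have "\<not> t < \<theta> (Suc k)" unfolding n_def by (intro not_less_Least) simp
            then show ?thesis using Suc by simp
          qed
          have dn: "0 < d n t" unfolding d_pos using n1 n2 elim by (auto simp: less_le)
          have "\<rho> (\<beta> t) \<le> Q n (- \<theta> n + 1 * t) + Q n (\<theta> (Suc n) + (-1) * t)"
          proof (cases "t - \<theta> n \<le> \<theta> (Suc n) - t")
            case True
            then have "d n t = - \<theta> n + 1 * t" "- \<theta> n + 1 * t \<in> {0..l n}"
              using n2 \<theta>_Suc[of n] by (auto simp: d_def)
            then show ?thesis using \<beta>_eq[OF dn] by (simp add: Q_def)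
          next
            case False
            then have "d n t = \<theta> (Suc n) + (-1) * t" "\<theta> (Suc n) + (-1) * t \<in> {0..l n}"
              using n1 \<theta>_Suc[of n] by (auto simp: d_def)
            then show ?thesis using \<beta>_eq[OF dn] by (simp add: Q_def)
          qed
          also have "\<dots> \<le> (\<Sum>n. Q n (- \<theta> n + 1 * t) + Q n (\<theta> (Suc n) + (-1) * t))"
            using sum_le_suminf[of "\<lambda>n. Q n (- \<theta> n + 1 * t) + Q n (\<theta> (Suc n) + (-1) * t)" "{n}"]
            by (simp add: summableI)
          finally show ?thesis using True by simp
        qed simp
      qed
    qed
    also have "\<dots> = (\<Sum>n. \<integral>\<^sup>+t. Q n (- \<theta> n + 1 * t) + Q n (\<theta> (Suc n) + (-1) * t) \<partial>lborel)"
      by (rule nn_integral_suminf) measurable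
    also have "\<dots> = (\<Sum>n. (\<integral>\<^sup>+t. Q n (- \<theta> n + 1 * t) \<partial>lborel) + (\<integral>\<^sup>+t. Q n (\<theta> (Suc n) + (-1) * t) \<partial>lborel))"
      by (subst nn_integral_add) auto
    also have "\<dots> = (\<Sum>n. (\<integral>\<^sup>+t. Q n t \<partial>lborel) + (\<integral>\<^sup>+t. Q n t \<partial>lborel))"
    proof -
      have "(\<integral>\<^sup>+t. Q n (- \<theta> n + 1 * t) \<partial>lborel) = (\<integral>\<^sup>+t. Q n t \<partial>lborel)" for n
        using nn_integral_real_affine[OF Q, of 1 n "- \<theta> n"] by simp
      moreover have "(\<integral>\<^sup>+t. Q n (\<theta> (Suc n) + (-1) * t) \<partial>lborel) = (\<integral>\<^sup>+t. Q n t \<partial>lborel)" for n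
        using nn_integral_real_affine[OF Q, of "-1" n "\<theta> (Suc n)"] by simp
      ultimately show ?thesis by simp
    qed
    also have "\<dots> \<le> (\<Sum>n. ennreal (2 * (1 / 2) ^ n))"
    proof (intro suminf_le summableI)
      fix n
      have "(\<integral>\<^sup>+t. Q n t \<partial>lborel) + (\<integral>\<^sup>+t. Q n t \<partial>lborel) \<le> ennreal ((1 / 2) ^ n) + ennreal ((1 / 2) ^ n)"
        by (intro add_mono Q_int)
      also have "\<dots> = ennreal (2 * (1 / 2) ^ n)" by (subst ennreal_plus[symmetric]) auto
      finally show "(\<integral>\<^sup>+t. Q n t \<partial>lborel) + (\<integral>\<^sup>+t. Q n t \<partial>lborel) \<le> ennreal (2 * (1 / 2) ^ n)" .
    qed
    also have "\<dots> = ennreal (2 * (1 / (1 - 1 / 2)))"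
      by (intro suminf_ennreal_eq sums_mult geometric_sums) auto
    also have "\<dots> < \<infinity>" by simp
    finally show ?thesis .
  qed
  moreover have "\<exists>n t. 0 \<le> t \<and> t \<le> T \<and> T - t < \<delta> \<and> \<beta> t = \<gamma> n (l n)" if "0 < \<delta>" for \<delta>
  proof -
    have "\<forall>\<^sub>F n in sequentially. T - \<delta> < \<theta> n" using order_tendstoD(1)[OF \<theta>_lim] that by simp
    then obtain n where n: "T - \<delta> < \<theta> n" by (auto simp: eventually_sequentially)
    have "d n (\<theta> n + l n) = l n" using l[of n] \<theta>_Suc[of n] by (simp add: d_def)
    then have "\<beta> (\<theta> n + l n) = \<gamma> n (l n)" using \<beta>_eq[of n "\<theta> n + l n"] l[of n] by simp
    moreover have "\<theta> n + l n \<le> T" using \<theta>_le_T[of "Suc n"] \<theta>_Suc[of n] l[of n] by simp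
    moreover have "0 \<le> \<theta> n + l n" using \<theta>_mono[of 0 n] \<theta>0 l[of n] by simp
    ultimately show ?thesis using n l[of n] by (intro exI[of _ n] exI[of _ "\<theta> n + l n"]) auto
  qed
  ultimately show ?thesis using that[OF \<open>0 \<le> T\<close>] by blast
qed

text \<open>Continuity from above of the measure with density \<open>\<rho>\<close> along
  \<open>\<gamma>\<close>, for intervals shrinking to one point.\<close>

lemma curve_integral_initial_small:
  assumes \<gamma>: "lip1 \<gamma>" and \<rho>[measurable]: "\<rho> \<in> borel_measurable borel"
    and fin: "curve_integral (l, \<gamma>) \<rho> < \<infinity>" and "0 < l" "0 < (e::real)"
  obtains \<delta> where "0 < \<delta>" "\<And>t. t < \<delta> \<Longrightarrow> curve_integral (t, \<gamma>) \<rho> < ennreal e"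
proof -
  have [measurable]: "\<gamma> \<in> borel_measurable borel" using \<gamma> by (rule lip1_measurable)
  define \<mu> where "\<mu> = density lborel (\<lambda>t. \<rho> (\<gamma> t))"
  have \<mu>: "emeasure \<mu> {0..t} = curve_integral (t, \<gamma>) \<rho>" for t
    by (simp add: \<mu>_def emeasure_density curve_integral_def)
  define s where "s n = l / real (Suc n)" for n
  have s: "s n \<le> l" "0 < s n" for n using \<open>0 < l\<close> by (auto simp: s_def field_simps)
  have s_mono: "s n \<le> s m" if "m \<le> n" for m n
    using \<open>0 < l\<close> that by (auto simp: s_def intro!: divide_left_mono)
  have "(\<lambda>n. emeasure \<mu> {0..s n}) \<longlonglongrightarrow> emeasure \<mu> (\<Inter>n. {0..s n})"
  proof (rule Lim_emeasure_decseq)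
    show "range (\<lambda>n. {0..s n}) \<subseteq> sets \<mu>" by (auto simp: \<mu>_def)
    show "decseq (\<lambda>n. {0..s n})" unfolding decseq_def using s_mono by (auto intro: order_trans)
    have "emeasure \<mu> {0..s n} \<le> emeasure \<mu> {0..l}" for n
      using s(1)[of n] by (intro emeasure_mono) (auto simp: \<mu>_def)
    then show "emeasure \<mu> {0..s n} \<noteq> \<infinity>" for n using fin unfolding \<mu> by (metis infinity_ennreal_def leD)
  qed
  moreover have "(\<Inter>n. {0..s n}) = {0}"
  proof -
    have "t \<le> 0" if "\<And>n. t \<le> s n" for t
    proof -
      have "s \<longlonglongrightarrow> 0" unfolding s_def using LIMSEQ_Suc[OF lim_const_over_n[of l]] by simp
      then show ?thesis by (rule LIMSEQ_le_const) (use that in auto)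
    qed
    then show ?thesis using s(2) by (auto simp: less_imp_le intro: antisym)
  qed
  moreover have "emeasure \<mu> {0} = 0"
    unfolding \<mu>_def by (subst emeasure_density) (auto simp: nn_integral_cmult_indicator)
  ultimately have "(\<lambda>n. emeasure \<mu> {0..s n}) \<longlonglongrightarrow> 0" by simp
  then have "\<forall>\<^sub>F n in sequentially. emeasure \<mu> {0..s n} < ennreal e"
    using \<open>0 < e\<close> by (intro order_tendstoD(2)) auto
  then obtain n where n: "emeasure \<mu> {0..s n} < ennreal e" by (auto simp: eventually_sequentially)
  show ?thesis
  proof (rule that[OF s(2)[of n]])
    fix t assume "t < s n"
    then have "emeasure \<mu> {0..t} \<le> emeasure \<mu> {0..s n}" by (intro emeasure_mono) (auto simp: \<mu>_def)
    then show "curve_integral (t, \<gamma>) \<rho> < ennreal e" using n unfolding \<mu> by simp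
  qed
qed

lemma cINF_abs_diff_le:
  fixes a b :: "nat \<Rightarrow> real"
  assumes "\<And>j. 0 \<le> a j" "\<And>j. 0 \<le> b j" "\<And>j. ennreal \<bar>a j - b j\<bar> \<le> D"
  shows "ennreal \<bar>(INF j. a j) - (INF j. b j)\<bar> \<le> D"
proof (cases D)
  case (real r)
  have *: "(INF j. a j) \<le> (INF j. b j) + r" if "\<And>j. 0 \<le> a j" "\<And>j. \<bar>a j - b j\<bar> \<le> r" for a b :: "nat \<Rightarrow> real"
  proof -
    have "(INF j. a j) - r \<le> b j" for j
    proof -
      have "(INF j. a j) \<le> a j" using that(1) by (intro cINF_lower bdd_belowI2[of _ 0]) auto
      then show ?thesis using that(2)[of j] by linarith
    qed
    then have "(INF j. a j) - r \<le> (INF j. b j)" by (intro cINF_greatest) auto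
    then show ?thesis by simp
  qed
  have ab: "\<bar>a j - b j\<bar> \<le> r" for j using assms(3)[of j] real by simp
  then have ba: "\<bar>b j - a j\<bar> \<le> r" for j by (simp add: abs_minus_commute)
  have "\<bar>(INF j. a j) - (INF j. b j)\<bar> \<le> r"
    using *[of a b, OF assms(1) ab] *[of b a, OF assms(2) ba] by linarith
  then show ?thesis using real by (simp add: ennreal_leI)
qed simp

context lsc_weight
begin

text \<open>The infimal convolutions \<open>g k\<close> of \<open>f\<close> with the path metric of \<open>2 ^ k * \<rho>\<close>, restricted to
  the sets \<open>K j\<close> to make them measurable, increase to \<open>f\<close> on \<open>U\<close> outside a small set: if they
  stayed below \<open>f x - e\<close>, then loops at \<open>x\<close> could be concatenated to a curve along which \<open>f\<close> is
  discontinuous.\<close>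

lemma path_continuous_imp_lower_quasicontinuous:
  fixes f :: "'a \<Rightarrow> real"
  assumes f: "\<And>x. 0 \<le> f x" "\<And>x. f x \<le> 1"
    and cont: "\<And>l \<gamma> t0 e. 0 \<le> l \<Longrightarrow> lip1 \<gamma> \<Longrightarrow> curve_integral (l, \<gamma>) \<rho> < \<infinity> \<Longrightarrow> t0 \<in> {0..l} \<Longrightarrow>
      \<gamma> t0 \<in> U \<Longrightarrow> 0 < e \<Longrightarrow>
      \<exists>\<delta>>0. \<forall>t\<in>{0..l}. \<bar>t - t0\<bar> < \<delta> \<longrightarrow> \<gamma> t \<in> U \<and> \<bar>f (\<gamma> t) - f (\<gamma> t0)\<bar> < e"
    and K: "\<And>j::nat. closed (K j)" "\<And>j. continuous_on (K j) (\<lambda>x. if x \<in> U then f x else 0)"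
    and Z: "emeasure N (- (\<Union>j. K j)) = 0" "\<And>x. x \<notin> (\<Union>j. K j) \<Longrightarrow> \<rho> x = \<infinity>"
    and "0 < \<epsilon>"
  shows "\<exists>G. open G \<and> capacity p (completion N) G < ennreal \<epsilon> \<and>
    (\<forall>a. \<exists>V. open V \<and> {x \<in> U. a < f x} - G = V \<inter> U - G)"
proof -
  \<comment> \<open>Extension by the least possible value, as competing curves may end outside
    \<open>U\<close>. Such ends only lower the infima, and they are excluded later because curves of
    finite weight through \<open>x\<close> stay in \<open>U\<close> near \<open>x\<close>.\<close>
  define f0 where "f0 x = (if x \<in> U then f x else 0)" for x
  have f0: "0 \<le> f0 x" for x using f by (simp add: f0_def)
  have f0K: "continuous_on (K j) f0" for j using K(2) by (simp add: f0_def[abs_def])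
  define \<sigma> where "\<sigma> k x = ennreal (2 ^ k) * \<rho> x" for k :: nat and x
  have \<sigma>: "lsc (\<sigma> k)" for k unfolding \<sigma>_def by (intro lsc_cmult \<rho>(1)) simp
  have \<sigma>1: "1 \<le> \<sigma> k x" for k x
    using mult_mono[of 1 "ennreal (2 ^ k)" 1 "\<rho> x"] \<rho>(2)[of x] by (simp add: \<sigma>_def)
  have \<sigma>_meas: "\<sigma> k \<in> borel_measurable borel" for k using \<sigma> by (rule lsc_measurable)
  have \<sigma>_int: "curve_integral (l, \<gamma>) (\<sigma> k) = ennreal (2 ^ k) * curve_integral (l, \<gamma>) \<rho>" if "lip1 \<gamma>" for k l \<gamma>
    unfolding \<sigma>_def by (rule curve_integral_cmult[OF that \<rho>_measurable])
  define F where "F k j = path_inf (K j) f0 (\<sigma> k)" for k j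
  define g where "g k x = (INF j. F k j x)" for k x
  have F0: "0 \<le> F k j x" and F1: "F k j x \<le> 1" for k j x
    by (simp_all add: F_def path_inf_nonneg path_inf_le_1)
  have g_le_F: "g k x \<le> F k j x" for k j x
    unfolding g_def by (intro cINF_lower bdd_belowI2[of _ 0] F0) simp
  have F_meas: "F k j \<in> borel_measurable borel" for k j
    unfolding F_def using open_path_inf[OF proper \<sigma> \<sigma>1 K(1) f0K f0]
    by (intro borel_measurable_iff_greater[THEN iffD2]) auto
  have g_meas: "g k \<in> borel_measurable borel" for k
    unfolding g_def using F_meas by (intro borel_measurable_cINF bdd_belowI2[of _ 0] F0) auto
  have g0: "0 \<le> g k x" for k x unfolding g_def by (intro cINF_greatest F0) simp
  have g1: "g k x \<le> 1" for k x using g_le_F[of k x 0] F1[of k 0 x] by simp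
  have g_ug: "ennreal \<bar>g k (\<gamma> 0) - g k (\<gamma> l)\<bar> \<le> curve_integral (l, \<gamma>) (\<sigma> k)" if "0 \<le> l" "lip1 \<gamma>" for k l \<gamma>
    unfolding g_def by (intro cINF_abs_diff_le F0) (auto simp: F_def intro: path_inf_upper_gradient that \<sigma>_meas)
  have "\<exists>G. open G \<and> capacity p (completion N) G < ennreal (\<epsilon> / 2 * (1 / 2) ^ k / 4) \<and>
    (\<forall>a. \<exists>V. open V \<and> {x. a < g k x} - G = V - G)" for k
  proof (rule lower_quasicontinuous[OF g_meas g0 g1, where c = "2 ^ k"])
    show "ennreal \<bar>g k (\<gamma> 0) - g k (\<gamma> l)\<bar> \<le> curve_integral (l, \<gamma>) (\<lambda>x. ennreal (2 ^ k) * \<rho> x)"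
      if "0 \<le> l" "lip1 \<gamma>" for l \<gamma>
      using g_ug[OF that] by (simp add: \<sigma>_def[abs_def])
  qed (use \<open>0 < \<epsilon>\<close> in auto)
  then obtain G where G: "\<And>k. open (G k)" "\<And>k. capacity p (completion N) (G k) < ennreal (\<epsilon> / 2 * (1 / 2) ^ k / 4)"
      "\<And>k a. \<exists>V. open V \<and> {x. a < g k x} - G k = V - G k" by metis
  \<comment> \<open>A point at which some \<open>g k\<close> exceeds \<open>f\<close> is in no
    \<open>K j\<close>, so \<open>E\<close> lies in a null set. It remains to see that curves
    leaving \<open>E\<close> have infinite weight.\<close>
  define E where "E = {x \<in> U. \<exists>k. f x < g k x}"
  have on_K: "g k y \<le> f y" if "y \<in> U" "y \<in> K j" for k j y
  proof -
    have "F k j y \<le> f0 y" unfolding F_def by (rule path_inf_on[OF that(2) f0])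
    then show ?thesis using g_le_F[of k y j] that(1) by (simp add: f0_def)
  qed
  have "\<exists>G. open G \<and> E \<subseteq> G \<and> capacity p (completion N) G < ennreal (\<epsilon> / 2 * (1 / 2) ^ 0 / 4)"
  proof (rule ex_open_small_capacity)
    show "- (\<Union>j. K j) \<in> sets borel" using K(1) by auto
    show "emeasure N (- (\<Union>j. K j)) = 0" by (rule Z(1))
    show "E \<subseteq> - (\<Union>j. K j)" 
    proof
      fix x assume "x \<in> E"
      then obtain k where "x \<in> U" "f x < g k x" by (auto simp: E_def)
      then show "x \<in> - (\<Union>j. K j)" using on_K[of x _ k] by (auto simp: not_less[symmetric])
    qed
    show "0 < \<epsilon> / 2 * (1 / 2) ^ 0 / 4" using \<open>0 < \<epsilon>\<close> by simp
    fix l :: real and \<gamma> :: "real \<Rightarrow> 'a"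
    assume l: "0 \<le> l" and \<gamma>: "lip1 \<gamma>" and E: "\<gamma> 0 \<in> E" and "\<gamma> l \<noteq> \<gamma> 0"
    then have "0 < l" by (cases "l = 0") auto
    show "curve_integral (l, \<gamma>) \<rho> = \<infinity>"
    proof (rule ccontr)
      assume "curve_integral (l, \<gamma>) \<rho> \<noteq> \<infinity>"
      then have fin: "curve_integral (l, \<gamma>) \<rho> < \<infinity>" by (simp add: less_top)
      have U: "\<gamma> 0 \<in> U" using E by (simp add: E_def)
      obtain k where k: "f (\<gamma> 0) < g k (\<gamma> 0)" using E by (auto simp: E_def)
      define e where "e = (g k (\<gamma> 0) - f (\<gamma> 0)) / 2"
      have "0 < e" using k by (simp add: e_def)
      obtain \<delta>1 where \<delta>1: "0 < \<delta>1" "\<And>t. t \<in> {0..l} \<Longrightarrow> \<bar>t\<bar> < \<delta>1 \<Longrightarrow> \<gamma> t \<in> U \<and> \<bar>f (\<gamma> t) - f (\<gamma> 0)\<bar> < e"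
        using cont[OF l \<gamma> fin _ U \<open>0 < e\<close>] l by auto
      have fin': "curve_integral (l, \<gamma>) (\<sigma> k) < \<infinity>"
        using fin by (simp add: \<sigma>_int[OF \<gamma>] ennreal_mult_less_top)
      obtain \<delta>2 where \<delta>2: "0 < \<delta>2" "\<And>t. t < \<delta>2 \<Longrightarrow> curve_integral (t, \<gamma>) (\<sigma> k) < ennreal e"
        by (rule curve_integral_initial_small[OF \<gamma> \<sigma>_meas fin' \<open>0 < l\<close> \<open>0 < e\<close>]) (rule that)
      define m where "m = min l (min \<delta>1 \<delta>2)"
      have "0 < m" using \<open>0 < l\<close> \<delta>1 \<delta>2 by (simp add: m_def)
      \<comment> \<open>As \<open>\<rho>\<close> is infinite off the \<open>K j\<close>, a curve of
        finite weight meets some \<open>K j\<close> at arbitrarily small times, where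
        \<open>g k \<le> f\<close>. Both functions change by less than \<open>e\<close> up to then,
        against a gap of \<open>2 * e\<close> at the start.\<close>
      have "\<exists>t. 0 < t \<and> t < m \<and> \<rho> (\<gamma> t) \<noteq> \<infinity>"
      proof (rule ccontr)
        assume "\<not> ?thesis"
        then have inf: "\<rho> (\<gamma> t) = \<infinity>" if "t \<in> {0<..<m}" for t using that by auto
        have "(\<infinity>::ennreal) = \<infinity> * ennreal m" using \<open>0 < m\<close> by (simp add: ennreal_top_mult)
        also have "\<dots> = \<infinity> * emeasure lborel {0<..<m}" using \<open>0 < m\<close> by simp
        also have "\<dots> = (\<integral>\<^sup>+t. \<infinity> * indicator {0<..<m} t \<partial>lborel)" by (rule nn_integral_cmult_indicator[symmetric]) simp
        also have "\<dots> \<le> curve_integral (l, \<gamma>) \<rho>"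
          unfolding curve_integral_def prod.case
          using inf by (intro nn_integral_mono) (auto simp: m_def split: split_indicator)
        finally show False using fin by simp
      qed
      then obtain t where t: "0 < t" "t < m" "\<rho> (\<gamma> t) \<noteq> \<infinity>" by blast
      then obtain j where j: "\<gamma> t \<in> K j" using Z(2) by blast
      have tl: "t \<in> {0..l}" "\<bar>t\<bar> < \<delta>1" "t < \<delta>2" using t by (auto simp: m_def)
      have "g k (\<gamma> t) \<le> f (\<gamma> t)" using \<delta>1(2)[OF tl(1,2)] j by (intro on_K) auto
      moreover have "f (\<gamma> t) < f (\<gamma> 0) + e" using \<delta>1(2)[OF tl(1,2)] by linarith
      moreover have "g k (\<gamma> 0) - g k (\<gamma> t) < e"
      proof -
        have "ennreal \<bar>g k (\<gamma> 0) - g k (\<gamma> t)\<bar> < ennreal e"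
          using g_ug[of t \<gamma> k] \<gamma> tl \<delta>2(2)[OF tl(3)] by (auto intro: le_less_trans)
        then have "\<bar>g k (\<gamma> 0) - g k (\<gamma> t)\<bar> < e" by (subst (asm) ennreal_less_iff) auto
        then show ?thesis by simp
      qed
      ultimately have "g k (\<gamma> 0) < f (\<gamma> 0) + 2 * e" by linarith
      then show False by (simp add: e_def field_simps)
    qed
  qed
  then obtain G' where G': "open G'" "E \<subseteq> G'" "capacity p (completion N) G' < ennreal (\<epsilon> / 2 * (1 / 2) ^ 0 / 4)"
    by blast
  have approx: "\<exists>k. f x - e < g k x" if x: "x \<in> U" and "0 < e" for x e
  proof (rule ccontr)
    assume "\<not> ?thesis"
    then have no: "g k x \<le> f x - e" for k by (simp add: not_less)
    \<comment> \<open>Midway between \<open>f x - e\<close> and \<open>f x\<close>: the competitors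
      end below \<open>b\<close>, while continuity along the concatenated loops will force values
      above it.\<close>
    define b where "b = f x - e / 2"
    have b1: "b \<le> 1" using f(2)[of x] \<open>0 < e\<close> by (simp add: b_def)
    have "\<exists>l \<gamma>. 0 < l \<and> lip1 \<gamma> \<and> \<gamma> 0 = x \<and> f0 (\<gamma> l) < b \<and> curve_integral (l, \<gamma>) \<rho> \<le> ennreal ((1 / 2) ^ k)" for k
    proof -
      have "g k x < b" using no[of k] \<open>0 < e\<close> by (simp add: b_def)
      then obtain j where "F k j x < b"
        unfolding g_def by (subst (asm) cINF_less_iff) (auto intro!: bdd_belowI2[of _ 0] F0)
      then obtain l \<gamma> where c: "0 \<le> l" "lip1 \<gamma>" "\<gamma> 0 = x"
          "ennreal (f0 (\<gamma> l)) + curve_integral (l, \<gamma>) (\<sigma> k) < ennreal b"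
        unfolding F_def using path_inf_less[OF _ b1] by metis
      have "ennreal (f0 (\<gamma> l)) < ennreal b" by (rule le_less_trans[OF _ c(4)]) simp
      then have f0b: "f0 (\<gamma> l) < b" using f0 by (simp add: ennreal_less_iff)
      \<comment> \<open>A curve of length 0 would end at \<open>x\<close>, where \<open>f0\<close>
        exceeds \<open>b\<close>.\<close>
      then have "l \<noteq> 0" using c(3) x \<open>0 < e\<close> by (auto simp: f0_def b_def)
      \<comment> \<open>The total cost stays below the cap 1, so division by \<open>2 ^ k\<close>
        gives the geometric decay that makes the loops concatenable.\<close>
      have "ennreal (2 ^ k) * curve_integral (l, \<gamma>) \<rho> \<le> ennreal (f0 (\<gamma> l)) + curve_integral (l, \<gamma>) (\<sigma> k)"
        by (simp add: \<sigma>_int[OF c(2)])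
      also have "\<dots> \<le> ennreal 1" using c(4) ennreal_leI[OF b1] by (meson less_imp_le order_trans)
      finally have "ennreal ((1 / 2) ^ k) * (ennreal (2 ^ k) * curve_integral (l, \<gamma>) \<rho>) \<le> ennreal ((1 / 2) ^ k) * ennreal 1"
        by (rule mult_left_mono) simp
      also have "ennreal ((1 / 2) ^ k) * (ennreal (2 ^ k) * curve_integral (l, \<gamma>) \<rho>) = curve_integral (l, \<gamma>) \<rho>"
        by (simp add: mult.assoc[symmetric] ennreal_mult[symmetric] power_mult_distrib[symmetric])
      finally show ?thesis using c f0b \<open>l \<noteq> 0\<close> by (intro exI[of _ l] exI[of _ \<gamma>]) auto
    qed
    then obtain l \<gamma> where \<gamma>: "\<And>k. 0 < l k" "\<And>k. lip1 (\<gamma> k)" "\<And>k. \<gamma> k 0 = x" "\<And>k. f0 (\<gamma> k (l k)) < b"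
        "\<And>k. curve_integral (l k, \<gamma> k) \<rho> \<le> ennreal ((1 / 2) ^ k)"
      by metis
    obtain T \<beta> where \<beta>: "0 \<le> T" "lip1 \<beta>" "\<beta> T = x" "curve_integral (T, \<beta>) \<rho> < \<infinity>"
        "\<And>\<delta>. 0 < \<delta> \<Longrightarrow> \<exists>n t. 0 \<le> t \<and> t \<le> T \<and> T - t < \<delta> \<and> \<beta> t = \<gamma> n (l n)"
      by (rule infinite_concat[OF \<gamma>(2,3,1) \<rho>_measurable \<rho>(2) \<gamma>(5)]) (rule that)
    obtain \<delta> where \<delta>: "0 < \<delta>" "\<And>t. t \<in> {0..T} \<Longrightarrow> \<bar>t - T\<bar> < \<delta> \<Longrightarrow> \<beta> t \<in> U \<and> \<bar>f (\<beta> t) - f (\<beta> T)\<bar> < e / 2"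
      using cont[OF \<beta>(1,2,4), of T "e / 2"] \<beta>(1,3) x \<open>0 < e\<close> by auto
    obtain n t where t: "0 \<le> t" "t \<le> T" "T - t < \<delta>" "\<beta> t = \<gamma> n (l n)" using \<beta>(5)[OF \<delta>(1)] by blast
    then have *: "\<gamma> n (l n) \<in> U" "\<bar>f (\<gamma> n (l n)) - f x\<bar> < e / 2"
      using \<delta>(2)[of t] \<beta>(3) by auto
    moreover have "f (\<gamma> n (l n)) < f x - e / 2" using \<gamma>(4)[of n] *(1) by (simp add: f0_def b_def)
    ultimately show False by linarith
  qed
  define H where "H = (\<Union>k. G k) \<union> G'"
  have "open H" unfolding H_def using G(1) G'(1) by auto
  moreover have "capacity p (completion N) H < ennreal \<epsilon>"
  proof -
    have sp: "sets borel \<subseteq> sets (completion N)" "space (completion N) = UNIV"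
      using sets_eq_imp_space_eq[OF sets_N] by auto
    \<comment> \<open>\<open>G'\<close> takes slot 0 of the budget of
      \<open>capacity_Union_less\<close> and \<open>G k\<close> takes slot \<open>Suc k\<close>; the
      extra factor 1/2 in the bound for \<open>G k\<close> accounts for this shift.\<close>
    define A where "A n = (case n of 0 \<Rightarrow> G' | Suc n' \<Rightarrow> G n')" for n
    have "capacity p (completion N) (A n) < ennreal (\<epsilon> * (1 / 2) ^ n / 4)" for n
    proof (cases n)
      case 0
      have "ennreal (\<epsilon> / 2 * (1 / 2) ^ 0 / 4) \<le> ennreal (\<epsilon> * (1 / 2) ^ 0 / 4)"
        using \<open>0 < \<epsilon>\<close> by (intro ennreal_leI) simp
      then show ?thesis using G'(3) 0 by (simp add: A_def)
    next
      case (Suc k)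
      then show ?thesis using G(2)[of k] by (simp add: A_def)
    qed
    from capacity_Union_less[OF p \<open>0 < \<epsilon>\<close> this sp] have "capacity p (completion N) (\<Union>n. A n) < ennreal \<epsilon>" .
    moreover have "H \<subseteq> (\<Union>n. A n)"
    proof -
      have "G k = A (Suc k)" "G' = A 0" for k by (simp_all add: A_def)
      then show ?thesis unfolding H_def by blast
    qed
    ultimately show ?thesis using capacity_mono[of H _ p "completion N"] by (meson le_less_trans)
  qed
  moreover have "\<exists>V. open V \<and> {x \<in> U. a < f x} - H = V \<inter> U - H" for a
  proof -
    obtain V where V: "\<And>k. open (V k)" "\<And>k. {x. a < g k x} - G k = V k - G k" using G(3) by metis
    have "a < f x \<longleftrightarrow> (\<exists>k. x \<in> V k)" if x: "x \<in> U" "x \<notin> H" for x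
    proof -
      have mem: "x \<in> V k \<longleftrightarrow> a < g k x" for k using V(2)[of k] x(2) by (auto simp: H_def)
      have "g k x \<le> f x" for k
      proof -
        have "x \<notin> E" using x(2) G'(2) by (auto simp: H_def)
        then show ?thesis using x(1) by (auto simp: E_def not_less)
      qed
      moreover have "\<exists>k. a < g k x" if "a < f x"
        using approx[OF x(1), of "f x - a"] that by auto
      ultimately show ?thesis unfolding mem by (meson less_le_trans)
    qed
    then have "{x \<in> U. a < f x} - H = (\<Union>k. V k) \<inter> U - H" by blast
    moreover have "open (\<Union>k. V k)" using V(1) by blast
    ultimately show ?thesis by blast
  qed
  ultimately show ?thesis by blast
qed

end

section \<open>The characterization\<close>

lemma capacity_empty: "0 < p \<Longrightarrow> capacity p M {} = 0"
  using capacity_le_test[of p "\<lambda>_. 0" M "{}" "\<lambda>_. 0"] by (simp add: curve_integral_def zero_ennreal_def[symmetric])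

text \<open>Slots 0 and 1 of \<open>capacity_Union_less\<close> allow \<open>\<epsilon> / 4\<close>
  and \<open>\<epsilon> / 8\<close>; the smaller bound is asked of both sets, and the other slots
  are empty.\<close>

lemma capacity_Un_less:
  assumes "0 < p" "0 < \<epsilon>" "capacity p M A < ennreal (\<epsilon> / 8)" "capacity p M B < ennreal (\<epsilon> / 8)"
    and M: "sets borel \<subseteq> sets M" "space M = UNIV"
  shows "capacity p M (A \<union> B) < ennreal \<epsilon>"
proof -
  define E where "E n = (if n = 0 then A else if n = 1 then B else {})" for n :: nat
  have "capacity p M (E n) < ennreal (\<epsilon> * (1 / 2) ^ n / 4)" for n
  proof -
    have "ennreal (\<epsilon> / 8) \<le> ennreal (\<epsilon> * (1 / 2) ^ 0 / 4)" using \<open>0 < \<epsilon>\<close> by (intro ennreal_leI) simp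
    then show ?thesis
      using assms by (auto simp: E_def capacity_empty intro: less_le_trans)
  qed
  from capacity_Union_less[OF \<open>0 < p\<close> \<open>0 < \<epsilon>\<close> this M] have "capacity p M (\<Union>n. E n) < ennreal \<epsilon>" .
  moreover have "A \<union> B \<subseteq> (\<Union>n. E n)"
  proof -
    have "A = E 0" "B = E 1" by (simp_all add: E_def)
    then show ?thesis by blast
  qed
  ultimately show ?thesis by (meson capacity_mono le_less_trans)
qed

lemma Lusin_exhaustion:
  fixes f :: "'a::metric_space \<Rightarrow> real"
  assumes N: "locally_finite N" and f: "f \<in> borel_measurable (completion N)"
  obtains K where "\<And>j::nat. closed (K j)" "\<And>j. continuous_on (K j) f" "emeasure N (- (\<Union>j. K j)) = 0"
proof -
  have sets: "sets N = sets borel" using N by (simp add: locally_finite_def)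
  have "\<exists>K. closed K \<and> continuous_on K f \<and> emeasure N (- K) < ennreal ((1 / 2) ^ j)" for j
    using Lusin_completion[OF N f, of "(1 / 2) ^ j"] by (metis half_gt_zero_iff zero_less_one zero_less_power)
  then obtain K where K: "\<And>j. closed (K j)" "\<And>j. continuous_on (K j) f" "\<And>j. emeasure N (- K j) < ennreal ((1 / 2) ^ j)"
    by metis
  have "emeasure N (- (\<Union>j. K j)) = 0"
  proof (rule ennreal_zeroI)
    fix e :: real assume "0 < e"
    then obtain j where j: "(1 / 2) ^ j < e" using real_arch_pow_inv[of e "1 / 2"] by auto
    have "emeasure N (- (\<Union>j. K j)) \<le> emeasure N (- K j)"
      using K(1) sets by (intro emeasure_mono) auto
    also have "\<dots> < ennreal ((1 / 2) ^ j)" by (rule K(3))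
    also have "\<dots> \<le> ennreal e" using j by (intro ennreal_leI) simp
    finally show "emeasure N (- (\<Union>j. K j)) < ennreal e" .
  qed
  then show ?thesis using that K(1,2) by blast
qed

text \<open>The path functionals use all 1-Lipschitz curves, the hypothesis on \<open>u\<close> only
  arc length curves. Since \<open>\<gamma>\<close> factors through the 1-Lipschitz map
  \<open>s\<close>, the same \<open>\<delta>\<close> works, and the integral of a lower
  semicontinuous weight does not grow. If \<open>S = 0\<close>, the curve is constant.\<close>

lemma lip1_continuity_from_arclength:
  fixes f :: "'a::metric_space \<Rightarrow> real"
  assumes \<rho>: "lsc \<rho>"
    and arc: "\<And>l \<gamma> t0 e. arclength_curve (l, \<gamma>) \<Longrightarrow> curve_integral (l, \<gamma>) \<rho> < \<infinity> \<Longrightarrow> t0 \<in> {0..l} \<Longrightarrow>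
      \<gamma> t0 \<in> U \<Longrightarrow> 0 < e \<Longrightarrow>
      \<exists>\<delta>>0. \<forall>t\<in>{0..l}. \<bar>t - t0\<bar> < \<delta> \<longrightarrow> \<gamma> t \<in> U \<and> \<bar>f (\<gamma> t) - f (\<gamma> t0)\<bar> < e"
    and \<gamma>: "0 \<le> l" "lip1 \<gamma>" "curve_integral (l, \<gamma>) \<rho> < \<infinity>" "t0 \<in> {0..l}" "\<gamma> t0 \<in> U" "0 < e"
  shows "\<exists>\<delta>>0. \<forall>t\<in>{0..l}. \<bar>t - t0\<bar> < \<delta> \<longrightarrow> \<gamma> t \<in> U \<and> \<bar>f (\<gamma> t) - f (\<gamma> t0)\<bar> < e"
proof -
  obtain S \<gamma>' s where S: "0 \<le> S" "s ` {0..l} = {0..S}"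
    and eq: "\<And>t. t \<in> {0..l} \<Longrightarrow> \<gamma> t = \<gamma>' (s t)"
    and lip: "\<And>t t'. t \<in> {0..l} \<Longrightarrow> t' \<in> {0..l} \<Longrightarrow> \<bar>s t - s t'\<bar> \<le> \<bar>t - t'\<bar>"
    and a: "0 < S \<Longrightarrow> arclength_curve (S, \<gamma>')"
    and i: "\<And>\<rho>. 0 < S \<Longrightarrow> lsc \<rho> \<Longrightarrow> curve_integral (S, \<gamma>') \<rho> \<le> (\<integral>\<^sup>+t\<in>{0..l}. \<rho> (\<gamma> t) \<partial>lborel)"
    by (rule lip1_reparam[OF \<gamma>(2,1)]) (rule that)
  have s: "s t \<in> {0..S}" if "t \<in> {0..l}" for t using S(2) that by blast
  show ?thesis
  proof (cases "S = 0")
    case True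
    then have "\<gamma> t = \<gamma> t0" if "t \<in> {0..l}" for t
      using s[OF that] s[OF \<gamma>(4)] eq[OF that] eq[OF \<gamma>(4)] by simp
    then show ?thesis using \<gamma>(5,6) by (intro exI[of _ 1]) auto
  next
    case False
    then have "0 < S" using S(1) by simp
    have "curve_integral (S, \<gamma>') \<rho> < \<infinity>"
      using i[OF \<open>0 < S\<close> \<rho>] \<gamma>(3) by (simp add: curve_integral_def le_less_trans)
    from arc[OF a[OF \<open>0 < S\<close>] this s[OF \<gamma>(4)] _ \<gamma>(6)] \<gamma>(5)
    obtain \<delta> where \<delta>: "\<delta> > 0" "\<And>t. t \<in> {0..S} \<Longrightarrow> \<bar>t - s t0\<bar> < \<delta> \<Longrightarrow> \<gamma>' t \<in> U \<and> \<bar>f (\<gamma>' t) - f (\<gamma>' (s t0))\<bar> < e"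
      unfolding eq[OF \<gamma>(4)] by blast
    have "\<gamma> t \<in> U \<and> \<bar>f (\<gamma> t) - f (\<gamma> t0)\<bar> < e" if "t \<in> {0..l}" "\<bar>t - t0\<bar> < \<delta>" for t
      unfolding eq[OF that(1)] eq[OF \<gamma>(4)]
      using lip[OF that(1) \<gamma>(4)] that by (intro \<delta>(2) s) auto
    then show ?thesis using \<delta>(1) by blast
  qed
qed

text \<open>Continuity is given only for curves lying entirely in \<open>U\<close>; a longer curve
  is treated on the parameter intervals on which it stays in \<open>U\<close>.\<close>

lemma continuous_on_subcurve:
  assumes ex: "\<And>l \<gamma>. arclength_curve (l, \<gamma>) \<Longrightarrow> \<gamma> ` {0..l} \<subseteq> U \<Longrightarrow> curve_integral (l, \<gamma>) \<rho> < \<infinity> \<Longrightarrow>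
      continuous_on {0..l} (u \<circ> \<gamma>)"
    and \<rho>: "\<rho> \<in> borel_measurable borel"
    and \<gamma>: "arclength_curve (l, \<gamma>)" "curve_integral (l, \<gamma>) \<rho> < \<infinity>"
    and ab: "0 \<le> a" "a < b" "b \<le> l" "\<gamma> ` {a..b} \<subseteq> U"
  shows "continuous_on {a..b} (u \<circ> \<gamma>)"
proof -
  have "curve_integral (b - a, \<lambda>t. \<gamma> (a + t)) \<rho> \<le> curve_integral (l, \<gamma>) \<rho>"
    unfolding curve_integral_subcurve[OF \<gamma>(1) \<rho> ab(1-3)] using ab
    by (auto simp: curve_integral_def intro!: nn_integral_mono split: split_indicator)
  then have *: "continuous_on {0..b - a} (u \<circ> (\<lambda>t. \<gamma> (a + t)))"
    using \<gamma>(2) ab by (intro ex arclength_curve_subcurve[OF \<gamma>(1)]) (auto simp: image_subset_iff)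
  have "continuous_on {a..b} ((u \<circ> (\<lambda>t. \<gamma> (a + t))) \<circ> (\<lambda>t. t - a))"
  proof (rule continuous_on_compose)
    show "continuous_on {a..b} (\<lambda>t. t - a)" by (intro continuous_intros)
    show "continuous_on ((\<lambda>t. t - a) ` {a..b}) (u \<circ> (\<lambda>t. \<gamma> (a + t)))"
      by (rule continuous_on_subset[OF *]) auto
  qed
  then show ?thesis by (simp add: o_def)
qed

lemma continuous_on_from_level_sets:
  fixes f :: "'a::topological_space \<Rightarrow> real"
  assumes "\<And>a. \<exists>V. open V \<and> {x \<in> S. a < f x} = V \<inter> S" "\<And>a. \<exists>V. open V \<and> {x \<in> S. f x < a} = V \<inter> S"
  shows "continuous_on S f"
  unfolding continuous_on_def
proof (intro ballI order_tendstoI)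
  fix x a assume x: "x \<in> S" "a < f x"
  obtain V where V: "open V" "{x \<in> S. a < f x} = V \<inter> S" using assms(1) by blast
  then have "\<forall>\<^sub>F y in at x within S. y \<in> V"
    using x by (intro topological_tendstoD[OF tendsto_ident_at]) auto
  moreover have "\<forall>\<^sub>F y in at x within S. y \<in> S" by (simp add: eventually_at_filter)
  ultimately show "\<forall>\<^sub>F y in at x within S. a < f y" by eventually_elim (use V in blast)
next
  fix x a assume x: "x \<in> S" "f x < a"
  obtain V where V: "open V" "{x \<in> S. f x < a} = V \<inter> S" using assms(2) by blast
  then have "\<forall>\<^sub>F y in at x within S. y \<in> V"
    using x by (intro topological_tendstoD[OF tendsto_ident_at]) auto
  moreover have "\<forall>\<^sub>F y in at x within S. y \<in> S" by (simp add: eventually_at_filter)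
  ultimately show "\<forall>\<^sub>F y in at x within S. f y < a" by eventually_elim (use V in blast)
qed

lemma quasicontinuous_onI:
  fixes N M :: "'a::metric_space measure" and u :: "'a \<Rightarrow> ereal"
  assumes p: "0 < p" and N: "locally_finite N" and M: "M = completion N"
    and proper: "\<And>(x::'a) r. compact (cball x r)"
    and qo: "quasiopen p M U"
    and u: "u \<in> borel_measurable (restrict_space M U)" "finite_qe_on p M U u"
      "p_ae_curve_in p M U (\<lambda>l \<gamma>. continuous_on {0..l} (u \<circ> \<gamma>))"
  shows "quasicontinuous_on p M U u"
proof -
  have setsN: "sets N = sets borel" using N by (simp add: locally_finite_def)
  have U: "U \<in> sets M" by (rule quasiopen_imp(1)[OF p setsN M qo])
  have sp: "space M = UNIV" "sets borel \<subseteq> sets M"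
    using space_M[OF p setsN M] borel_sets_M[OF p setsN M] by auto
  define E where "E = {x \<in> U. \<bar>u x\<bar> = \<infinity>}"
  have "{x \<in> space (restrict_space M U). \<bar>u x\<bar> = \<infinity>} \<in> sets (restrict_space M U)"
    using u(1) by measurable
  then have "E \<in> sets M"
    using U sp by (simp add: E_def space_restrict_space sets_restrict_space_iff)
  have capE: "capacity p M E = 0" using u(2) by (simp add: finite_qe_on_def E_def)
  then have "E \<in> null_sets M"
    using emeasure_le_capacity[OF p \<open>E \<in> sets M\<close>] \<open>E \<in> sets M\<close> by (auto simp: null_sets_def)
  then obtain ZE where ZE: "ZE \<in> null_sets N" "E \<subseteq> ZE"
    unfolding M null_sets_completion_iff2 by blast
  \<comment> \<open>\<open>real_of_ereal\<close> sends infinite values to 0, so \<open>f\<close> is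
    1/2 there. This is harmless: \<open>E\<close> will be put into the exceptional set, and curves
    of finite weight avoid it.\<close>
  define f where "f x = 1 / 2 + arctan (real_of_ereal (u x)) / pi" for x
  have f01: "0 < f x" "f x < 1" for x
    using arctan_bounded[of "real_of_ereal (u x)"] by (auto simp: f_def field_simps)
  have f_meas: "f \<in> borel_measurable (restrict_space M U)"
    unfolding f_def using u(1) by measurable
  have f0_meas: "(\<lambda>x. if x \<in> U then f x else 0) \<in> borel_measurable M"
    "(\<lambda>x. if x \<in> U then 1 - f x else 0) \<in> borel_measurable M"
  proof -
    have "(\<lambda>x. indicator U x *\<^sub>R g x) \<in> borel_measurable M" if "g \<in> borel_measurable (restrict_space M U)" for g :: "'a \<Rightarrow> real"
      using that U sp by (subst borel_measurable_restrict_space_iff[symmetric]) auto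
    moreover have "(\<lambda>x. indicator U x *\<^sub>R g x) = (\<lambda>x. if x \<in> U then g x else 0)" for g :: "'a \<Rightarrow> real"
      by (auto simp: fun_eq_iff)
    ultimately show "(\<lambda>x. if x \<in> U then f x else 0) \<in> borel_measurable M"
      "(\<lambda>x. if x \<in> U then 1 - f x else 0) \<in> borel_measurable M"
      using f_meas borel_measurable_diff[OF borel_measurable_const[of 1] f_meas] by metis+
  qed
  obtain K where K: "\<And>j::nat. closed (K j)" "\<And>j. continuous_on (K j) (\<lambda>x. if x \<in> U then f x else 0)"
      "emeasure N (- (\<Union>j. K j)) = 0"
    by (rule Lusin_exhaustion[OF N f0_meas(1)[unfolded M]]) (rule that)
  \<comment> \<open>Both \<open>f\<close> and \<open>1 - f\<close> are extended by 0 off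
    \<open>U\<close>, so the second extension is not 1 minus the first and gets its own closed
    sets.\<close>
  obtain K' where K': "\<And>j::nat. closed (K' j)" "\<And>j. continuous_on (K' j) (\<lambda>x. if x \<in> U then 1 - f x else 0)"
      "emeasure N (- (\<Union>j. K' j)) = 0"
    by (rule Lusin_exhaustion[OF N f0_meas(2)[unfolded M]]) (rule that)
  define Z where "Z = - (\<Union>j. K j) \<union> - (\<Union>j. K' j)"
  have Z_borel: "Z \<in> sets borel" using K(1) K'(1) by (auto simp: Z_def)
  have Z_null: "Z \<in> null_sets N"
    unfolding Z_def using K(1,3) K'(1,3) setsN by (intro null_sets.Un) (auto simp: null_sets_def)
  obtain \<rho>1 where \<rho>1[measurable]: "\<rho>1 \<in> borel_measurable borel" and \<rho>1_int: "(\<integral>\<^sup>+x. enn_powr (\<rho>1 x) p \<partial>N) < \<infinity>"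
    and \<rho>1_cont: "\<And>l \<gamma>. arclength_curve (l, \<gamma>) \<Longrightarrow> \<gamma> ` {0..l} \<subseteq> U \<Longrightarrow> curve_integral (l, \<gamma>) \<rho>1 < \<infinity> \<Longrightarrow>
      continuous_on {0..l} (u \<circ> \<gamma>)"
    using u(3) unfolding p_ae_curve_in_def p_exceptional_def M nn_integral_completion by force
  obtain \<rho>2 where \<rho>2[measurable]: "\<rho>2 \<in> borel_measurable borel" and \<rho>2_int: "(\<integral>\<^sup>+x. enn_powr (\<rho>2 x) p \<partial>N) < \<infinity>"
    and \<rho>2_open: "\<And>l \<gamma>. arclength_curve (l, \<gamma>) \<Longrightarrow> curve_integral (l, \<gamma>) \<rho>2 < \<infinity> \<Longrightarrow>
      \<exists>V. open V \<and> \<gamma> ` {0..l} \<inter> V = \<gamma> ` {0..l} \<inter> U"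
    using quasiopen_imp(2)[OF p setsN M qo] by blast
  obtain \<rho>3 where \<rho>3[measurable]: "\<rho>3 \<in> borel_measurable borel" and \<rho>3_int: "(\<integral>\<^sup>+x. enn_powr (\<rho>3 x) p \<partial>N) < \<infinity>"
    and \<rho>3_E: "\<And>l \<gamma>. arclength_curve (l, \<gamma>) \<Longrightarrow> curve_integral (l, \<gamma>) \<rho>3 < \<infinity> \<Longrightarrow> \<gamma> ` {0..l} \<inter> E = {}"
    using capacity_zero_imp[OF p setsN M capE] by blast
  define \<rho>4 where "\<rho>4 x = (if x \<in> Z then top else 0 :: ennreal)" for x
  have \<rho>4[measurable]: "\<rho>4 \<in> borel_measurable borel" unfolding \<rho>4_def using Z_borel by measurable
  have \<rho>4_int: "(\<integral>\<^sup>+x. enn_powr (\<rho>4 x) p \<partial>N) = 0"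
  proof -
    have "AE x in N. enn_powr (\<rho>4 x) p = 0"
      using AE_not_in[OF Z_null] by eventually_elim (simp add: \<rho>4_def)
    then show ?thesis by (subst nn_integral_cong_AE[where v = "\<lambda>_. 0"]) auto
  qed
  \<comment> \<open>Finite \<open>\<rho>1\<close> gives continuity of \<open>u\<close> along a
    curve, finite \<open>\<rho>2\<close> relative openness of \<open>U\<close>, finite
    \<open>\<rho>3\<close> avoidance of the infinite values, and \<open>\<rho>4\<close> marks the
    Lusin null set.\<close>
  define \<rho>0 where "\<rho>0 x = max (max (\<rho>1 x) (\<rho>2 x)) (max (\<rho>3 x) (\<rho>4 x))" for x
  have \<rho>0: "\<rho>0 \<in> borel_measurable borel" unfolding \<rho>0_def by measurable
  have "(\<integral>\<^sup>+x. enn_powr (\<rho>0 x) p \<partial>N) \<le>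
      (\<integral>\<^sup>+x. (enn_powr (\<rho>1 x) p + enn_powr (\<rho>2 x) p) + (enn_powr (\<rho>3 x) p + enn_powr (\<rho>4 x) p) \<partial>N)"
    unfolding \<rho>0_def by (intro nn_integral_mono order_trans[OF enn_powr_max_le[OF p]] add_mono enn_powr_max_le[OF p])
  also have "\<dots> = ((\<integral>\<^sup>+x. enn_powr (\<rho>1 x) p \<partial>N) + (\<integral>\<^sup>+x. enn_powr (\<rho>2 x) p \<partial>N)) +
      ((\<integral>\<^sup>+x. enn_powr (\<rho>3 x) p \<partial>N) + (\<integral>\<^sup>+x. enn_powr (\<rho>4 x) p \<partial>N))"
  proof -
    have "(\<lambda>x. enn_powr (g x) p) \<in> borel_measurable N" if "g \<in> borel_measurable borel" for g :: "'a \<Rightarrow> ennreal"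
    proof -
      have "(\<lambda>x. enn_powr (g x) p) \<in> borel_measurable borel" using that by measurable
      then show ?thesis using setsN by (simp cong: measurable_cong_sets)
    qed
    then show ?thesis by (simp add: nn_integral_add \<rho>1 \<rho>2 \<rho>3 \<rho>4)
  qed
  also have "\<dots> < \<infinity>" using \<rho>1_int \<rho>2_int \<rho>3_int \<rho>4_int by simp
  finally have "(\<integral>\<^sup>+x. enn_powr (\<rho>0 x) p \<partial>N) < \<infinity>" .
  then obtain \<rho> where \<rho>: "lsc \<rho>" "\<And>x. \<rho>0 x \<le> \<rho> x" "\<And>x. 1 \<le> \<rho> x"
      "\<And>x r. (\<integral>\<^sup>+y\<in>ball x r. enn_powr (\<rho> y) p \<partial>N) < \<infinity>"
    by (rule ex_lsc_majorant[OF N \<rho>0 p]) (rule that)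
  interpret weight: lsc_weight N p \<rho>
    using proper N p \<rho> by unfold_locales auto
  have fin: "curve_integral c \<rho>1 < \<infinity>" "curve_integral c \<rho>2 < \<infinity>" "curve_integral c \<rho>3 < \<infinity>"
    if "curve_integral c \<rho> < \<infinity>" for c
  proof -
    have le: "curve_integral c g \<le> curve_integral c \<rho>" if "\<And>x. g x \<le> \<rho>0 x" for g
    proof -
      have "g x \<le> \<rho> x" for x using that \<rho>(2) by (rule order_trans)
      then show ?thesis
        unfolding curve_integral_def by (cases c) (auto intro!: nn_integral_mono mult_right_mono)
    qed
    show "curve_integral c \<rho>1 < \<infinity>" "curve_integral c \<rho>2 < \<infinity>" "curve_integral c \<rho>3 < \<infinity>"
      by (rule le_less_trans[OF le that], simp add: \<rho>0_def le_max_iff_disj)+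
  qed
  have arc: "\<exists>\<delta>>0. \<forall>t\<in>{0..l}. \<bar>t - t0\<bar> < \<delta> \<longrightarrow> \<gamma> t \<in> U \<and> \<bar>f (\<gamma> t) - f (\<gamma> t0)\<bar> < e"
    if \<gamma>: "arclength_curve (l, \<gamma>)" "curve_integral (l, \<gamma>) \<rho> < \<infinity>" and t0: "t0 \<in> {0..l}" "\<gamma> t0 \<in> U" and "0 < e"
    for l \<gamma> t0 e
  proof -
    have l: "0 < l" and cont\<gamma>: "continuous_on {0..l} \<gamma>" using \<gamma>(1) by (auto simp: arclength_curve_def)
    obtain V where V: "open V" "\<gamma> ` {0..l} \<inter> V = \<gamma> ` {0..l} \<inter> U"
      using \<rho>2_open[OF \<gamma>(1) fin(2)[OF \<gamma>(2)]] by blast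
    have "\<gamma> t0 \<in> V" using V(2) t0 by blast
    then have "\<forall>\<^sub>F t in at t0 within {0..l}. \<gamma> t \<in> V"
      using cont\<gamma> V(1) t0(1) unfolding continuous_on_def by (blast intro: topological_tendstoD)
    then obtain d where d: "d > 0" "\<And>t. t \<in> {0..l} \<Longrightarrow> t \<noteq> t0 \<Longrightarrow> \<bar>t - t0\<bar> < d \<Longrightarrow> \<gamma> t \<in> V"
      unfolding eventually_at dist_real_def by blast
    have dU: "\<gamma> t \<in> U" if "t \<in> {0..l}" "\<bar>t - t0\<bar> < d" for t
      using d(2)[OF that(1) _ that(2)] V(2) t0(2) that(1) by (cases "t = t0") auto
    \<comment> \<open>Half of \<open>d\<close> keeps the closed interval within the range on which
      \<open>\<gamma>\<close> lies in \<open>U\<close>; the cuts at \<open>0\<close> and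
      \<open>l\<close> cover the case that \<open>t0\<close> is an end point.\<close>
    define a where "a = max 0 (t0 - d / 2)"
    define b where "b = min l (t0 + d / 2)"
    have ab: "0 \<le> a" "a < b" "b \<le> l" "t0 \<in> {a..b}" using d(1) t0(1) l by (auto simp: a_def b_def)
    have abU: "\<gamma> ` {a..b} \<subseteq> U"
      using d(1) by (auto simp: a_def b_def intro!: dU)
    have "continuous_on {a..b} (u \<circ> \<gamma>)"
      by (rule continuous_on_subcurve[OF \<rho>1_cont \<rho>1 \<gamma>(1) fin(1)[OF \<gamma>(2)] ab(1-3) abU])
    moreover have "\<bar>(u \<circ> \<gamma>) t\<bar> \<noteq> \<infinity>" if "t \<in> {a..b}" for t
    proof -
      have "t \<in> {0..l}" using that ab by auto
      then have "\<gamma> t \<notin> E" using \<rho>3_E[OF \<gamma>(1) fin(3)[OF \<gamma>(2)]] by blast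
      moreover have "\<gamma> t \<in> U" using abU that by blast
      ultimately show ?thesis by (simp add: E_def)
    qed
    ultimately have "continuous_on {a..b} (real_of_ereal \<circ> (u \<circ> \<gamma>))"
      by (subst continuous_on_iff_real[symmetric])
    then have "continuous_on {a..b} (\<lambda>t. 1 / 2 + arctan ((real_of_ereal \<circ> (u \<circ> \<gamma>)) t) / pi)"
      by (intro continuous_on_add continuous_on_const continuous_on_divide continuous_on_arctan) auto
    then have "continuous_on {a..b} (\<lambda>t. f (\<gamma> t))" by (simp add: f_def o_def)
    then obtain d2 where d2: "d2 > 0" "\<And>t. t \<in> {a..b} \<Longrightarrow> \<bar>t - t0\<bar> < d2 \<Longrightarrow> \<bar>f (\<gamma> t) - f (\<gamma> t0)\<bar> < e"
      unfolding continuous_on_iff dist_real_def using ab(4) \<open>0 < e\<close> by blast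
    have "\<gamma> t \<in> U \<and> \<bar>f (\<gamma> t) - f (\<gamma> t0)\<bar> < e" if t: "t \<in> {0..l}" "\<bar>t - t0\<bar> < min (d / 2) d2" for t
    proof -
      have "\<bar>t - t0\<bar> < d / 2" using t(2) by simp
      then have "t0 - d / 2 \<le> t" "t \<le> t0 + d / 2" by linarith+
      then have "t \<in> {a..b}" using t(1) by (simp add: a_def b_def)
      then show ?thesis using abU d2(2) t by auto
    qed
    then show ?thesis using d(1) d2(1) by (intro exI[of _ "min (d / 2) d2"]) auto
  qed
  have cont: "\<exists>\<delta>>0. \<forall>t\<in>{0..l}. \<bar>t - t0\<bar> < \<delta> \<longrightarrow> \<gamma> t \<in> U \<and> \<bar>f (\<gamma> t) - f (\<gamma> t0)\<bar> < e"
    if "0 \<le> l" "lip1 \<gamma>" "curve_integral (l, \<gamma>) \<rho> < \<infinity>" "t0 \<in> {0..l}" "\<gamma> t0 \<in> U" "0 < e" for l \<gamma> t0 e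
    by (rule lip1_continuity_from_arclength[OF \<rho>(1) _ that]) (rule arc)
  have cont': "\<exists>\<delta>>0. \<forall>t\<in>{0..l}. \<bar>t - t0\<bar> < \<delta> \<longrightarrow> \<gamma> t \<in> U \<and> \<bar>(1 - f (\<gamma> t)) - (1 - f (\<gamma> t0))\<bar> < e"
    if "0 \<le> l" "lip1 \<gamma>" "curve_integral (l, \<gamma>) \<rho> < \<infinity>" "t0 \<in> {0..l}" "\<gamma> t0 \<in> U" "0 < e" for l \<gamma> t0 e
    using cont[OF that] by (simp add: abs_minus_commute)
  have \<rho>_top: "\<rho> x = \<infinity>" if "x \<in> Z" for x
    using \<rho>(2)[of x] that by (simp add: \<rho>0_def \<rho>4_def top_unique)
  \<comment> \<open>A 1-Lipschitz curve with distinct ends has positive length, so it has an arc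
    length version, which passes through \<open>E\<close>; then \<open>\<rho>3\<close>
    applies.\<close>
  have hitE: "curve_integral (l, \<gamma>) \<rho> = \<infinity>"
    if \<gamma>: "0 \<le> l" "lip1 \<gamma>" "\<gamma> 0 \<in> E" "\<gamma> l \<noteq> \<gamma> 0" for l \<gamma>
  proof (rule ccontr)
    assume "curve_integral (l, \<gamma>) \<rho> \<noteq> \<infinity>"
    then have finite: "curve_integral (l, \<gamma>) \<rho> < \<infinity>" by (simp add: less_top)
    obtain S \<gamma>' s where S: "0 \<le> S" "s ` {0..l} = {0..S}"
      and eq: "\<And>t. t \<in> {0..l} \<Longrightarrow> \<gamma> t = \<gamma>' (s t)"
      and lip: "\<And>t t'. t \<in> {0..l} \<Longrightarrow> t' \<in> {0..l} \<Longrightarrow> \<bar>s t - s t'\<bar> \<le> \<bar>t - t'\<bar>"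
      and a: "0 < S \<Longrightarrow> arclength_curve (S, \<gamma>')"
      and i: "\<And>\<rho>. 0 < S \<Longrightarrow> lsc \<rho> \<Longrightarrow> curve_integral (S, \<gamma>') \<rho> \<le> (\<integral>\<^sup>+t\<in>{0..l}. \<rho> (\<gamma> t) \<partial>lborel)"
      by (rule lip1_reparam[OF \<gamma>(2,1)]) (rule that)
    have s: "s 0 \<in> {0..S}" "s l \<in> {0..S}" using S(2) \<gamma>(1) by auto
    have "S \<noteq> 0"
    proof
      assume "S = 0"
      then show False using s eq[of 0] eq[of l] \<gamma>(1,4) by simp
    qed
    then have "0 < S" using S(1) by simp
    have "curve_integral (S, \<gamma>') \<rho> < \<infinity>"
      using i[OF \<open>0 < S\<close> \<rho>(1)] finite by (simp add: curve_integral_def le_less_trans)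
    then have "\<gamma>' ` {0..S} \<inter> E = {}" by (intro \<rho>3_E a \<open>0 < S\<close> fin)
    moreover have "\<gamma>' (s 0) \<in> E" using eq[of 0] \<gamma>(1,3) by simp
    ultimately show False using imageI[OF s(1), of \<gamma>'] by blast
  qed
  show ?thesis
    unfolding quasicontinuous_on_def
  proof (intro allI impI)
    fix \<epsilon> :: real assume "0 < \<epsilon>"
    \<comment> \<open>Three exceptional sets are joined by two applications of
      \<open>capacity_Un_less\<close>, each costing a factor 8.\<close>
    have e64: "0 < \<epsilon> / 64" "0 < \<epsilon> / 8" using \<open>0 < \<epsilon>\<close> by auto
    have "\<exists>G. open G \<and> capacity p M G < ennreal (\<epsilon> / 64) \<and>
        (\<forall>a. \<exists>V. open V \<and> {x \<in> U. a < f x} - G = V \<inter> U - G)"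
      unfolding M
    proof (rule weight.path_continuous_imp_lower_quasicontinuous[OF _ _ _ K(1,2,3) _ e64(1)])
      show "\<rho> x = \<infinity>" if "x \<notin> (\<Union>j. K j)" for x using that by (intro \<rho>_top) (simp add: Z_def)
    qed (rule less_imp_le[OF f01(1)] less_imp_le[OF f01(2)] cont; assumption)+
    then obtain G1 where G1: "open G1" "capacity p M G1 < ennreal (\<epsilon> / 64)"
        "\<And>a. \<exists>V. open V \<and> {x \<in> U. a < f x} - G1 = V \<inter> U - G1" by blast
    have "\<exists>G. open G \<and> capacity p M G < ennreal (\<epsilon> / 64) \<and>
        (\<forall>a. \<exists>V. open V \<and> {x \<in> U. a < 1 - f x} - G = V \<inter> U - G)"
      unfolding M
    proof (rule weight.path_continuous_imp_lower_quasicontinuous[OF _ _ _ K'(1,2,3) _ e64(1)])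
      show "\<rho> x = \<infinity>" if "x \<notin> (\<Union>j. K' j)" for x using that by (intro \<rho>_top) (simp add: Z_def)
      show "0 \<le> 1 - f x" "1 - f x \<le> 1" for x using f01[of x] by auto
    qed (rule cont'; assumption)
    then obtain G2 where G2: "open G2" "capacity p M G2 < ennreal (\<epsilon> / 64)"
        "\<And>a. \<exists>V. open V \<and> {x \<in> U. a < 1 - f x} - G2 = V \<inter> U - G2" by blast
    have "\<exists>G. open G \<and> E \<subseteq> G \<and> capacity p M G < ennreal (\<epsilon> / 8)"
      unfolding M
      by (rule weight.ex_open_small_capacity[OF _ _ ZE(2) hitE e64(2)]) (use ZE(1) setsN in \<open>auto simp: null_sets_def\<close>)
    then obtain G3 where G3: "open G3" "E \<subseteq> G3" "capacity p M G3 < ennreal (\<epsilon> / 8)" by blast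
    define G where "G = G1 \<union> G2 \<union> G3"
    have "open G" using G1 G2 G3 by (auto simp: G_def)
    moreover have "capacity p M G < ennreal \<epsilon>"
    proof -
      have G12: "capacity p M (G1 \<union> G2) < ennreal (\<epsilon> / 8)"
        using G1(2) G2(2) by (intro capacity_Un_less p e64 sp) auto
      show ?thesis
        unfolding G_def by (rule capacity_Un_less[OF p \<open>0 < \<epsilon>\<close> G12 G3(3) sp(2,1)])
    qed
    moreover have finite: "\<bar>u x\<bar> \<noteq> \<infinity>" if "x \<in> U - G" for x
      using that G3(2) by (auto simp: G_def E_def)
    moreover have "continuous_on (U - G) u"
    proof -
      \<comment> \<open>Sublevel sets of \<open>f\<close> are superlevel sets of
        \<open>1 - f\<close>, so the two one-sided statements combine to continuity.\<close>
      have contf: "continuous_on (U - G) f"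
      proof (rule continuous_on_from_level_sets)
        fix a
        obtain V where V: "open V" "{x \<in> U. a < f x} - G1 = V \<inter> U - G1" using G1(3) by blast
        then show "\<exists>V. open V \<and> {x \<in> U - G. a < f x} = V \<inter> (U - G)"
          by (intro exI[of _ V]) (auto simp: G_def)
        obtain W where W: "open W" "{x \<in> U. 1 - a < 1 - f x} - G2 = W \<inter> U - G2" using G2(3) by blast
        then show "\<exists>V. open V \<and> {x \<in> U - G. f x < a} = V \<inter> (U - G)"
          by (intro exI[of _ W]) (auto simp: G_def)
      qed
      have r_eq: "pi * (f x - 1 / 2) = arctan (real_of_ereal (u x))" for x
        by (simp add: f_def)
      have "continuous_on (U - G) (\<lambda>x. tan (pi * (f x - 1 / 2)))"
      proof (rule continuous_on_compose2[where g = tan and f = "\<lambda>x. pi * (f x - 1 / 2)"])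
        show "continuous_on {y. cos y \<noteq> 0} (tan :: real \<Rightarrow> real)"
          by (intro continuous_at_imp_continuous_on ballI isCont_tan) simp
        show "continuous_on (U - G) (\<lambda>x. pi * (f x - 1 / 2))" by (intro continuous_intros contf)
        show "(\<lambda>x. pi * (f x - 1 / 2)) ` (U - G) \<subseteq> {y. cos y \<noteq> 0}" by (auto simp: r_eq)
      qed
      then have "continuous_on (U - G) (real_of_ereal \<circ> u)" by (simp add: r_eq tan_arctan o_def)
      then show ?thesis using finite by (subst continuous_on_iff_real) auto
    qed
    ultimately show "\<exists>G. open G \<and> capacity p M G < ennreal \<epsilon> \<and>
        (\<forall>x\<in>U - G. \<bar>u x\<bar> \<noteq> \<infinity>) \<and> continuous_on (U - G) u"
      by (intro exI[of _ G] conjI ballI)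
  qed
qed

theorem theorem1p2:
  fixes M :: "'a::metric_space measure" and p :: real
    and U :: "'a set" and u :: "'a \<Rightarrow> ereal"
  assumes "1 \<le> p"
    and "complete_borel_measure M"
    and "\<And>x r. emeasure M (ball x r) < \<infinity>"
    and "complete (UNIV :: 'a set)"
    and "doubling M"
    and "poincare_inequality p M"
    and "quasiopen p M U"
  shows "quasicontinuous_on p M U u \<longleftrightarrow>
    u \<in> borel_measurable (restrict_space M U) \<and>
    finite_qe_on p M U u \<and>
    p_ae_curve_in p M U (\<lambda>l \<gamma>. continuous_on {0..l} (u \<circ> \<gamma>))"
proof -
  have p: "0 < p" using assms(1) by simp
  obtain N where setsN: "sets N = sets borel" and M: "M = completion N"
    using assms(2) unfolding complete_borel_measure_def by blast
  have N: "locally_finite N"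
    using assms(3) setsN by (simp add: locally_finite_def M)
  have "sets borel \<subseteq> sets M" using borel_sets_M[OF p setsN M] by blast
  \<comment> \<open>Completeness and doubling enter here, as compactness of closed balls.\<close>
  then have proper: "compact (cball x r)" for x :: 'a and r
    by (rule doubling_imp_compact_cball[OF assms(4,5)])
  show ?thesis
    using quasicontinuous_on_imp[OF p setsN M] quasicontinuous_onI[OF p N M proper assms(7)] by blast
qed

end
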